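(* Let $G$ be a simply connected four-dimensional solvable real Lie group, with Lie algebra $\mathfrak g$ written as in the list in the context, with basis $e_1,e_2,e_3,e_4$. Then the following list shows, for each Lie algebra and only in those cases when they exist, (i) representatives $\mathfrak q$ of the non-equivalent classes of invariant complex subalgebras of $\mathfrak g^{\mathbb C}$ (classes already known from work of J. Snow and of G. Ovando), and (ii) the general form $\mathcal Q$ of any invariant complex subalgebra of $\mathfrak g^{\mathbb C}$. The parameters $a_i,b_i,c_i,d_i$ are complex numbers subject to the stated conditions, and $\varepsilon=\pm1$ throughout. 1. $\mathfrak{rh}_3$. $\mathfrak q$: $\langle e_1+ie_2,\ e_3+ie_4\rangle$. $\mathcal Q$: $\langle e_1+b_1e_2+d_1e_4,\ e_3+d_2e_4\rangle$, $\operatorname{Im} b_1\operatorname{Im} d_2\neq0$. 2. $\mathfrak{rr}_{3,0}$. $\mathfrak q$: $\langle e_1+ie_2,\ e_3+ie_4\rangle$. $\mathcal Q$: $\langle e_1+b_1e_2+d_1e_4,\ e_3+d_2e_4\rangle$, $\operatorname{Im} b_1\operatorname{Im} d_2\neq0$. 3. $\mathfrak{rr}_{3,1}$. $\mathfrak q$: $\langle e_1+ie_4,\ e_3+ie_2\rangle$. $\mathcal Q$: $\langle e_1+b_1e_2+d_1e_4,\ b_2e_2+e_3\rangle$, $\operatorname{Im} b_2\operatorname{Im} d_1\neq0$. 4. $\mathfrak{rr}'_{3,\gamma}$, $\gamma\ge0$. $\mathfrak q$: for $\gamma=0$, $\langle e_1+ie_4,\ e_2+ie_3\rangle$; for $\gamma\neq0$,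 $\langle e_1+ie_4,\ e_2-(2\gamma+i)e_3\rangle$ and $\langle e_1+ie_4,\ e_2-(2\gamma-i)e_3\rangle$. $\mathcal Q$ (both for $\gamma=0$ and for $\gamma\ne0$): $\langle e_1+c_1e_3+d_1e_4,\ e_2-(2\gamma+\varepsilon i)e_3\rangle$, $\operatorname{Im} d_1\neq0$. 5. $\mathfrak r_2\mathfrak r_2$. $\mathfrak q$: $\langle e_1+ie_2,\ e_3+ie_4\rangle$. $\mathcal Q$: $\langle e_1+b_1e_2+d_1e_4,\ e_3+d_2e_4\rangle$, $\operatorname{Im} b_1\operatorname{Im} d_2\neq0$. 6. $\mathfrak r_2'$. $\mathfrak q$: $\langle e_1+ie_3,\ e_2+ie_4\rangle$; $\langle e_1+ib_1e_2,\ e_3+ie_4\rangle$ with $\operatorname{Im} b_1\neq0$. $\mathcal Q$: $\langle e_1+c_1e_3+d_1e_4,\ e_2-d_1e_3+c_1e_4\rangle$ with $(\operatorname{Im} c_1)^2+(\operatorname{Im} d_1)^2\neq0$; $\langle e_1+\varepsilon ie_2+d_1e_4,\ e_3-\varepsilon ie_4\rangle$; $\langle e_1+b_1e_2+d_1e_4,\ e_3+\varepsilon ie_4\rangle$ with $\operatorname{Im} b_1\neq0$. 7. $\mathfrak r_{4,1}$ (that is, $\mathfrak r_{4,\mu}$ with $\mu=1$). $\mathfrak q$: $\langle e_4+ie_3,\ e_1+ie_2\rangle$. $\mathcal Q$: $\langle e_4+b_1e_2+c_1e_3,\ e_1+b_2e_2\rangle$, $\operatorname{Im} c_1\operatorname{Im}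 b_2\neq0$. 8. $\mathfrak r_{4,\alpha,1}$, $\alpha\neq1$. $\mathfrak q$: $\langle e_4+ie_2,\ e_1+ie_3\rangle$. $\mathcal Q$: $\langle e_4+b_1e_2+c_1e_3,\ e_1+c_2e_3\rangle$, $\operatorname{Im} b_1\operatorname{Im} c_2\neq0$. 9. $\mathfrak r_{4,\alpha,\alpha}$, $\alpha\neq0,1$. $\mathfrak q$: $\langle e_4+ie_1,\ e_2+ie_3\rangle$. $\mathcal Q$: $\langle e_4+a_1e_1+c_1e_3,\ a_2e_1+e_2+c_2e_3\rangle$, $\operatorname{Im} c_1\operatorname{Im} a_2-\operatorname{Im} a_1\operatorname{Im} c_2\neq0$. 10. $\mathfrak r'_{4,\gamma,\delta}$. $\mathfrak q$: $\langle e_4+ie_1,\ e_2+ie_3\rangle$; $\langle e_4+ie_1,\ e_2-ie_3\rangle$. $\mathcal Q$: $\langle e_4+a_1e_1+c_1e_3,\ e_2+\varepsilon ie_3\rangle$, $\operatorname{Im} a_1\neq0$. 11. $\mathfrak d_4$. $\mathfrak q$: $\langle e_1-ie_3,\ e_4+ie_2\rangle$; $\langle e_4+i(e_2+e_3),\ e_1-ie_3\rangle$. $\mathcal Q$: $\langle e_4+b_1e_2+c_1e_3,\ e_1-b_1e_3\rangle$ with $\operatorname{Im} b_1\neq0$; $\langle e_4+a_1e_1+c_1e_3,\ e_2-a_1e_3\rangle$ with $\operatorname{Im} a_1\neq0$. 12. $\mathfrak d_{4,1}$. $\mathfrak q$: $\langle e_4-ie_1,\ e_2+ie_3\rangle$.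 $\mathcal Q$: $\langle e_4-c_2e_1+c_1e_3,\ e_2+c_2e_3\rangle$, $\operatorname{Im} c_2\neq0$. 13. $\mathfrak d_{4,1/2}$. $\mathfrak q$: $\langle e_4+ie_3,\ e_1+ie_2\rangle$; $\langle e_4+ie_3,\ e_1-ie_2\rangle$; $\langle e_4+ie_1,\ e_2-2ie_3\rangle$. $\mathcal Q$: $\langle e_4+b_1e_2+c_1e_3,\ e_1+b_2e_2+2b_1e_3\rangle$ with $2(\operatorname{Im} b_1)^2-\operatorname{Im} c_1\operatorname{Im} b_2\neq0$; $\langle e_4+a_1e_1+c_1e_3,\ a_2e_1+e_2-2a_1e_3\rangle$ with $2(\operatorname{Im} a_1)^2+\operatorname{Im} c_1\operatorname{Im} a_2\neq0$. 14. $\mathfrak d_{4,\lambda}$, $\lambda\neq\frac12,1$. $\mathfrak q$: $\langle e_4-\lambda ie_1,\ e_2+ie_3\rangle$; $\langle e_4+(1-\lambda)ie_2,\ e_1+ie_3\rangle$. $\mathcal Q$: $\langle e_4-\lambda c_2e_1+c_1e_3,\ e_2+c_2e_3\rangle$; $\langle e_4+(1-\lambda)c_2e_2+c_1e_3,\ e_1+c_2e_3\rangle$; in both cases $\operatorname{Im} c_2\neq0$. 15. $\mathfrak d'_{4,0}$. $\mathfrak q$: $\langle e_4-ie_3,\ e_1+ie_2\rangle$; $\langle e_4+ie_3,\ e_1+ie_2\rangle$. $\mathcal Q$: $\langle e_4+c_1e_3-\varepsilon ic_2e_2,\ c_2e_3+e_1+\varepsilon ie_2\rangle$, $\operatorname{Re}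 c_2\operatorname{Im} c_2+\operatorname{Im} c_1\neq0$. 16. $\mathfrak d'_{4,\delta}$, $\delta>0$. $\mathfrak q$: $\langle e_4+ie_3,\ e_1-ie_2\rangle$; $\langle e_4-ie_3,\ e_1+ie_2\rangle$; $\langle e_4+ie_3,\ e_1+ie_2\rangle$; $\langle e_4-ie_3,\ e_1-ie_2\rangle$. $\mathcal Q$: $\langle e_4+c_1e_3+(\frac\delta2-\varepsilon i)c_2e_2,\ e_1+\varepsilon ie_2+c_2e_3\rangle$, $\varepsilon\operatorname{Im} c_1+\operatorname{Im} c_2\left(-\frac\delta2\operatorname{Im} c_2-\varepsilon\operatorname{Re} c_2\right)\neq0$. 17. $\mathfrak h_4$. $\mathfrak q$: $\langle e_4+ie_2,\ e_1+2ie_3\rangle$. $\mathcal Q$: $\langle e_4+b_1e_2+c_1e_3,\ e_1+2b_1e_3\rangle$, $\operatorname{Im} b_1\neq0$.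
   Context: $\langle v_1,\dots,v_k\rangle$ denotes the linear span (over $\mathbb C$ in the claim). For a real Lie algebra $\mathfrak g$, let $\mathfrak g^{\mathbb C}=\mathfrak g\otimes_{\mathbb R}\mathbb C$ and let $\sigma$ be the conjugation $\sigma(X+iY)=X-iY$ for $X,Y\in\mathfrak g$. An invariant complex subalgebra is a complex Lie subalgebra $\mathfrak q\subset\mathfrak g^{\mathbb C}$ such that $\mathfrak g^{\mathbb C}=\mathfrak q\oplus\sigma\mathfrak q$ as vector spaces. These correspond bijectively to left invariant complex structures $J$ on $G$, via $J=-i$ on $\mathfrak q$ and $J=i$ on $\sigma\mathfrak q$. Two invariant complex subalgebras $\mathfrak q_1,\mathfrak q_2$ are equivalent if there is $y\in\operatorname{Aut}(\mathfrak g^{\mathbb C})$ with $y\sigma=\sigma y$ and $y\mathfrak q_1=\mathfrak q_2$. List of Lie algebras: every four-dimensional solvable real Lie algebra is isomorphic to one and only one of the following, with basis $e_1,\dots,e_4$; brackets of basis vectors not determined by those listed (via antisymmetry) are zero. $\mathfrak a_4$: abelian. $\mathfrak{rh}_3$: $[e_1,e_2]=e_3$. $\mathfrak{rr}_3$: $[e_1,e_2]=e_2$, $[e_1,e_3]=e_2+e_3$. $\mathfrak{rr}_{3,\lambda}$, $\lambda\in[-1,1]$: $[e_1,e_2]=e_2$, $[e_1,e_3]=\lambda e_3$. $\mathfrak{rr}'_{3,\gamma}$, $\gamma\ge0$: $[e_1,e_2]=\gamma e_2-e_3$, $[e_1,e_3]=e_2+\gamma e_3$. $\mathfrak r_2\mathfrak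 r_2$: $[e_1,e_2]=e_2$, $[e_3,e_4]=e_4$. $\mathfrak r_2'$: $[e_1,e_3]=e_3$, $[e_1,e_4]=e_4$, $[e_2,e_3]=e_4$, $[e_2,e_4]=-e_3$. $\mathfrak n_4$: $[e_4,e_1]=e_2$, $[e_4,e_2]=e_3$. $\mathfrak r_4$: $[e_4,e_1]=e_1$, $[e_4,e_2]=e_1+e_2$, $[e_4,e_3]=e_2+e_3$. $\mathfrak r_{4,\mu}$, $\mu\in\mathbb R$: $[e_4,e_1]=e_1$, $[e_4,e_2]=\mu e_2$, $[e_4,e_3]=e_2+\mu e_3$. $\mathfrak r_{4,\alpha,\beta}$, $\alpha\beta\ne0$, $-1\le\alpha\le\beta\le1$: $[e_4,e_1]=e_1$, $[e_4,e_2]=\alpha e_2$, $[e_4,e_3]=\beta e_3$. $\mathfrak r'_{4,\gamma,\delta}$, $\gamma\in\mathbb R$, $\delta>0$: $[e_4,e_1]=e_1$, $[e_4,e_2]=\gamma e_2-\delta e_3$, $[e_4,e_3]=\delta e_2+\gamma e_3$. $\mathfrak d_4$: $[e_1,e_2]=e_3$, $[e_4,e_1]=e_1$, $[e_4,e_2]=-e_2$. $\mathfrak d_{4,\lambda}$, $\lambda\ge\frac12$: $[e_1,e_2]=e_3$, $[e_4,e_3]=e_3$, $[e_4,e_1]=\lambda e_1$, $[e_4,e_2]=(1-\lambda)e_2$. $\mathfrak d'_{4,\delta}$, $\delta\ge0$: $[e_1,e_2]=e_3$, $[e_4,e_1]=\frac\delta2e_1-e_2$, $[e_4,e_3]=\delta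 e_3$, $[e_4,e_2]=e_1+\frac\delta2e_2$. $\mathfrak h_4$: $[e_1,e_2]=e_3$, $[e_4,e_3]=e_3$, $[e_4,e_1]=\frac12e_1$, $[e_4,e_2]=e_1+\frac12e_2$.
   Formalization: Corrected: item 4 (γ>0) has e2∓ie3 for e2−(2γ±i)e3; items 5 and 9 require Q to be a subalgebra; item 6 reads ib1 as b1 and adds q ⟨e1+ie2+e4, e3+ie4⟩; item 16 condition has +εRe c2; nothing is claimed for a4 and r4,1,1, which do have such subalgebras. *)

theory Defs
  imports "HOL-Analysis.Analysis"
begin

section \<open>Complexification, conjugation, invariant complex subalgebras\<close>

text \<open>
  A real Lie algebra with a fixed ordered basis is given by its bracket on \<open>real ^ 'n\<close>, the basis
  being the standard one; its complexification then has underlying space \<open>complex ^ 'n\<close>.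
\<close>

definition real_lie_bracket :: "(real ^ 'n \<Rightarrow> real ^ 'n \<Rightarrow> real ^ 'n) \<Rightarrow> bool" where
  "real_lie_bracket br \<longleftrightarrow>
     bilinear br \<and> (\<forall>x. br x x = 0) \<and>
     (\<forall>x y z. br x (br y z) + br y (br z x) + br z (br x y) = 0)"

definition re_part :: "complex ^ 'n \<Rightarrow> real ^ 'n" where
  "re_part z = (\<chi> i. Re (z $ i))"

definition im_part :: "complex ^ 'n \<Rightarrow> real ^ 'n" where
  "im_part z = (\<chi> i. Im (z $ i))"

definition of_real_vec :: "real ^ 'n \<Rightarrow> complex ^ 'n" where
  "of_real_vec x = (\<chi> i. complex_of_real (x $ i))"

text \<open>\<open>[X + iY, Z + iW] = ([X, Z] - [Y, W]) + i([X, W] + [Y, Z])\<close> for real \<open>X, Y, Z, W\<close>.\<close>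

definition complexified ::
    "(real ^ 'n \<Rightarrow> real ^ 'n \<Rightarrow> real ^ 'n) \<Rightarrow> complex ^ 'n \<Rightarrow> complex ^ 'n \<Rightarrow> complex ^ 'n" where
  "complexified br z w =
     of_real_vec (br (re_part z) (re_part w) - br (im_part z) (im_part w)) +
     \<i> *s of_real_vec (br (re_part z) (im_part w) + br (im_part z) (re_part w))"

definition conj_vec :: "complex ^ 'n \<Rightarrow> complex ^ 'n" where
  "conj_vec z = of_real_vec (re_part z) - \<i> *s of_real_vec (im_part z)"

definition complex_subalgebra ::
    "(real ^ 'n \<Rightarrow> real ^ 'n \<Rightarrow> real ^ 'n) \<Rightarrow> (complex ^ 'n) set \<Rightarrow> bool" where
  "complex_subalgebra br q \<longleftrightarrow>
     vec.subspace q \<and> (\<forall>z\<in>q. \<forall>w\<in>q. complexified br z w \<in> q)"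

definition invariant_complex_subalgebra ::
    "(real ^ 'n \<Rightarrow> real ^ 'n \<Rightarrow> real ^ 'n) \<Rightarrow> (complex ^ 'n) set \<Rightarrow> bool" where
  "invariant_complex_subalgebra br q \<longleftrightarrow>
     complex_subalgebra br q \<and>
     q \<inter> conj_vec ` q = {0} \<and> {z + w | z w. z \<in> q \<and> w \<in> conj_vec ` q} = UNIV"

definition complex_automorphism ::
    "(real ^ 'n \<Rightarrow> real ^ 'n \<Rightarrow> real ^ 'n) \<Rightarrow> (complex ^ 'n \<Rightarrow> complex ^ 'n) \<Rightarrow> bool" where
  "complex_automorphism br y \<longleftrightarrow>
     Vector_Spaces.linear (*s) (*s) y \<and> bij y \<and>
     (\<forall>z w. y (complexified br z w) = complexified br (y z) (y w))"

definition equivalent_subalgebras ::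
    "(real ^ 'n \<Rightarrow> real ^ 'n \<Rightarrow> real ^ 'n) \<Rightarrow> (complex ^ 'n) set \<Rightarrow> (complex ^ 'n) set \<Rightarrow> bool" where
  "equivalent_subalgebras br q q' \<longleftrightarrow>
     (\<exists>y. complex_automorphism br y \<and> y \<circ> conj_vec = conj_vec \<circ> y \<and> y ` q = q')"

definition span_pair :: "(complex ^ 'n) \<times> (complex ^ 'n) \<Rightarrow> (complex ^ 'n) set" where
  "span_pair p = vec.span {fst p, snd p}"

text \<open>
  Subalgebras are listed by pairs of spanning vectors: \<open>R\<close> lists one representative for each
  equivalence class (different entries of \<open>R\<close> being non-equivalent), and \<open>Q\<close> lists the
  invariant complex subalgebras themselves.
\<close>

definition classified_by ::
    "(real ^ 'n \<Rightarrow> real ^ 'n \<Rightarrow> real ^ 'n) \<Rightarrow>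
     ((complex ^ 'n) \<times> (complex ^ 'n)) set \<Rightarrow> ((complex ^ 'n) \<times> (complex ^ 'n)) set \<Rightarrow> bool" where
  "classified_by br R Q \<longleftrightarrow>
     (\<forall>p\<in>R. invariant_complex_subalgebra br (span_pair p)) \<and>
     (\<forall>p\<in>R. \<forall>p'\<in>R. p \<noteq> p' \<longrightarrow> \<not> equivalent_subalgebras br (span_pair p) (span_pair p')) \<and>
     (\<forall>q. invariant_complex_subalgebra br q \<longrightarrow>
        (\<exists>p\<in>R. equivalent_subalgebras br (span_pair p) q)) \<and>
     (\<forall>q. invariant_complex_subalgebra br q \<longleftrightarrow> (\<exists>p\<in>Q. q = span_pair p))"


section \<open>The four-dimensional solvable real Lie algebras\<close>

text \<open>
  The index type \<open>4\<close> has elements \<open>1, 2, 3, 4\<close> (where \<open>4 = 0\<close>), so \<open>e 1, ..., e 4\<close> is the whole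
  standard basis.
\<close>

abbreviation e :: "4 \<Rightarrow> 'a::{zero,one} ^ 4" where
  "e i \<equiv> axis i 1"

text \<open>
  An entry \<open>(i, j, v)\<close> stands for \<open>[e i, e j] = v\<close> (hence \<open>[e j, e i] = -v\<close>); brackets of basis
  vectors not determined by the entries vanish.
\<close>

definition lie_table :: "(4 \<times> 4 \<times> (real ^ 4)) list \<Rightarrow> real ^ 4 \<Rightarrow> real ^ 4 \<Rightarrow> real ^ 4" where
  "lie_table T x y = (\<Sum>(i, j, v) \<leftarrow> T. (x $ i * y $ j - x $ j * y $ i) *\<^sub>R v)"

definition "rh3 = lie_table [(1, 2, e 3)]"

definition "rr3 = lie_table [(1, 2, e 2), (1, 3, e 2 + e 3)]"

definition "rr3_par l = lie_table [(1, 2, e 2), (1, 3, l *\<^sub>R e 3)]"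

definition "rr3' g = lie_table [(1, 2, g *\<^sub>R e 2 - e 3), (1, 3, e 2 + g *\<^sub>R e 3)]"

definition "r2r2 = lie_table [(1, 2, e 2), (3, 4, e 4)]"

definition "r2' = lie_table [(1, 3, e 3), (1, 4, e 4), (2, 3, e 4), (2, 4, - e 3)]"

definition "n4 = lie_table [(4, 1, e 2), (4, 2, e 3)]"

definition "r4 = lie_table [(4, 1, e 1), (4, 2, e 1 + e 2), (4, 3, e 2 + e 3)]"

definition "r4_par m = lie_table [(4, 1, e 1), (4, 2, m *\<^sub>R e 2), (4, 3, e 2 + m *\<^sub>R e 3)]"

definition "r4_par2 a b = lie_table [(4, 1, e 1), (4, 2, a *\<^sub>R e 2), (4, 3, b *\<^sub>R e 3)]"

definition "r4' g d = lie_table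
  [(4, 1, e 1), (4, 2, g *\<^sub>R e 2 - d *\<^sub>R e 3), (4, 3, d *\<^sub>R e 2 + g *\<^sub>R e 3)]"

definition "d4 = lie_table [(1, 2, e 3), (4, 1, e 1), (4, 2, - e 2)]"

definition "d4_par l = lie_table
  [(1, 2, e 3), (4, 3, e 3), (4, 1, l *\<^sub>R e 1), (4, 2, (1 - l) *\<^sub>R e 2)]"

definition "d4' d = lie_table
  [(1, 2, e 3), (4, 1, (d / 2) *\<^sub>R e 1 - e 2), (4, 3, d *\<^sub>R e 3), (4, 2, e 1 + (d / 2) *\<^sub>R e 2)]"

definition "h4 = lie_table
  [(1, 2, e 3), (4, 3, e 3), (4, 1, (1 / 2) *\<^sub>R e 1), (4, 2, e 1 + (1 / 2) *\<^sub>R e 2)]"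

lemmas lie_algebra_defs =
  rh3_def rr3_def rr3_par_def rr3'_def r2r2_def r2'_def n4_def r4_def r4_par_def r4_par2_def
  r4'_def d4_def d4_par_def d4'_def h4_def

lemma bilinear_lie_table: "bilinear (lie_table T)"
  by (induction T)
     (auto simp: bilinear_def linear_iff lie_table_def algebra_simps scaleR_add_left
       split: prod.splits)

lemma real_lie_bracket_listed:
  "real_lie_bracket rh3" "real_lie_bracket rr3" "real_lie_bracket (rr3_par l)"
  "real_lie_bracket (rr3' g)" "real_lie_bracket r2r2" "real_lie_bracket r2'"
  "real_lie_bracket n4" "real_lie_bracket r4" "real_lie_bracket (r4_par m)"
  "real_lie_bracket (r4_par2 a b)" "real_lie_bracket (r4' g d)" "real_lie_bracket d4"
  "real_lie_bracket (d4_par l)" "real_lie_bracket (d4' d)" "real_lie_bracket h4"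
  unfolding real_lie_bracket_def lie_algebra_defs
  by (simp_all add: bilinear_lie_table,
      simp_all add: lie_table_def vec_eq_iff forall_4 axis_def,
      simp_all add: algebra_simps add_divide_distrib diff_divide_distrib)

text \<open>
  Where the published classification is false as printed, the statement uses the following corrected
  entries.

  \<^item> \<open>rr3' \<gamma>\<close>, \<open>\<gamma> > 0\<close>: printed with \<open>e 2 - (2\<gamma> \<plusminus> i) e 3\<close>, which is not an eigenvector of \<open>ad (e 1)\<close>
    (the eigenvectors are \<open>e 2 \<plusminus> i e 3\<close>), so the printed spans are not subalgebras.
  \<^item> \<open>r2'\<close>: a representative is printed as \<open>\<langle>e 1 + i b1 e 2, e 3 + i e 4\<rangle>\<close>, \<open>Im b1 \<noteq> 0\<close>, which for
    \<open>b1 = i\<close> contains a real vector; \<open>i b1\<close> is read as \<open>b1\<close>. The class of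
    \<open>\<langle>e 1 + i e 2 + e 4, e 3 + i e 4\<rangle>\<close> is missing and has been added.
  \<^item> \<open>d4' \<delta>\<close>, \<open>\<delta> > 0\<close>: the term \<open>\<epsilon> Re c2\<close> in the condition is printed with a minus sign.
  \<^item> \<open>r2r2\<close> and \<open>r4_par2 \<alpha> \<alpha>\<close>: the printed parameters also describe subspaces that are not subalgebras
    (\<open>d1 \<noteq> 0\<close>, respectively \<open>a2 \<noteq> 0\<close>), so being a subalgebra is an explicit condition.
  \<^item> The abelian algebra and \<open>r4_par2 1 1\<close> have invariant complex subalgebras but no entry; nothing is
    asserted about them. For all other algebras without an entry, nonexistence is asserted.
\<close>

end

(*
  If e_j is not in the derived algebra, an invariant complex subalgebra q meets the coordinate
  hyperplane z_j = 0 in a line C w and contains a vector v with v_j = 1; so q = <v, w> with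
  [v, w] = kappa w, and since w is not a multiple of a real vector, column reduction leaves only two
  shapes for (v, w). In these shapes g^C = q + sigma q says that one 2 x 2 determinant of imaginary
  parts does not vanish, and [v, w] = kappa w becomes a small polynomial system, solved algebra by
  algebra. An equivalence of subalgebras is a real matrix respecting the bracket; its invertibility
  is automatic, because its range contains q and sigma q. Inequivalence of the representatives comes
  from kappa, which an automorphism can change by a real factor only, and from the entries of such a
  matrix.
*)
theory Submission
  imports Defs
begin

section \<open>Complexification of a bracket given by a table\<close>

text \<open>If the hyperplane \<open>z $ j = 0\<close> is an abelian ideal, then [v, w] = [e_j, w],
  so \<open>w\<close> must be an eigenvector of ad e_j that is not a multiple of a real vector. This
  needs a non-real eigenvalue or an eigenvalue with a two-dimensional eigenspace, which accounts for
  every case of nonexistence and for the special parameter values there. In the algebras with a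
  Heisenberg ideal e_1, e_2, e_3, the scale of e_3 is the determinant of the map on e_1, e_2.
  Lengths can then be normalized; where the sign of that determinant is forced, a sign survives as
  an extra invariant. The factor \<open>A $ j $ j\<close> decides whether conjugate eigenvalues give
  one class or two: \<kappa> = \<gamma> + i and \<gamma> - i differ by a real factor only if
  \<gamma> = 0 and the factor is -1. In \<open>rr3' 0\<close> and \<open>d4' 0\<close> an
  automorphism reversing e_j exists and identifies the two; in \<open>r4'\<close> the eigenvalue 1
  on e_1 forbids it.\<close>

lemma conj_vec_nth [simp]: "conj_vec z $ i = cnj (z $ i)"
  by (simp add: conj_vec_def of_real_vec_def re_part_def im_part_def complex_eq_iff)

lemma of_real_vec_nth [simp]: "of_real_vec x $ i = complex_of_real (x $ i)"
  by (simp add: of_real_vec_def)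

lemma conj_vec_idem [simp]: "conj_vec (conj_vec z) = z"
  by (simp add: vec_eq_iff)

lemma conj_vec_add: "conj_vec (z + w) = conj_vec z + conj_vec w"
  by (simp add: vec_eq_iff)

lemma conj_vec_scale: "conj_vec (a *s z) = cnj a *s conj_vec z"
  by (simp add: vec_eq_iff)

text \<open>Expanding the products into real and imaginary parts reproduces the four real brackets
  in \<open>complexified\<close>; from here on all computation is in complex coordinates.\<close>

lemma complexified_lie_table:
  "complexified (lie_table T) z w =
     (\<Sum>(i, j, v) \<leftarrow> T. (z $ i * w $ j - z $ j * w $ i) *s of_real_vec v)"
  by (induction T)
     (auto simp: complexified_def lie_table_def vec_eq_iff complex_eq_iff re_part_def im_part_def
        algebra_simps)

lemma complexified_lie_table_simps:
  "complexified (lie_table []) z w = 0"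
  "complexified (lie_table ((i, j, v) # T)) z w =
     (z $ i * w $ j - z $ j * w $ i) *s of_real_vec v + complexified (lie_table T) z w"
  by (simp_all add: complexified_lie_table)

lemma lie_table_simps:
  "lie_table [] x y = 0"
  "lie_table ((i, j, v) # T) x y = (x $ i * y $ j - x $ j * y $ i) *\<^sub>R v + lie_table T x y"
  by (simp_all add: lie_table_def)

text \<open>The bracket is bilinear and alternating, so on a plane it sees only the determinant of
  the coefficients. Hence closure of a span is a condition on one single bracket.\<close>

lemma complexified_lie_table_pair:
  "complexified (lie_table T) (a *s v + b *s w) (c *s v + d *s w) =
     (a * d - b * c) *s complexified (lie_table T) v w"
  by (induction T) (auto simp: complexified_lie_table_simps vec_eq_iff algebra_simps)

text \<open>The coordinate form of the condition that the derived algebra lies in the hyperplane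
  \<open>z $ j = 0\<close>; the first index of every normal form below has this property.\<close>

lemma complexified_lie_table_nth_eq_0:
  assumes "\<forall>(i, i', v)\<in>set T. v $ j = 0"
  shows "complexified (lie_table T) z w $ j = 0"
  using assms
proof (induction T)
  case (Cons t T)
  obtain i i' v where t: "t = (i, i', v)"
    by (cases t)
  have "v $ j = 0" "complexified (lie_table T) z w $ j = 0"
    using Cons by (auto simp: t)
  then show ?case
    by (simp add: t complexified_lie_table_simps)
qed (simp add: complexified_lie_table_simps)

section \<open>Invariant complex subalgebras in normal form\<close>

lemma span_pair_iff: "z \<in> span_pair (v, w) \<longleftrightarrow> (\<exists>a b. z = a *s v + b
    *s w)"
  unfolding span_pair_def by (auto simp: vec.span_breakdown_eq algebra_simps)

lemma span_pair_swap: "span_pair (v, w) = span_pair (w, v)"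
  by (simp add: span_pair_def insert_commute)

text \<open>Triangular changes with non-zero diagonal serve both the reduction to normal form and
  the comparison of an image with its target.\<close>

lemma span_pair_shear:
  assumes "s \<noteq> 0" "c \<noteq> 0"
  shows "span_pair (s *s v + t *s w, c *s w) = span_pair (v, w)"
proof -
  have "\<exists>a' b'. a *s (s *s v + t *s w) + b *s (c *s w) = a' *s v + b' *s w" for a b
    by (rule exI[of _ "a * s"], rule exI[of _ "a * t + b * c"]) (simp add: vec_eq_iff algebra_simps)
  moreover have "\<exists>a' b'. a *s v + b *s w = a' *s (s *s v + t *s w) + b' *s (c *s w)" for a b
    by (rule exI[of _ "a / s"], rule exI[of _ "(b - a / s * t) / c"])
       (use assms in \<open>simp add: vec_eq_iff field_simps\<close>)
  ultimately show ?thesis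
    by (auto simp: set_eq_iff span_pair_iff)
qed

lemma subspace_span_pair: "vec.subspace (span_pair p)"
  by (simp add: span_pair_def)

lemma complex_subalgebra_span_pair:
  "complex_subalgebra (lie_table T) (span_pair (v, w)) \<longleftrightarrow>
     complexified (lie_table T) v w \<in> span_pair (v, w)"
proof
  assume "complex_subalgebra (lie_table T) (span_pair (v, w))"
  moreover have "v \<in> span_pair (v, w)" "w \<in> span_pair (v, w)"
    by (auto simp: span_pair_def intro: vec.span_base)
  ultimately show "complexified (lie_table T) v w \<in> span_pair (v, w)"
    by (simp add: complex_subalgebra_def)
next
  assume *: "complexified (lie_table T) v w \<in> span_pair (v, w)"
  have "complexified (lie_table T) z z' \<in> span_pair (v, w)"
    if zz': "z \<in> span_pair (v, w)" "z' \<in> span_pair (v, w)" for z z'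
  proof -
    obtain a b c d where "z = a *s v + b *s w" "z' = c *s v + d *s w"
      using zz' unfolding span_pair_iff by blast
    then show ?thesis
      using vec.subspace_scale[OF subspace_span_pair *] by (metis complexified_lie_table_pair)
  qed
  then show "complex_subalgebra (lie_table T) (span_pair (v, w))"
    by (simp add: complex_subalgebra_def subspace_span_pair)
qed

section \<open>Dimension of an invariant complex subalgebra\<close>

lemma conj_vec_span: "conj_vec ` vec.span B = vec.span (conj_vec ` B)"
proof -
  \<comment> \<open>Conjugation is only semilinear, so this inclusion goes by induction over linear
    combinations. Applied to the conjugate of \<open>B\<close> it gives the reverse inclusion,
    because conjugation is an involution.\<close>
  have *: "conj_vec ` vec.span B \<subseteq> vec.span (conj_vec ` B)" for B :: "(complex ^ 'n) set"
  proof clarify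
    fix z assume "z \<in> vec.span B"
    then show "conj_vec z \<in> vec.span (conj_vec ` B)"
    proof (induction rule: vec.span_induct_alt)
      case base
      have "conj_vec 0 = (0 :: complex ^ 'n)"
        by (simp add: vec_eq_iff)
      then show ?case
        by (simp add: vec.span_zero)
    next
      case (step c x y)
      then show ?case
        by (simp add: conj_vec_add conj_vec_scale vec.span_add vec.span_scale vec.span_base)
    qed
  qed
  have "conj_vec ` (conj_vec ` vec.span (conj_vec ` B)) \<subseteq> conj_vec ` vec.span B"
    using *[of "conj_vec ` B"] by (intro image_mono) (simp add: image_image)
  then have "vec.span (conj_vec ` B) \<subseteq> conj_vec ` vec.span B"
    by (simp only: image_image conj_vec_idem image_ident)
  then show ?thesis
    using * by blast
qed

text \<open>The conjugate of a basis still spans the conjugate. One inequality suffices, since it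
  can be applied to the conjugate subspace as well.\<close>

lemma dim_conj_vec_le:
  assumes "vec.subspace q"
  shows "vec.dim (conj_vec ` q) \<le> vec.dim q"
proof -
  obtain B where B: "B \<subseteq> q" "vec.independent B" "q \<subseteq> vec.span B" "card B =
      vec.dim q"
    using vec.basis_exists by blast
  have "finite B"
    using B(2) vec.independent_bound_general by blast
  have "conj_vec ` q \<subseteq> vec.span (conj_vec ` B)"
    using B(3) conj_vec_span[of B] by blast
  then have "vec.dim (conj_vec ` q) \<le> card (conj_vec ` B)"
    using \<open>finite B\<close> by (simp add: vec.dim_le_card)
  then show ?thesis
    using card_image_le[OF \<open>finite B\<close>, of conj_vec] B(4) by simp
qed

text \<open>Conjugation preserves the complex dimension, and the dimension formula applies to a
  direct sum that fills the whole space.\<close>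

lemma dim_invariant_complex_subalgebra:
  fixes q :: "(complex ^ 'n) set"
  assumes "invariant_complex_subalgebra br q"
  shows "2 * vec.dim q = CARD('n)"
proof -
  have q: "vec.subspace q" and int: "q \<inter> conj_vec ` q = {0}"
    and sum: "{z + w | z w. z \<in> q \<and> w \<in> conj_vec ` q} = UNIV"
    using assms by (auto simp: invariant_complex_subalgebra_def complex_subalgebra_def)
  have span_q: "vec.span q = q"
    using q by simp
  have q': "vec.subspace (conj_vec ` q)"
    using conj_vec_span[of q] span_q by (metis vec.subspace_span)
  have "vec.dim q \<le> vec.dim (conj_vec ` q)"
    using dim_conj_vec_le[OF q'] by (simp add: image_image)
  then have "vec.dim (conj_vec ` q) = vec.dim q"
    using dim_conj_vec_le[OF q] by simp
  moreover have "{z + w | z w. z \<in> q \<and> w \<in> conj_vec ` q} = {x + y | x y. x \<in> q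
      \<and> y \<in> conj_vec ` q}"
    by auto
  ultimately show ?thesis
    using vec.dim_sums_Int[OF q q'] sum int
    by (simp add: vec_dim_card del: vec.dim_UNIV)
qed

text \<open>Otherwise the coordinate would vanish on the conjugate too, hence on the whole sum,
  which contains the \<open>j\<close>-th basis vector.\<close>

lemma nth_nonzero_in_invariant_complex_subalgebra:
  assumes "invariant_complex_subalgebra br q"
  shows "\<exists>v\<in>q. v $ j \<noteq> 0"
proof (rule ccontr)
  assume *: "\<not> ?thesis"
  have "axis j 1 \<in> {z + w | z w. z \<in> q \<and> w \<in> conj_vec ` q}"
    using assms by (simp add: invariant_complex_subalgebra_def)
  then obtain z w where "axis j 1 = z + conj_vec w" "z \<in> q" "w \<in> q"
    by blast
  then have "(axis j 1 :: complex ^ 'a) $ j = 0"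
    using * by simp
  then show False
    by simp
qed

text \<open>On the plane \<open>q\<close> the functional \<open>z $ j\<close> is non-zero, so its
  kernel is a line; \<open>w\<close> spans it, and \<open>v\<close> is normalized to value
  1.\<close>

lemma invariant_complex_subalgebra_adapted_pair:
  fixes q :: "(complex ^ 4) set"
  assumes "invariant_complex_subalgebra br q"
  obtains v w where "q = span_pair (v, w)" "v $ j = 1" "w $ j = 0" "w \<noteq> 0"
proof -
  have q: "vec.subspace q"
    using assms by (simp add: invariant_complex_subalgebra_def complex_subalgebra_def)
  have dim: "vec.dim q = 2"
    using dim_invariant_complex_subalgebra[OF assms] by simp
  obtain B where B: "B \<subseteq> q" "vec.independent B" "q \<subseteq> vec.span B" "card B = 2"
    using vec.basis_exists[of q] dim by metis
  obtain x y where xy: "B = {x, y}" "x \<noteq> y"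
    using B(4) by (auto simp: card_2_iff)
  have "vec.span B = q"
    using B(1,3) q by (metis vec.span_minimal subset_antisym)
  then have qxy: "q = span_pair (x, y)"
    by (simp add: xy span_pair_def)
  have "\<exists>x y. q = span_pair (x, y) \<and> x $ j \<noteq> 0"
  proof (cases "x $ j = 0 \<and> y $ j = 0")
    case True
    then have "\<forall>z\<in>q. z $ j = 0"
      by (auto simp: qxy span_pair_iff)
    then show ?thesis
      using nth_nonzero_in_invariant_complex_subalgebra[OF assms] by blast
  qed (use qxy span_pair_swap in metis)
  then obtain x y where xy: "q = span_pair (x, y)" "x $ j \<noteq> 0"
    by blast
  define v w where "v = (1 / x $ j) *s x" and "w = y - (y $ j) *s v"
  have "span_pair (y, x) = span_pair (w, v)"
    using span_pair_shear[of 1 "1 / x $ j" y "- (y $ j / x $ j)" x] xy(2)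
    by (simp add: v_def w_def algebra_simps)
  then have span: "q = span_pair (v, w)"
    using xy(1) span_pair_swap by metis
  have "w \<noteq> 0"
  proof
    assume "w = 0"
    then have "q \<subseteq> vec.span {v}"
      by (simp add: span span_pair_def insert_commute)
    then have "vec.dim q \<le> card {v}"
      using vec.dim_le_card by blast
    then show False
      using dim by simp
  qed
  then show thesis
    using that[OF span] xy(2) by (simp add: v_def w_def)
qed

text \<open>Reduced echelon form with pivot coordinates \<open>j\<close> and \<open>k\<close>. The
  second shape, in which \<open>w\<close> has no \<open>k\<close> component, is the same form with
  \<open>k\<close> and \<open>l\<close> exchanged and \<open>x = 0\<close>.\<close>

definition normal_pair ::
    "4 \<Rightarrow> 4 \<Rightarrow> 4 \<Rightarrow> 4 \<Rightarrow> complex \<Rightarrow> complex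
        \<Rightarrow> complex \<Rightarrow> complex \<Rightarrow> (complex ^ 4) \<times> (complex
        ^ 4)" where
  "normal_pair j k l m b c x y = (e j + b *s e l + c *s e m, e k + x *s e l + y *s e m)"

text \<open>Keeping the indices variable lets the determinant criterion and the reduction be proved
  once for all orders in use.\<close>

definition coordinate_order :: "4 \<Rightarrow> 4 \<Rightarrow> 4 \<Rightarrow> 4 \<Rightarrow>
    bool" where
  "coordinate_order j k l m \<longleftrightarrow> distinct [j, k, l, m] \<and> UNIV = {j, k, l, m}"

lemma vec_eq_iff_coordinate_order:
  assumes "coordinate_order j k l m"
  shows "z = w \<longleftrightarrow> z $ j = w $ j \<and> z $ k = w $ k \<and> z $ l = w $ l
      \<and> z $ m = w $ m"
proof -
  have "(\<forall>i. P i) \<longleftrightarrow> P j \<and> P k \<and> P l \<and> P m" for P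
    using assms unfolding coordinate_order_def by (metis UNIV_I empty_iff insert_iff)
  then show ?thesis
    by (simp add: vec_eq_iff)
qed

lemma axis_nth_coordinate_order:
  assumes "coordinate_order j k l m"
  shows "axis j a $ k = 0" "axis j a $ l = 0" "axis j a $ m = 0"
    "axis k a $ j = 0" "axis k a $ l = 0" "axis k a $ m = 0"
    "axis l a $ j = 0" "axis l a $ k = 0" "axis l a $ m = 0"
    "axis m a $ j = 0" "axis m a $ k = 0" "axis m a $ l = 0"
  using assms by (auto simp: coordinate_order_def axis_def)

text \<open>The pivot coordinates of a combination of \<open>v\<close> and \<open>w\<close> are its
  coefficients, so a real element has real coefficients, and these must annihilate the imaginary
  parts in coordinates \<open>l\<close> and \<open>m\<close>. Non-zero real solutions exist exactly
  when the 2 by 2 determinant vanishes.\<close>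

lemma invariant_normal_pair_iff:
  assumes o: "coordinate_order j k l m"
  shows "invariant_complex_subalgebra br (span_pair (normal_pair j k l m b c x y))
      \<longleftrightarrow>
    complex_subalgebra br (span_pair (normal_pair j k l m b c x y)) \<and> Im b * Im y \<noteq> Im
        c * Im x"
proof -
  note coords = vec_eq_iff_coordinate_order[OF o] axis_nth_coordinate_order[OF o]
  obtain v w where vw: "normal_pair j k l m b c x y = (v, w)"
    by (cases "normal_pair j k l m b c x y")
  then have nth: "v $ j = 1" "v $ k = 0" "v $ l = b" "v $ m = c"
    "w $ j = 0" "w $ k = 1" "w $ l = x" "w $ m = y"
    by (auto simp: coords normal_pair_def)
  have "Im b * Im y \<noteq> Im c * Im x"
    if int: "span_pair (v, w) \<inter> conj_vec ` span_pair (v, w) = {0}"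
  proof
    assume D: "Im b * Im y = Im c * Im x"
    have *: "of_real \<alpha> = (0::complex)" "of_real \<beta> = (0::complex)"
      if "\<alpha> * Im b + \<beta> * Im x = 0" "\<alpha> * Im c + \<beta> * Im y = 0" for
          \<alpha> \<beta> :: real
    proof -
      let ?z = "of_real \<alpha> *s v + of_real \<beta> *s w"
      have z: "?z \<in> span_pair (v, w)"
        by (auto simp: span_pair_iff)
      have "conj_vec ?z = ?z"
        using that by (simp add: coords nth complex_eq_iff)
      then have "?z \<in> conj_vec ` span_pair (v, w)"
        using z by (metis image_eqI)
      then have "?z = 0"
        using z int by blast
      then show "of_real \<alpha> = (0::complex)" "of_real \<beta> = (0::complex)"
        by (auto simp: coords nth)
    qed
    \<comment> \<open>If the determinant vanishes, the first two pairs lie in the kernel of the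
      matrix of imaginary parts, so all its entries vanish; then (1, 0) lies in the kernel as well
      and gives 1 = 0.\<close>
    show False
      using *[of "Im x" "- Im b"] *[of "Im y" "- Im c"] *[of 1 0] D
      by (auto simp: algebra_simps)
  qed
  moreover have "span_pair (v, w) \<inter> conj_vec ` span_pair (v, w) = {0}"
    "{z + z' | z z'. z \<in> span_pair (v, w) \<and> z' \<in> conj_vec ` span_pair (v, w)} = UNIV"
    if D: "Im b * Im y \<noteq> Im c * Im x"
  proof -
    let ?D = "complex_of_real (Im b * Im y - Im c * Im x)"
    have D': "?D \<noteq> 0"
      using D by (simp only: of_real_eq_0_iff right_minus_eq not_False_eq_True)
    have "z = 0" if z: "z \<in> span_pair (v, w)" "z \<in> conj_vec ` span_pair (v, w)" for z
    proof -
      obtain \<alpha> \<beta> where ab: "z = \<alpha> *s v + \<beta> *s w"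
        using z(1) by (auto simp: span_pair_iff)
      obtain \<alpha>' \<beta>' where ab': "z = conj_vec (\<alpha>' *s v + \<beta>' *s w)"
        using z(2) by (auto simp: span_pair_iff image_iff)
      have eq: "\<alpha> *s v + \<beta> *s w = conj_vec (\<alpha>' *s v + \<beta>' *s w)"
        using ab ab' by simp
      then have "\<alpha> = cnj \<alpha>'" "\<beta> = cnj \<beta>'"
        by (simp_all add: coords nth)
      with eq have "\<alpha> * (b - cnj b) + \<beta> * (x - cnj x) = 0" "\<alpha> * (c - cnj c) +
          \<beta> * (y - cnj y) = 0"
        by (simp_all add: coords nth algebra_simps)
      then have 1: "\<alpha> * of_real (Im b) + \<beta> * of_real (Im x) = 0"
        "\<alpha> * of_real (Im c) + \<beta> * of_real (Im y) = 0"
        by (simp_all add: complex_diff_cnj) (auto simp: complex_eq_iff)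
      have "\<alpha> * ?D = 0" "\<beta> * ?D = 0"
        using 1 by (simp_all, algebra+)
      then show "z = 0"
        using ab D' by simp
    qed
    moreover have "0 \<in> span_pair (v, w) \<inter> conj_vec ` span_pair (v, w)"
    proof
      show "0 \<in> span_pair (v, w)"
        by (simp add: vec.subspace_0 subspace_span_pair)
      then show "0 \<in> conj_vec ` span_pair (v, w)"
        by (rule rev_image_eqI) (simp add: vec_eq_iff)
    qed
    ultimately show "span_pair (v, w) \<inter> conj_vec ` span_pair (v, w) = {0}"
      by blast
    have "z \<in> {z + z' | z z'. z \<in> span_pair (v, w) \<and> z' \<in> conj_vec ` span_pair
        (v, w)}" for z
    proof -
      \<comment> \<open>Sought are coefficients with \<open>\<alpha> + \<alpha>' = z $ j\<close> and
        \<open>\<alpha> - \<alpha>' = - \<i> * s\<close>, likewise with \<open>\<beta>\<close>,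
        \<open>z $ k\<close> and \<open>t\<close>. Coordinates \<open>l\<close> and \<open>m\<close>
        then become a linear system for \<open>s\<close>, \<open>t\<close> with the imaginary parts
        as matrix and \<open>f\<close>, \<open>g\<close> as right-hand side, solved by Cramer's
        rule.\<close>
      define f g where "f = z $ l - (z $ j * of_real (Re b) + z $ k * of_real (Re x))"
        and "g = z $ m - (z $ j * of_real (Re c) + z $ k * of_real (Re y))"
      define s t where "s = (f * of_real (Im y) - g * of_real (Im x)) / ?D"
        and "t = (g * of_real (Im b) - f * of_real (Im c)) / ?D"
      have st: "s * of_real (Im b) + t * of_real (Im x) = f" "s * of_real (Im c) + t * of_real (Im
          y) = g"
      proof -
        have "?D * (s * of_real (Im b) + t * of_real (Im x)) = ?D * f"
          "?D * (s * of_real (Im c) + t * of_real (Im y)) = ?D * g"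
          using D' by (simp_all add: s_def t_def distrib_left del: of_real_diff of_real_mult)
            (simp_all add: algebra_simps)
        then show "s * of_real (Im b) + t * of_real (Im x) = f"
          "s * of_real (Im c) + t * of_real (Im y) = g"
          using D' by (simp_all only: mult_cancel_left simp_thms)
      qed
      define \<alpha> \<alpha>' \<beta> \<beta>' where "\<alpha> = (z $ j - \<i> * s) / 2" and
          "\<alpha>' = (z $ j + \<i> * s) / 2"
        and "\<beta> = (z $ k - \<i> * t) / 2" and "\<beta>' = (z $ k + \<i> * t) / 2"
      have "\<alpha> * b + \<beta> * x + (\<alpha>' * cnj b + \<beta>' * cnj x) = z $ l"
        "\<alpha> * c + \<beta> * y + (\<alpha>' * cnj c + \<beta>' * cnj y) = z $ m"
        using st unfolding f_def g_def \<alpha>_def \<alpha>'_def \<beta>_def \<beta>'_def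
        by (auto simp: complex_eq_iff field_simps)
      then have "z = (\<alpha> *s v + \<beta> *s w) + conj_vec (cnj \<alpha>' *s v + cnj \<beta>'
          *s w)"
        by (simp add: coords nth) (simp add: \<alpha>_def \<alpha>'_def \<beta>_def \<beta>'_def
            field_simps)
      then show ?thesis
        by (force simp: span_pair_iff)
    qed
    then show "{z + z' | z z'. z \<in> span_pair (v, w) \<and> z' \<in> conj_vec ` span_pair (v,
        w)} = UNIV"
      by blast
  qed
  ultimately show ?thesis
    unfolding vw invariant_complex_subalgebra_def by blast
qed

text \<open>A bracket has no \<open>j\<close> coordinate, so it lies in the span only as a multiple
  of \<open>w\<close>; as \<open>w $ k = 1\<close>, the factor \<kappa> is read off in coordinate
  \<open>k\<close>.\<close>

lemma invariant_complex_subalgebra_normal_pair: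
  assumes o: "coordinate_order j k l m"
    and T: "\<forall>(i, i', v)\<in>set T. v $ j = 0"
    and vw: "(v, w) = normal_pair j k l m b c x y"
  shows "invariant_complex_subalgebra (lie_table T) (span_pair (normal_pair j k l m b c x y))
      \<longleftrightarrow>
    Im b * Im y \<noteq> Im c * Im x \<and>
    complexified (lie_table T) v w = (complexified (lie_table T) v w $ k) *s w"
proof -
  note coords = vec_eq_iff_coordinate_order[OF o] axis_nth_coordinate_order[OF o]
  have nth: "v $ j = 1" "v $ k = 0" "v $ l = b" "v $ m = c"
    "w $ j = 0" "w $ k = 1" "w $ l = x" "w $ m = y"
    using vw by (simp_all add: coords normal_pair_def)
  let ?B = "complexified (lie_table T) v w"
  have "?B \<in> span_pair (v, w) \<longleftrightarrow> ?B = (?B $ k) *s w"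
  proof
    assume "?B \<in> span_pair (v, w)"
    then obtain a d where ad: "?B = a *s v + d *s w"
      by (auto simp: span_pair_iff)
    have "?B $ j = 0"
      by (rule complexified_lie_table_nth_eq_0[OF T])
    then have "a = 0"
      using ad nth by simp
    then show "?B = (?B $ k) *s w"
      using ad nth by simp
  next
    assume "?B = (?B $ k) *s w"
    then show "?B \<in> span_pair (v, w)"
      unfolding span_pair_iff by (metis add_0 vector_smult_lzero)
  qed
  then show ?thesis
    using invariant_normal_pair_iff[OF o, of "lie_table T" b c x y]
    unfolding vw[symmetric] complex_subalgebra_span_pair by blast
qed

lemma invariant_complex_subalgebra_normal_form:
  assumes o: "coordinate_order j k l m"
    and inv: "invariant_complex_subalgebra br q"
  obtains (first) b c x y where "q = span_pair (normal_pair j k l m b c x y)"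
  | (second) b c y where "q = span_pair (normal_pair j l k m b c 0 y)"
proof -
  note coords = vec_eq_iff_coordinate_order[OF o] axis_nth_coordinate_order[OF o]
  obtain v w where vw: "q = span_pair (v, w)" "v $ j = 1" "w $ j = 0" "w \<noteq> 0"
    using invariant_complex_subalgebra_adapted_pair[OF inv] by metis
  have norm: "q = span_pair (v - (v $ i / w $ i) *s w, (1 / w $ i) *s w)" if "w $ i \<noteq> 0"
      for i
    using span_pair_shear[of 1 "1 / w $ i" v "- (v $ i / w $ i)" w] that vw(1) by simp
  show thesis
  proof (cases "w $ k = 0")
    case False
    have "(v - (v $ k / w $ k) *s w, (1 / w $ k) *s w) =
      normal_pair j k l m (v $ l - v $ k * w $ l / w $ k) (v $ m - v $ k * w $ m / w $ k)
        (w $ l / w $ k) (w $ m / w $ k)"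
      using False vw(2,3) by (simp add: coords normal_pair_def)
    then show thesis
      using norm[OF False] that(1) by metis
  next
    case k: True
    show thesis
    proof (cases "w $ l = 0")
      case False
      have "(v - (v $ l / w $ l) *s w, (1 / w $ l) *s w) =
        normal_pair j l k m (v $ k) (v $ m - v $ l * w $ m / w $ l) 0 (w $ m / w $ l)"
        using False vw(2,3) k by (simp add: coords normal_pair_def)
      then show thesis
        using norm[OF False] that(2) by metis
    next
      case True
      \<comment> \<open>Only coordinate \<open>m\<close> of \<open>w\<close> survives here, so
        \<open>?z\<close> is the real vector e_m, which would lie in both \<open>q\<close> and its
        conjugate.\<close>
      let ?z = "(1 / w $ m) *s w"
      have "w $ m \<noteq> 0"
      proof
        assume "w $ m = 0"
        then have "w = 0"
          using True k vw(3) by (simp add: coords)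
        then show False
          using vw(4) by simp
      qed
      then have "conj_vec ?z = ?z" and nz: "?z \<noteq> 0"
        using True k vw(3,4) by (auto simp: coords(1)[of "conj_vec _"])
      moreover have "?z = 0 *s v + (1 / w $ m) *s w"
        by simp
      then have "?z \<in> q"
        unfolding vw(1) span_pair_iff by blast
      ultimately have "?z \<in> q \<inter> conj_vec ` q"
        by (metis IntI image_eqI)
      then show thesis
        using inv nz unfolding invariant_complex_subalgebra_def by blast
    qed
  qed
qed

text \<open>Index 1 lies outside the derived algebra of \<open>rh3\<close>, the \<open>rr3\<close>
  family, \<open>r2r2\<close> and \<open>r2'\<close>, index 4 outside that of the others. The orders
  come in pairs that exchange \<open>k\<close> and \<open>l\<close>, one for each of the two
  shapes.\<close>

lemma coordinate_order:
  "coordinate_order 1 3 2 4" "coordinate_order 1 2 3 4"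
  "coordinate_order 4 1 2 3" "coordinate_order 4 2 1 3"
  unfolding coordinate_order_def UNIV_4 by auto

lemmas invariant_normal_pair_1324 =
  invariant_complex_subalgebra_normal_pair[OF coordinate_order(1) _ normal_pair_def[symmetric]]
lemmas invariant_normal_pair_1234 =
  invariant_complex_subalgebra_normal_pair[OF coordinate_order(2) _ normal_pair_def[symmetric]]
lemmas invariant_normal_pair_4123 =
  invariant_complex_subalgebra_normal_pair[OF coordinate_order(3) _ normal_pair_def[symmetric]]
lemmas invariant_normal_pair_4213 =
  invariant_complex_subalgebra_normal_pair[OF coordinate_order(4) _ normal_pair_def[symmetric]]

lemmas invariant_normal_pair =
  invariant_normal_pair_1324 invariant_normal_pair_1234
  invariant_normal_pair_4123 invariant_normal_pair_4213

lemmas coordinates = complexified_lie_table_simps vec_eq_iff forall_4 axis_def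

section \<open>Equivalence through real matrices\<close>

definition complexified_map :: "real ^ 'n ^ 'n \<Rightarrow> complex ^ 'n \<Rightarrow> complex ^
    'n" where
  "complexified_map A z = (\<Sum>i\<in>UNIV. z $ i *s of_real_vec (A $ i))"

text \<open>The rows of \<open>A\<close> are the images of the basis vectors.\<close>

definition bracket_matrix ::
    "(real ^ 'n \<Rightarrow> real ^ 'n \<Rightarrow> real ^ 'n) \<Rightarrow> real ^ 'n ^ 'n
        \<Rightarrow> bool" where
  "bracket_matrix br A \<longleftrightarrow>
     (\<forall>i j. br (A $ i) (A $ j) = (\<Sum>k\<in>UNIV. br (axis i 1) (axis j 1) $ k *\<^sub>R
         A $ k))"

lemma complexified_map_nth:
  "complexified_map A z $ k = (\<Sum>i\<in>UNIV. z $ i * of_real (A $ i $ k))"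
  by (simp add: complexified_map_def)

lemma complexified_map_add: "complexified_map A (z + w) = complexified_map A z + complexified_map
    A w"
  by (simp add: vec_eq_iff complexified_map_nth algebra_simps sum.distrib)

lemma complexified_map_scale: "complexified_map A (c *s z) = c *s complexified_map A z"
  by (simp add: vec_eq_iff complexified_map_nth algebra_simps sum_distrib_left)

lemma linear_complexified_map: "Vector_Spaces.linear (*s) (*s) (complexified_map A)"
  by (simp add: Vector_Spaces.linear_iff vec.vector_space_axioms complexified_map_add
      complexified_map_scale)

lemma complexified_map_conj_vec: "complexified_map A (conj_vec z) = conj_vec (complexified_map A z)"
  by (simp add: vec_eq_iff complexified_map_nth)

text \<open>Bilinear maps that agree on basis vectors agree, which gives the real statement for the
  linear map \<open>L\<close>; the complexified bracket is made of real brackets of real and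
  imaginary parts, so the statement carries over.\<close>

lemma complexified_map_bracket:
  assumes br: "bilinear br" and A: "bracket_matrix br A"
  shows "complexified_map A (complexified br z w) =
    complexified br (complexified_map A z) (complexified_map A w)"
proof -
  define L where "L x = (\<Sum>i\<in>UNIV. x $ i *\<^sub>R A $ i)" for x :: "real ^ 'a"
  have "linear L"
    by (rule linearI)
      (simp_all add: L_def vec_eq_iff algebra_simps sum.distrib sum_distrib_left)
  have "(\<lambda>x y. L (br x y)) = (\<lambda>x y. br (L x) (L y))"
  proof (rule bilinear_eq_stdbasis)
    show "bilinear (\<lambda>x y. L (br x y))" "bilinear (\<lambda>x y. br (L x) (L y))"
      using br \<open>linear L\<close> unfolding bilinear_def
      by (auto intro: linear_compose[unfolded o_def])
    have "L (axis i 1) = A $ i" for i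
      by (simp add: L_def axis_def vec_eq_iff if_distrib sum.delta if_distribR cong: if_cong)
    moreover have "(A $ i) = x \<Longrightarrow> (A $ j) = y \<Longrightarrow> br x y = L (br
        (axis i 1) (axis j 1))" for i j x y
      using A by (auto simp: bracket_matrix_def L_def)
    ultimately show "L (br x y) = br (L x) (L y)" if "x \<in> Basis" "y \<in> Basis" for x y
      using that by (auto simp: Basis_vec_def)
  qed
  then have hom: "L (br x y) = br (L x) (L y)" for x y
    by meson
  have re_im: "re_part (of_real_vec x + \<i> *s of_real_vec y) = x"
    "im_part (of_real_vec x + \<i> *s of_real_vec y) = y" for x y :: "real ^ 'a"
    by (simp_all add: re_part_def im_part_def vec_eq_iff)
  have L: "re_part (complexified_map A u) = L (re_part u)" "im_part (complexified_map A u) = L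
      (im_part u)" for u
    by (simp_all add: re_part_def im_part_def L_def complexified_map_nth vec_eq_iff)
  have "re_part (complexified_map A (complexified br z w)) =
      re_part (complexified br (complexified_map A z) (complexified_map A w))"
    "im_part (complexified_map A (complexified br z w)) =
      im_part (complexified br (complexified_map A z) (complexified_map A w))"
    by (simp_all only: L complexified_def re_im linear_diff[OF \<open>linear L\<close>]
        linear_add[OF \<open>linear L\<close>] hom)
  then show ?thesis
    by (simp add: re_part_def im_part_def vec_eq_iff complex_eq_iff)
qed

lemma image_span_pair:
  assumes "\<And>z w. f (z + w) = f z + f w" "\<And>c z. f (c *s z) = c *s f z"
  shows "f ` span_pair (v, w) = span_pair (f v, f w)"
proof -
  have "f (a *s v + b *s w) = a *s f v + b *s f w" for a b
    by (simp add: assms)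
  then show ?thesis
    by (simp add: set_eq_iff image_iff Bex_def span_pair_iff) metis
qed

text \<open>For a concrete matrix only polynomial identities in its entries remain to be checked.
  The numbers \<open>s\<close>, \<open>t\<close>, \<open>c\<close> record in which triangular way
  the images of \<open>v0\<close>, \<open>w0\<close> span the target.\<close>

lemma equivalent_subalgebrasI:
  assumes br: "bilinear br" and A: "bracket_matrix br A"
    and nz: "s \<noteq> 0" "c \<noteq> 0"
    and v: "complexified_map A v0 = s *s fst p + t *s snd p"
    and w: "complexified_map A w0 = c *s snd p"
    and inv: "invariant_complex_subalgebra br (span_pair p)"
  shows "equivalent_subalgebras br (span_pair (v0, w0)) (span_pair p)"
proof -
  let ?y = "complexified_map A"
  let ?q = "span_pair p"
  have image: "?y ` span_pair (v0, w0) = ?q"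
    using image_span_pair[of ?y v0 w0] span_pair_shear[OF nz, of "fst p" t "snd p"] v w
    by (simp add: complexified_map_add complexified_map_scale)
  have "z \<in> range ?y" for z
  proof -
    have "z \<in> {z + w | z w. z \<in> ?q \<and> w \<in> conj_vec ` ?q}"
      using inv by (simp add: invariant_complex_subalgebra_def)
    then obtain a b where "z = a + conj_vec b" "a \<in> ?q" "b \<in> ?q"
      by blast
    moreover obtain a' b' where "a = ?y a'" "b = ?y b'"
      using calculation image by blast
    ultimately have "z = ?y (a' + conj_vec b')"
      by (simp add: complexified_map_add complexified_map_conj_vec)
    then show ?thesis
      by blast
  qed
  then have "surj ?y"
    by blast
  moreover have "inj ?y"
    using vec.linear_surjective_imp_injective[OF linear_complexified_map \<open>surj ?y\<close>]
        by simp
  ultimately have "complex_automorphism br ?y"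
    by (simp add: complex_automorphism_def linear_complexified_map bij_def
        complexified_map_bracket[OF br A])
  moreover have "?y \<circ> conj_vec = conj_vec \<circ> ?y"
    by (simp add: fun_eq_iff complexified_map_conj_vec)
  ultimately show ?thesis
    unfolding equivalent_subalgebras_def using image by blast
qed

text \<open>An automorphism commuting with conjugation maps the standard basis to real vectors, so
  it is the complex extension of a real matrix.\<close>

lemma equivalent_subalgebrasE:
  assumes br: "bilinear br" and eq: "equivalent_subalgebras br q q'"
  obtains A where "bracket_matrix br A" "inj (complexified_map A)" "complexified_map A ` q = q'"
proof -
  obtain y where lin: "Vector_Spaces.linear (*s) (*s) y" and bij: "bij y"
    and hom: "\<And>z w. y (complexified br z w) = complexified br (y z) (y w)"
    and comm: "y \<circ> conj_vec = conj_vec \<circ> y" and image: "y ` q = q'"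
    using eq by (auto simp: equivalent_subalgebras_def complex_automorphism_def)
  define A where "A = (\<chi> i. re_part (y (axis i 1)))"
  have real: "y (axis i 1) = of_real_vec (A $ i)" for i
  proof -
    have "conj_vec (axis i 1 :: complex ^ 'a) = axis i 1"
      by (simp add: vec_eq_iff axis_def)
    then have "conj_vec (y (axis i 1)) = y (axis i 1)"
      using comm by (metis comp_apply)
    then have "cnj (y (axis i 1) $ k) = y (axis i 1) $ k" for k
      by (metis conj_vec_nth)
    then have "Im (y (axis i 1) $ k) = 0" for k
      by (metis Reals_cnj_iff complex_is_Real_iff)
    then show ?thesis
      by (simp add: A_def vec_eq_iff complex_eq_iff re_part_def)
  qed
  have y: "y z = complexified_map A z" for z
  proof -
    have "z = (\<Sum>i\<in>UNIV. z $ i *s axis i 1)"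
      by (simp add: vec_eq_iff axis_def if_distrib cong: if_cong)
    then have "y z = y (\<Sum>i\<in>UNIV. z $ i *s axis i 1)"
      by simp
    also have "\<dots> = (\<Sum>i\<in>UNIV. z $ i *s y (axis i 1))"
      using lin by (simp add: vec.linear_sum vec.linear_scale)
    finally show ?thesis
      by (simp add: complexified_map_def real)
  qed
  have zero: "br x 0 = 0" "br 0 x = 0" for x
    using br by (simp_all add: bilinear_rzero bilinear_lzero)
  have real_part: "re_part (of_real_vec x) = x" "im_part (of_real_vec x) = 0" for x :: "real ^ 'a"
    by (simp_all add: vec_eq_iff re_part_def im_part_def)
  have of_real_br: "complexified br (of_real_vec x) (of_real_vec x') = of_real_vec (br x x')" for
      x x'
    by (simp add: complexified_def real_part zero vec_eq_iff)
  have "br (A $ i) (A $ j) = (\<Sum>k\<in>UNIV. br (axis i 1) (axis j 1) $ k *\<^sub>R A $ k)" for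
      i j
  proof -
    have axis: "axis i 1 = (of_real_vec (axis i 1) :: complex ^ 'a)" for i
      by (simp add: vec_eq_iff axis_def)
    have "of_real_vec (br (A $ i) (A $ j)) = y (complexified br (axis i 1) (axis j 1))"
      by (simp add: hom real of_real_br)
    also have "complexified br (axis i 1) (axis j 1) = of_real_vec (br (axis i 1) (axis j 1))"
      unfolding axis[of i] axis[of j] of_real_br ..
    finally have "complex_of_real (br (A $ i) (A $ j) $ n) =
        of_real ((\<Sum>k\<in>UNIV. br (axis i 1) (axis j 1) $ k *\<^sub>R A $ k) $ n)" for n
      by (auto simp: y vec_eq_iff complexified_map_nth)
    then show ?thesis
      unfolding of_real_eq_iff by (simp add: vec_eq_iff)
  qed
  then have "bracket_matrix br A"
    by (simp add: bracket_matrix_def)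
  moreover have "y = complexified_map A"
    using y by blast
  ultimately show thesis
    using that bij image by (simp add: bij_def)
qed

text \<open>Allows non-equivalence of two differently shaped representatives to be proved in one
  direction only.\<close>

lemma equivalent_subalgebras_sym:
  assumes "equivalent_subalgebras br q q'"
  shows "equivalent_subalgebras br q' q"
proof -
  obtain y where lin: "Vector_Spaces.linear (*s) (*s) y" and bij: "bij y"
    and hom: "\<And>z w. y (complexified br z w) = complexified br (y z) (y w)"
    and comm: "y \<circ> conj_vec = conj_vec \<circ> y" and image: "y ` q = q'"
    using assms by (auto simp: equivalent_subalgebras_def complex_automorphism_def)
  have inv: "inv y (y z) = z" "y (inv y z) = z" for z
    using bij by (simp_all add: bij_is_inj bij_is_surj surj_f_inv_f)
  have inv_add: "inv y (z + w) = inv y z + inv y w" for z w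
    by (metis inv lin vec.linear_add)
  have inv_scale: "inv y (c *s z) = c *s inv y z" for c z
    by (metis inv lin vec.linear_scale)
  have "Vector_Spaces.linear (*s) (*s) (inv y)"
    using lin by (auto simp: Vector_Spaces.linear_iff inv_add inv_scale)
  moreover have "inv y (complexified br z w) = complexified br (inv y z) (inv y w)" for z w
    by (metis hom inv)
  moreover have "inv y (conj_vec z) = conj_vec (inv y z)" for z
    by (metis comm comp_apply inv)
  moreover have "inv y ` q' = q"
    using image bij by (metis bij_is_inj image_inv_f_f)
  ultimately show ?thesis
    unfolding equivalent_subalgebras_def complex_automorphism_def
    using bij bij_imp_bij_inv by (intro exI[of _ "inv y"]) auto
qed

text \<open>
  For a matrix preserving \<open>z $ j = 0\<close>, the factor in \<open>\<kappa> = m *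
      \<kappa>'\<close> is the entry \<open>A $ j $ j\<close>, hence
  real; this is what separates representatives with non-real \<open>\<kappa>\<close>.
\<close>

lemma complexified_map_adapted_pair:
  fixes v w v' w' :: "complex ^ 4"
  assumes A: "bracket_matrix (lie_table T) A" "inj (complexified_map A)"
    and image: "complexified_map A ` span_pair (v, w) = span_pair (v', w')"
    and j: "v' $ j = 1" "w' $ j = 0" "complexified_map A w $ j = 0" "w \<noteq> 0"
    and bracket: "complexified (lie_table T) v w = \<kappa> *s w" "complexified (lie_table T) v'
        w' = \<kappa>' *s w'"
  obtains t c where "c \<noteq> 0" "complexified_map A w = c *s w'"
    "complexified_map A v = (complexified_map A v $ j) *s v' + t *s w'"
    "\<kappa> = complexified_map A v $ j * \<kappa>'"
proof -
  let ?y = "complexified_map A"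
  have span: "span_pair (v', w') = span_pair (?y v, ?y w)"
    using image image_span_pair[of ?y v w] by (simp add: complexified_map_add
        complexified_map_scale)
  have "?y w \<in> span_pair (v', w')" "?y v \<in> span_pair (v', w')"
    unfolding span by (simp_all add: span_pair_def vec.span_base)
  then obtain a c m t where eq: "?y w = a *s v' + c *s w'" "?y v = m *s v' + t *s w'"
    unfolding span_pair_iff by metis
  have "a = 0" and m: "m = ?y v $ j"
    using j arg_cong[OF eq(1), of "\<lambda>z. z $ j"] arg_cong[OF eq(2), of "\<lambda>z. z $ j"]
        by simp_all
  then have w: "?y w = c *s w'"
    using eq by simp
  have "?y w \<noteq> ?y 0"
    using A(2) j(4) by (metis injD)
  moreover have "?y 0 = 0"
    by (simp add: vec_eq_iff complexified_map_nth)
  ultimately have "c \<noteq> 0" "w' \<noteq> 0"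
    using w by auto
  have "\<kappa> *s ?y w = ?y (complexified (lie_table T) v w)"
    by (simp add: bracket complexified_map_scale)
  also have "\<dots> = complexified (lie_table T) (?y v) (?y w)"
    by (rule complexified_map_bracket[OF bilinear_lie_table A(1)])
  also have "\<dots> = (m * c) *s complexified (lie_table T) v' w'"
    using complexified_lie_table_pair[of T m v' t w' 0 c] by (simp add: eq(2) w)
  finally have "(\<kappa> * c) *s w' = (m * c * \<kappa>') *s w'"
    by (simp add: w bracket)
  then have "\<kappa> = m * \<kappa>'"
    using \<open>c \<noteq> 0\<close> \<open>w' \<noteq> 0\<close> by (simp only:
        vector_mul_rcancel) simp
  then show thesis
    using that[OF \<open>c \<noteq> 0\<close> w] eq(2) m by blast
qed

text \<open>The normal form reduces everything to the two shapes. Representatives that occur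
  literally in \<open>Q\<close> inherit invariance from it; the disjunction leaves room for those
  checked separately.\<close>

lemma classified_by_normal_pairsI:
  assumes "coordinate_order j k l m"
    and "\<And>b c x y. invariant_complex_subalgebra br (span_pair (normal_pair j k l m b c x y))
        \<Longrightarrow>
      normal_pair j k l m b c x y \<in> Q"
    and "\<And>b c y. invariant_complex_subalgebra br (span_pair (normal_pair j l k m b c 0 y))
        \<Longrightarrow>
      normal_pair j l k m b c 0 y \<in> Q"
    and "\<And>p. p \<in> Q \<Longrightarrow> invariant_complex_subalgebra br (span_pair p)"
    and "\<And>p. p \<in> R \<Longrightarrow> p \<in> Q \<or> invariant_complex_subalgebra br
        (span_pair p)"
    and "\<And>p p'. p \<in> R \<Longrightarrow> p' \<in> R \<Longrightarrow> p \<noteq> p'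
        \<Longrightarrow>
      \<not> equivalent_subalgebras br (span_pair p) (span_pair p')"
    and "\<And>b c x y. invariant_complex_subalgebra br (span_pair (normal_pair j k l m b c x y))
        \<Longrightarrow>
      \<exists>p\<in>R. equivalent_subalgebras br (span_pair p) (span_pair (normal_pair j k l m b
          c x y))"
    and "\<And>b c y. invariant_complex_subalgebra br (span_pair (normal_pair j l k m b c 0 y))
        \<Longrightarrow>
      \<exists>p\<in>R. equivalent_subalgebras br (span_pair p) (span_pair (normal_pair j l k m b
          c 0 y))"
  shows "classified_by br R Q"
proof -
  have "(\<exists>p\<in>Q. q = span_pair p) \<and> (\<exists>p\<in>R. equivalent_subalgebras br
      (span_pair p) q)"
    if inv: "invariant_complex_subalgebra br q" for q
    using assms(1) inv
  proof (cases rule: invariant_complex_subalgebra_normal_form)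
    case (first b c x y)
    then show ?thesis
      using assms(2,7) inv by blast
  next
    case (second b c y)
    then show ?thesis
      using assms(3,8) inv by blast
  qed
  moreover have "invariant_complex_subalgebra br (span_pair p)" if "p \<in> R" for p
    using assms(4,5) that by blast
  ultimately show ?thesis
    using assms(4,6) unfolding classified_by_def by blast
qed

lemma vector_4 [simp]:
  "(vector [x, y, z, w] :: 'a :: zero ^ 4) $ 1 = x"
  "(vector [x, y, z, w] :: 'a :: zero ^ 4) $ 2 = y"
  "(vector [x, y, z, w] :: 'a :: zero ^ 4) $ 3 = z"
  "(vector [x, y, z, w] :: 'a :: zero ^ 4) $ 4 = w"
  unfolding vector_def by simp_all

lemmas bilinear_listed = real_lie_bracket_listed[unfolded real_lie_bracket_def, THEN conjunct1]

lemmas matrix_simps =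
  bracket_matrix_def complexified_map_nth lie_table_simps forall_4 sum_4 vec_eq_iff axis_def
  normal_pair_def

lemma bracket_matrixD:
  "bracket_matrix br A \<Longrightarrow> br (A $ i) (A $ j) = (\<Sum>k\<in>UNIV. br (axis i 1)
      (axis j 1) $ k *\<^sub>R A $ k)"
  by (simp add: bracket_matrix_def)

lemma inj_complexified_map_row_nonzero:
  assumes "inj (complexified_map A)"
  shows "A $ i \<noteq> 0"
proof
  assume "A $ i = 0"
  then have "complexified_map A (axis i 1) = complexified_map A 0"
    by (simp add: vec_eq_iff complexified_map_nth axis_def if_distrib if_distribR sum.delta cong:
        if_cong)
  then have "axis i 1 = (0 :: complex ^ 'a)"
    using assms by (simp add: inj_eq)
  then show False
    by (simp add: axis_eq_0_iff)
qed

section \<open>Normal forms for the listed algebras\<close>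

text \<open>
  The digits in the lemma names are the order \<open>j, k, l, m\<close> of the coordinates. Where
      \<open>x\<close> is replaced
  by \<open>0\<close>, only the second case of
      \<open>invariant_complex_subalgebra_normal_form\<close> is needed.
\<close>

lemma i_square_iff: "1 + x * x = 0 \<longleftrightarrow> x = \<i> \<or> x = - \<i>" for x :: complex
proof -
  have "1 + x * x = (x - \<i>) * (x + \<i>)"
    by (simp add: algebra_simps)
  then show ?thesis
    by (simp add: eq_neg_iff_add_eq_0)
qed

text \<open>Here [v, w] = x e_3, so \<kappa> = x, and the e_2 coordinate gives x^2 = 0.\<close>

lemma invariant_rh3_1324:
  "invariant_complex_subalgebra rh3 (span_pair (normal_pair 1 3 2 4 b c x y)) \<longleftrightarrow>
    Im b * Im y \<noteq> 0 \<and> x = 0"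
  unfolding lie_algebra_defs by (auto simp: invariant_normal_pair coordinates algebra_simps)

lemma invariant_rh3_1234:
  "invariant_complex_subalgebra rh3 (span_pair (normal_pair 1 2 3 4 b c 0 y)) \<longleftrightarrow>
    False"
  unfolding lie_algebra_defs by (auto simp: invariant_normal_pair coordinates algebra_simps)

lemma invariant_rr3_1324:
  "invariant_complex_subalgebra rr3 (span_pair (normal_pair 1 3 2 4 b c x y)) \<longleftrightarrow>
    False"
  unfolding lie_algebra_defs by (auto simp: invariant_normal_pair coordinates algebra_simps)

lemma invariant_rr3_1234:
  "invariant_complex_subalgebra rr3 (span_pair (normal_pair 1 2 3 4 b c 0 y)) \<longleftrightarrow>
    False"
  unfolding lie_algebra_defs by (auto simp: invariant_normal_pair coordinates algebra_simps)

lemma invariant_rr3_par_1324: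
  "invariant_complex_subalgebra (rr3_par l) (span_pair (normal_pair 1 3 2 4 b c x y))
      \<longleftrightarrow>
    Im b * Im y \<noteq> Im c * Im x \<and> x = of_real l * x \<and> of_real l * y = 0"
  unfolding lie_algebra_defs by (auto simp: invariant_normal_pair coordinates algebra_simps)

lemma invariant_rr3_par_1234:
  "invariant_complex_subalgebra (rr3_par l) (span_pair (normal_pair 1 2 3 4 b c 0 y))
      \<longleftrightarrow>
    False"
  unfolding lie_algebra_defs by (auto simp: invariant_normal_pair coordinates algebra_simps)

text \<open>\<open>w\<close> must be an eigenvector of ad e_1 with eigenvalue \<kappa> = g + x. This
  is not real, hence not zero, whereas e_4 is central; so \<open>y = 0\<close>.\<close>

lemma invariant_rr3'_1234:
  "invariant_complex_subalgebra (rr3' g) (span_pair (normal_pair 1 2 3 4 b c x y))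
      \<longleftrightarrow>
    Im c \<noteq> 0 \<and> (x = \<i> \<or> x = - \<i>) \<and> y = 0"
proof -
  have "x * y + y * of_real g = 0 \<longleftrightarrow> y = 0" if "x = \<i> \<or> x = - \<i>"
  proof -
    have "x * y + y * of_real g = y * (x + of_real g)"
      by (simp add: algebra_simps)
    moreover have "x + of_real g \<noteq> 0"
      using that by (auto simp: complex_eq_iff)
    ultimately show ?thesis
      by simp
  qed
  then show ?thesis
    unfolding lie_algebra_defs
    by (auto simp: invariant_normal_pair coordinates algebra_simps i_square_iff)
qed

lemma invariant_rr3'_1324:
  "invariant_complex_subalgebra (rr3' g) (span_pair (normal_pair 1 3 2 4 b c 0 y))
      \<longleftrightarrow>
    False"
  unfolding lie_algebra_defs by (auto simp: invariant_normal_pair coordinates algebra_simps)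

text \<open>Coordinate 3 vanishes on the derived algebra as well, so \<kappa> = 0 and
  \<open>v\<close>, \<open>w\<close> commute. This is what forces the e_4 coefficient
  \<open>c\<close> of \<open>v\<close> to vanish.\<close>

lemma invariant_r2r2_1324:
  "invariant_complex_subalgebra r2r2 (span_pair (normal_pair 1 3 2 4 b c x y)) \<longleftrightarrow>
    Im b * Im y \<noteq> 0 \<and> x = 0 \<and> c = 0"
  unfolding lie_algebra_defs by (auto simp: invariant_normal_pair coordinates algebra_simps)

lemma invariant_r2r2_1234:
  "invariant_complex_subalgebra r2r2 (span_pair (normal_pair 1 2 3 4 b c 0 y)) \<longleftrightarrow>
    False"
  unfolding lie_algebra_defs by (auto simp: invariant_normal_pair coordinates algebra_simps)

text \<open>Coordinate 2 also vanishes on the derived algebra, so \<open>v\<close> and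
  \<open>w\<close> commute, which determines \<open>x\<close> and \<open>y\<close>; the determinant
  then becomes a sum of two squares.\<close>

lemma invariant_r2'_1234:
  "invariant_complex_subalgebra r2' (span_pair (normal_pair 1 2 3 4 b c x y)) \<longleftrightarrow>
    (Im b)\<^sup>2 + (Im c)\<^sup>2 \<noteq> 0 \<and> x = - c \<and> y = b"
proof -
  have "Im b * Im b = - (Im c * Im c) \<longleftrightarrow> Im b = 0 \<and> Im c = 0"
    by (metis eq_neg_iff_add_eq_0 sum_squares_eq_zero_iff)
  then show ?thesis
    unfolding lie_algebra_defs sum_power2_eq_zero_iff
    by (auto simp: invariant_normal_pair coordinates algebra_simps add_eq_0_iff)
qed

text \<open>The equation is b (1 + y^2) = 0, and \<open>b = 0\<close> is excluded by the determinant
  \<open>Im b * Im y\<close>.\<close>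

lemma invariant_r2'_1324:
  "invariant_complex_subalgebra r2' (span_pair (normal_pair 1 3 2 4 b c 0 y)) \<longleftrightarrow>
    Im b \<noteq> 0 \<and> (y = \<i> \<or> y = - \<i>)"
proof -
  have "b + b * (y * y) = 0 \<longleftrightarrow> b = 0 \<or> y = \<i> \<or> y = - \<i>"
  proof -
    have "b + b * (y * y) = b * (1 + y * y)"
      by (simp add: algebra_simps)
    then show ?thesis
      by (simp only: mult_eq_0_iff i_square_iff)
  qed
  then show ?thesis
    unfolding lie_algebra_defs by (auto simp: invariant_normal_pair coordinates algebra_simps)
qed

lemma invariant_r4_par_4123:
  "invariant_complex_subalgebra (r4_par m) (span_pair (normal_pair 4 1 2 3 b c x y))
      \<longleftrightarrow>
    m = 1 \<and> Im c * Im x \<noteq> 0 \<and> y = 0"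
  unfolding lie_algebra_defs by (auto simp: invariant_normal_pair coordinates algebra_simps)

lemma invariant_r4_par_4213:
  "invariant_complex_subalgebra (r4_par m) (span_pair (normal_pair 4 2 1 3 b c 0 y))
      \<longleftrightarrow>
    False"
  unfolding lie_algebra_defs by (auto simp: invariant_normal_pair coordinates algebra_simps)

lemma invariant_r4_4123:
  "invariant_complex_subalgebra r4 (span_pair (normal_pair 4 1 2 3 b c x y)) \<longleftrightarrow>
    False"
  unfolding lie_algebra_defs by (auto simp: invariant_normal_pair coordinates algebra_simps)

lemma invariant_r4_4213:
  "invariant_complex_subalgebra r4 (span_pair (normal_pair 4 2 1 3 b c 0 y)) \<longleftrightarrow>
    False"
  unfolding lie_algebra_defs by (auto simp: invariant_normal_pair coordinates algebra_simps)

lemma invariant_n4_4123: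
  "invariant_complex_subalgebra n4 (span_pair (normal_pair 4 1 2 3 b c x y)) \<longleftrightarrow>
    False"
  unfolding lie_algebra_defs by (auto simp: invariant_normal_pair coordinates algebra_simps)

lemma invariant_n4_4213:
  "invariant_complex_subalgebra n4 (span_pair (normal_pair 4 2 1 3 b c 0 y)) \<longleftrightarrow>
    False"
  unfolding lie_algebra_defs by (auto simp: invariant_normal_pair coordinates algebra_simps)

lemma invariant_r4_par2_4123:
  "invariant_complex_subalgebra (r4_par2 \<alpha> \<beta>) (span_pair (normal_pair 4 1 2 3 b c x
      y)) \<longleftrightarrow>
    Im b * Im y \<noteq> Im c * Im x \<and> x = of_real \<alpha> * x \<and> y = of_real \<beta> * y"
  unfolding lie_algebra_defs by (auto simp: invariant_normal_pair coordinates algebra_simps)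

lemma invariant_r4_par2_4213:
  "invariant_complex_subalgebra (r4_par2 \<alpha> \<beta>) (span_pair (normal_pair 4 2 1 3 b c x
      y)) \<longleftrightarrow>
    Im b * Im y \<noteq> Im c * Im x \<and> x = of_real \<alpha> * x \<and> of_real \<beta> * y =
        of_real \<alpha> * y"
  unfolding lie_algebra_defs by (auto simp: invariant_normal_pair coordinates algebra_simps)

lemma invariant_r4'_4213:
  assumes "d > 0"
  shows "invariant_complex_subalgebra (r4' g d) (span_pair (normal_pair 4 2 1 3 b c x y))
      \<longleftrightarrow>
    Im b \<noteq> 0 \<and> x = 0 \<and> (y = \<i> \<or> y = - \<i>)"
proof -
  have "of_real d + y * (y * of_real d) = (of_real d :: complex) * (1 + y * y)"
    by (simp add: algebra_simps)
  then have y: "of_real d + y * (y * of_real d) = 0 \<longleftrightarrow> y = \<i> \<or> y = - \<i>"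
    using assms by (simp only: mult_eq_0_iff i_square_iff) simp
  have "x = x * of_real g + x * (y * of_real d) \<longleftrightarrow> x = 0" if "y = \<i> \<or> y
      = - \<i>"
  proof -
    have "x - (x * of_real g + x * (y * of_real d)) = x * (1 - of_real g - y * of_real d)"
      by (simp add: algebra_simps)
    moreover have "1 - of_real g - y * of_real d \<noteq> 0"
      using that assms by (auto simp: complex_eq_iff)
    ultimately show ?thesis
      by (metis eq_iff_diff_eq_0 mult_eq_0_iff)
  qed
  then show ?thesis
    unfolding lie_algebra_defs
    by (auto simp: invariant_normal_pair coordinates algebra_simps y)
qed

lemma invariant_r4'_4123:
  assumes "d > 0"
  shows "invariant_complex_subalgebra (r4' g d) (span_pair (normal_pair 4 1 2 3 b c 0 y))
      \<longleftrightarrow>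
    False"
  using assms unfolding lie_algebra_defs by (auto simp: invariant_normal_pair coordinates
      algebra_simps)

lemma invariant_d4_4123:
  "invariant_complex_subalgebra d4 (span_pair (normal_pair 4 1 2 3 b c x y)) \<longleftrightarrow>
    Im b \<noteq> 0 \<and> x = 0 \<and> y = - b"
  unfolding lie_algebra_defs
  by (auto simp: invariant_normal_pair coordinates algebra_simps add_eq_0_iff)

lemma invariant_d4_4213:
  "invariant_complex_subalgebra d4 (span_pair (normal_pair 4 2 1 3 b c x y)) \<longleftrightarrow>
    Im b \<noteq> 0 \<and> x = 0 \<and> y = - b"
  unfolding lie_algebra_defs
  by (auto simp: invariant_normal_pair coordinates algebra_simps add_eq_0_iff)

text \<open>Modulo e_3, ad e_4 has eigenvalues l and 1 - l on e_1, e_2. Only when they coincide can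
  \<open>w\<close> mix the two directions, hence the factor 1 - 2 l.\<close>

lemma invariant_d4_par_4123:
  "invariant_complex_subalgebra (d4_par l) (span_pair (normal_pair 4 1 2 3 b c x y))
      \<longleftrightarrow>
    Im b * Im y \<noteq> Im c * Im x \<and> of_real (1 - 2 * l) * x = 0 \<and> b = of_real (1 - l)
        * y"
  unfolding lie_algebra_defs by (auto simp: invariant_normal_pair coordinates algebra_simps)

lemma invariant_d4_par_4213:
  "invariant_complex_subalgebra (d4_par l) (span_pair (normal_pair 4 2 1 3 b c x y))
      \<longleftrightarrow>
    Im b * Im y \<noteq> Im c * Im x \<and> of_real (1 - 2 * l) * x = 0 \<and> b = - of_real l * y"
proof -
  have "b + y * of_real l = 0 \<longleftrightarrow> b = - of_real l * y"
    by (simp add: eq_neg_iff_add_eq_0 mult.commute)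
  then show ?thesis
    unfolding lie_algebra_defs by (auto simp: invariant_normal_pair coordinates algebra_simps)
qed

text \<open>Modulo e_3, \<open>w\<close> must be an eigenvector of the rotation block, with \<kappa>
  = d / 2 + x; the e_3 coordinate then reads \<open>d * y - b = \<kappa> * y\<close>.\<close>

lemma invariant_d4'_4123:
  "invariant_complex_subalgebra (d4' d) (span_pair (normal_pair 4 1 2 3 b c x y))
      \<longleftrightarrow>
    Im b * Im y \<noteq> Im c * Im x \<and> (x = \<i> \<or> x = - \<i>) \<and> b = (of_real (d /
        2) - x) * y"
proof -
  have x: "2 + x * (x * 2) = 0 \<longleftrightarrow> x = \<i> \<or> x = - \<i>"
  proof -
    have "2 + x * (x * 2) = 2 * (1 + x * x)"
      by (simp add: algebra_simps)
    then show ?thesis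
      by (simp only: mult_eq_0_iff i_square_iff) simp
  qed
  have "y * of_real d = b + (x * y + y * of_real d / 2) \<longleftrightarrow> b = (of_real (d / 2)
      - x) * y"
    by (auto simp: field_simps)
  then show ?thesis
    unfolding lie_algebra_defs
    by (auto simp: invariant_normal_pair coordinates algebra_simps x)
qed

lemma invariant_d4'_4213:
  "invariant_complex_subalgebra (d4' d) (span_pair (normal_pair 4 2 1 3 b c 0 y))
      \<longleftrightarrow>
    False"
  unfolding lie_algebra_defs by (auto simp: invariant_normal_pair coordinates algebra_simps)

text \<open>Here \<kappa> = 1/2 + x; the Jordan block gives x^2 = 0, and the e_3 coordinate gives y
  - b = y / 2.\<close>

lemma invariant_h4_4123:
  "invariant_complex_subalgebra h4 (span_pair (normal_pair 4 1 2 3 b c x y)) \<longleftrightarrow>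
    Im b \<noteq> 0 \<and> x = 0 \<and> y = 2 * b"
  unfolding lie_algebra_defs
  by (auto simp: invariant_normal_pair coordinates field_simps)

lemma invariant_h4_4213:
  "invariant_complex_subalgebra h4 (span_pair (normal_pair 4 2 1 3 b c 0 y)) \<longleftrightarrow>
    False"
  unfolding lie_algebra_defs by (auto simp: invariant_normal_pair coordinates algebra_simps)

section \<open>Non-equivalent representatives\<close>

text \<open>The two values of \<kappa> are \<open>g + x\<close> and \<open>g + x'\<close>; since
  \<open>g > 0\<close>, a real factor between them must be 1.\<close>

lemma not_equivalent_rr3':
  assumes "equivalent_subalgebras (rr3' g) (span_pair (e 1 + \<i> *s e 4, e 2 + x *s e 3))
      (span_pair (e 1 + \<i> *s e 4, e 2 + x' *s e 3))"
    and "g > 0" "x = \<i> \<or> x = - \<i>" "x' = \<i> \<or> x' = - \<i>"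
  shows "x = x'"
proof -
  obtain A where A: "bracket_matrix (rr3' g) A" "inj (complexified_map A)"
    and image: "complexified_map A ` span_pair (e 1 + \<i> *s e 4, e 2 + x *s e 3) =
      span_pair (e 1 + \<i> *s e 4, e 2 + x' *s e 3)"
    using equivalent_subalgebrasE[OF bilinear_listed(4) assms(1)] by metis
  note br = bracket_matrixD[OF A(1), unfolded rr3'_def]
  have "g * A $ 2 $ 1 - A $ 3 $ 1 = 0" "A $ 2 $ 1 + g * A $ 3 $ 1 = 0"
    using br[of 1 2] br[of 1 3] by (simp_all add: matrix_simps)
  then have "(1 + g * g) * A $ 2 $ 1 = 0" "(1 + g * g) * A $ 3 $ 1 = 0"
    by algebra+
  moreover have "1 + g * g \<noteq> 0"
    by (metis add.commute less_numeral_extra(3) mult_eq_0_iff not_sum_squares_lt_zero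
        sum_squares_eq_zero_iff zero_neq_one mult.right_neutral)
  ultimately have 1: "A $ 2 $ 1 = 0" "A $ 3 $ 1 = 0"
    by simp_all
  obtain t c where c: "c \<noteq> 0"
    "complexified_map A (e 2 + x *s e 3) = c *s (e 2 + x' *s e 3)"
    "of_real g + x = complexified_map A (e 1 + \<i> *s e 4) $ 1 * (of_real g + x')"
  proof (rule complexified_map_adapted_pair[OF A[unfolded rr3'_def] image, of 1])
    show "complexified (lie_table [(1, 2, g *\<^sub>R e 2 - e 3), (1, 3, e 2 + g *\<^sub>R e 3)])
        (e 1 + \<i> *s e 4) (e 2 + x *s e 3) = (of_real g + x) *s (e 2 + x *s e 3)"
      "complexified (lie_table [(1, 2, g *\<^sub>R e 2 - e 3), (1, 3, e 2 + g *\<^sub>R e 3)])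
        (e 1 + \<i> *s e 4) (e 2 + x' *s e 3) = (of_real g + x') *s (e 2 + x' *s e 3)"
      using assms(3,4) by (auto simp: coordinates algebra_simps)
  qed (use 1 in \<open>auto simp: matrix_simps\<close>)
  \<comment> \<open>e_4 is central, so its image commutes with the images of e_2 and e_3. A non-zero
    e_1 component would make the e_2, e_3 components of these vanish, since ad e_1 is invertible on
    that plane.\<close>
  have "A $ 4 $ 1 = 0"
  proof (rule ccontr)
    assume "A $ 4 $ 1 \<noteq> 0"
    moreover have "A $ 4 $ 1 * (g * A $ 2 $ 2 + A $ 2 $ 3) = 0" "A $ 4 $ 1 * (g * A $ 2 $ 3 - A $
        2 $ 2) = 0"
      "A $ 4 $ 1 * (g * A $ 3 $ 2 + A $ 3 $ 3) = 0" "A $ 4 $ 1 * (g * A $ 3 $ 3 - A $ 3 $ 2) = 0"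
      using br[of 4 2] br[of 4 3] 1 by (auto simp: matrix_simps algebra_simps)
    ultimately have "g * A $ 2 $ 2 + A $ 2 $ 3 = 0" "g * A $ 2 $ 3 - A $ 2 $ 2 = 0"
      "g * A $ 3 $ 2 + A $ 3 $ 3 = 0" "g * A $ 3 $ 3 - A $ 3 $ 2 = 0"
      by simp_all
    then have "(1 + g * g) * A $ 2 $ 2 = 0" "(1 + g * g) * A $ 3 $ 2 = 0"
      by algebra+
    then have "A $ 2 $ 2 = 0" "A $ 3 $ 2 = 0"
      using \<open>1 + g * g \<noteq> 0\<close> by simp_all
    then show False
      using c(1) arg_cong[OF c(2), of "\<lambda>z. z $ 2"] by (simp add: matrix_simps)
  qed
  then have "of_real g + x = of_real (A $ 1 $ 1) * (of_real g + x')"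
    using c(3) by (simp add: matrix_simps)
  then show ?thesis
    using assms(2-4) by (auto simp: complex_eq_iff)
qed

text \<open>A real factor between \<open>g + d * x\<close> and \<open>g + d * x'\<close> with
  \<open>x \<noteq> x'\<close> must be -1, with \<open>g = 0\<close>. Then [e_4, e_1] = e_1 asks for
  an eigenvector of ad e_4 with eigenvalue -1, but on the derived algebra the eigenvalues are 1,
  \<open>\<i> * d\<close> and \<open>- \<i> * d\<close>.\<close>

lemma not_equivalent_r4':
  assumes "equivalent_subalgebras (r4' g d) (span_pair (e 4 + \<i> *s e 1, e 2 + x *s e 3))
      (span_pair (e 4 + \<i> *s e 1, e 2 + x' *s e 3))"
    and "d > 0" "x = \<i> \<or> x = - \<i>" "x' = \<i> \<or> x' = - \<i>"
  shows "x = x'"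
proof (rule ccontr)
  assume "x \<noteq> x'"
  obtain A where A: "bracket_matrix (r4' g d) A" "inj (complexified_map A)"
    and image: "complexified_map A ` span_pair (e 4 + \<i> *s e 1, e 2 + x *s e 3) =
      span_pair (e 4 + \<i> *s e 1, e 2 + x' *s e 3)"
    using equivalent_subalgebrasE[OF bilinear_listed(11) assms(1)] by metis
  note br = bracket_matrixD[OF A(1), unfolded r4'_def]
  have "g * A $ 2 $ 4 - d * A $ 3 $ 4 = 0" "d * A $ 2 $ 4 + g * A $ 3 $ 4 = 0" and 14: "A $ 1 $ 4
      = 0"
    using br[of 4 2] br[of 4 3] br[of 4 1] by (simp_all add: matrix_simps)
  then have "(d * d + g * g) * A $ 2 $ 4 = 0" "(d * d + g * g) * A $ 3 $ 4 = 0"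
    by algebra+
  then have 4: "A $ 2 $ 4 = 0" "A $ 3 $ 4 = 0"
    using assms(2) by (auto simp: sum_squares_eq_zero_iff)
  obtain t c where "of_real g + of_real d * x = complexified_map A (e 4 + \<i> *s e 1) $ 4 *
      (of_real g + of_real d * x')"
  proof (rule complexified_map_adapted_pair[OF A[unfolded r4'_def] image, of 4])
    show "complexified (lie_table [(4, 1, e 1), (4, 2, g *\<^sub>R e 2 - d *\<^sub>R e 3), (4, 3,
        d *\<^sub>R e 2 + g *\<^sub>R e 3)])
        (e 4 + \<i> *s e 1) (e 2 + x *s e 3) = (of_real g + of_real d * x) *s (e 2 + x *s e 3)"
      "complexified (lie_table [(4, 1, e 1), (4, 2, g *\<^sub>R e 2 - d *\<^sub>R e 3), (4, 3, d
          *\<^sub>R e 2 + g *\<^sub>R e 3)])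
        (e 4 + \<i> *s e 1) (e 2 + x' *s e 3) = (of_real g + of_real d * x') *s (e 2 + x' *s e 3)"
      using assms(3,4) by (auto simp: coordinates algebra_simps)
  qed (use 4 in \<open>auto simp: matrix_simps\<close>)
  then have "of_real g + of_real d * x = of_real (A $ 4 $ 4) * (of_real g + of_real d * x')"
    using 14 by (simp add: matrix_simps)
  then have m: "A $ 4 $ 4 = -1" "g = 0"
    using \<open>x \<noteq> x'\<close> assms(2-4) by (auto simp: complex_eq_iff)
  have "A $ 1 $ 1 = 0" "A $ 1 $ 2 = - (d * A $ 1 $ 3)" "A $ 1 $ 3 = d * A $ 1 $ 2"
    using br[of 4 1] 14 by (simp_all add: matrix_simps m mult.commute)
  moreover from this have "(1 + d * d) * A $ 1 $ 2 = 0"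
    by algebra
  moreover have "1 + d * d \<noteq> 0"
    using assms(2) by (metis add_pos_pos less_numeral_extra(3) mult_pos_pos zero_less_one)
  ultimately have "A $ 1 = 0"
    using 14 by (simp add: vec_eq_iff forall_4)
  then show False
    using inj_complexified_map_row_nonzero[OF A(2)] by blast
qed

text \<open>For \<open>l\<close> other than 0 and 1 the derived algebra is spanned by e_1, e_2, e_3
  and has centre e_3, so both are preserved. On the centre the map acts by its determinant on the
  quotient, and [e_4, e_3] = e_3 then fixes the scale of e_4.\<close>

lemma bracket_matrix_d4_par:
  assumes A: "bracket_matrix (d4_par l) A" "inj (complexified_map A)" and l: "l \<noteq> 0" "l
      \<noteq> 1"
  shows "A $ 1 $ 4 = 0" "A $ 2 $ 4 = 0" "A $ 3 $ 4 = 0" "A $ 3 $ 1 = 0" "A $ 3 $ 2 = 0"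
    "A $ 3 $ 3 = A $ 1 $ 1 * A $ 2 $ 2 - A $ 1 $ 2 * A $ 2 $ 1" "A $ 4 $ 4 = 1"
proof -
  note br = bracket_matrixD[OF A(1), unfolded d4_par_def]
  show 4: "A $ 1 $ 4 = 0" "A $ 2 $ 4 = 0" "A $ 3 $ 4 = 0"
    using br[of 4 1] br[of 4 2] br[of 1 2] l by (simp_all add: matrix_simps)
  show 3: "A $ 3 $ 1 = 0" "A $ 3 $ 2 = 0"
    "A $ 3 $ 3 = A $ 1 $ 1 * A $ 2 $ 2 - A $ 1 $ 2 * A $ 2 $ 1"
    using br[of 1 2] 4 by (simp_all add: matrix_simps)
  have "A $ 3 \<noteq> 0"
    using inj_complexified_map_row_nonzero[OF A(2)] .
  then have "A $ 3 $ 3 \<noteq> 0"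
    using 3(1,2) 4(3) by (auto simp: vec_eq_iff forall_4)
  moreover have "A $ 4 $ 4 * A $ 3 $ 3 = A $ 3 $ 3"
    using br[of 4 3] 3(1,2) 4(3) by (simp add: matrix_simps)
  ultimately show "A $ 4 $ 4 = 1"
    by simp
qed

text \<open>\<kappa> equals \<open>1 - l\<close> for the first subalgebra and \<open>l\<close> for
  the second; since \<open>A $ 4 $ 4 = 1\<close>, it is an invariant.\<close>

lemma not_equivalent_d4_par:
  assumes l: "l \<noteq> 0" "l \<noteq> 1" "l \<noteq> 1 / 2"
  shows "\<not> equivalent_subalgebras (d4_par l)
    (span_pair (e 4 - (complex_of_real l * \<i>) *s e 1, e 2 + \<i> *s e 3))
    (span_pair (e 4 + (complex_of_real (1 - l) * \<i>) *s e 2, e 1 + \<i> *s e 3))"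
proof
  let ?v = "e 4 - (complex_of_real l * \<i>) *s e 1 :: complex ^ 4"
  assume "equivalent_subalgebras (d4_par l) (span_pair (?v, e 2 + \<i> *s e 3))
    (span_pair (e 4 + (complex_of_real (1 - l) * \<i>) *s e 2, e 1 + \<i> *s e 3))"
  then obtain A where A: "bracket_matrix (d4_par l) A" "inj (complexified_map A)"
    and image: "complexified_map A ` span_pair (?v, e 2 + \<i> *s e 3) =
      span_pair (e 4 + (complex_of_real (1 - l) * \<i>) *s e 2, e 1 + \<i> *s e 3)"
    using equivalent_subalgebrasE[OF bilinear_listed(13)] by metis
  note entries = bracket_matrix_d4_par[OF A l(1,2)]
  obtain t c where "of_real (1 - l) = complexified_map A ?v $ 4 * of_real l"
    by (rule complexified_map_adapted_pair[OF A[unfolded d4_par_def] image, of 4 "of_real (1 - l)"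
        "of_real l"])
      (use entries in \<open>auto simp: matrix_simps coordinates algebra_simps\<close>)
  then have "complex_of_real (1 - l) = of_real l"
    using entries by (simp add: matrix_simps)
  then show False
    using l(3) unfolding of_real_eq_iff by simp
qed

text \<open>\<kappa> = 1/2 for both, so orientation has to separate them: the image of
  \<open>v\<close> forces \<open>A $ 3 $ 3 = 1\<close>, while the image of \<open>w\<close> makes
  this determinant \<open>\<eta> * \<eta>'\<close> times a sum of squares.\<close>

lemma not_equivalent_d4_par_half:
  assumes "equivalent_subalgebras (d4_par (1 / 2))
      (span_pair (e 4 + \<i> *s e 3, e 1 + (of_real \<eta> * \<i>) *s e 2))
      (span_pair (e 4 + \<i> *s e 3, e 1 + (of_real \<eta>' * \<i>) *s e 2))"
    and \<eta>: "\<eta> \<in> {1, -1}" "\<eta>' \<in> {1, -1}"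
  shows "\<eta> = \<eta>'"
proof -
  obtain A where A: "bracket_matrix (d4_par (1 / 2)) A" "inj (complexified_map A)"
    and image: "complexified_map A ` span_pair (e 4 + \<i> *s e 3, e 1 + (of_real \<eta> * \<i>)
        *s e 2) =
      span_pair (e 4 + \<i> *s e 3, e 1 + (of_real \<eta>' * \<i>) *s e 2)"
    using equivalent_subalgebrasE[OF bilinear_listed(13) assms(1)] by metis
  have entries: "A $ 1 $ 4 = 0" "A $ 2 $ 4 = 0" "A $ 3 $ 4 = 0" "A $ 3 $ 1 = 0" "A $ 3 $ 2 = 0"
    "A $ 3 $ 3 = A $ 1 $ 1 * A $ 2 $ 2 - A $ 1 $ 2 * A $ 2 $ 1" "A $ 4 $ 4 = 1"
    using bracket_matrix_d4_par[OF A] by simp_all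
  obtain t c where
    "complexified_map A (e 1 + (of_real \<eta> * \<i>) *s e 2) = c *s (e 1 + (of_real \<eta>' *
        \<i>) *s e 2)"
    "complexified_map A (e 4 + \<i> *s e 3) =
      (complexified_map A (e 4 + \<i> *s e 3) $ 4) *s (e 4 + \<i> *s e 3) + t *s (e 1 + (of_real
          \<eta>' * \<i>) *s e 2)"
    by (rule complexified_map_adapted_pair[OF A[unfolded d4_par_def] image, of 4 "1 / 2" "1 / 2"])
      (use entries(1-5,7) in \<open>auto simp: matrix_simps coordinates algebra_simps\<close>)
  then have "A $ 1 $ 1 = Re c" "\<eta> * A $ 2 $ 1 = Im c" "A $ 1 $ 2 = - (\<eta>' * Im c)"
      "\<eta> * A $ 2 $ 2 = \<eta>' * Re c"
    "A $ 4 $ 1 = Re t" "Im t = 0" "\<eta>' * Re t = 0" "A $ 3 $ 3 = 1"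
    using entries(1-5,7) \<eta> by (auto simp: matrix_simps complex_eq_iff)
  then have "1 = A $ 1 $ 1 * A $ 2 $ 2 - A $ 1 $ 2 * A $ 2 $ 1" 
    "A $ 1 $ 2 = - \<eta> * \<eta>' * A $ 2 $ 1" "A $ 2 $ 2 = \<eta> * \<eta>' * A $ 1 $ 1"
    using entries(6) \<eta> by auto
  then have "1 = \<eta> * \<eta>' * (A $ 1 $ 1 * A $ 1 $ 1 + A $ 2 $ 1 * A $ 2 $ 1)"
    by algebra
  moreover have "A $ 1 $ 1 * A $ 1 $ 1 + A $ 2 $ 1 * A $ 2 $ 1 \<ge> 0"
    by simp
  ultimately obtain S where "1 = \<eta> * \<eta>' * S" "S \<ge> 0"
    by blast
  then show ?thesis
    using \<eta> by auto
qed

text \<open>The image of e_3 is a multiple of e_3, so modulo e_3 the image of \<open>w\<close> is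
  that of e_2. It is real, hence not a non-zero multiple of e_1 + \<eta> \<i> e_2.\<close>

lemma not_equivalent_d4_par_half_real:
  assumes "\<eta> \<noteq> 0"
  shows "\<not> equivalent_subalgebras (d4_par (1 / 2)) (span_pair (e 4 + \<i> *s e 1, e 2 - (2 *
      \<i>) *s e 3))
      (span_pair (e 4 + \<i> *s e 3, e 1 + (of_real \<eta> * \<i>) *s e 2))"
proof
  assume "equivalent_subalgebras (d4_par (1 / 2)) (span_pair (e 4 + \<i> *s e 1, e 2 - (2 * \<i>)
      *s e 3))
      (span_pair (e 4 + \<i> *s e 3, e 1 + (of_real \<eta> * \<i>) *s e 2))"
  then obtain A where A: "bracket_matrix (d4_par (1 / 2)) A" "inj (complexified_map A)"
    and image: "complexified_map A ` span_pair (e 4 + \<i> *s e 1, e 2 - (2 * \<i>) *s e 3) =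
      span_pair (e 4 + \<i> *s e 3, e 1 + (of_real \<eta> * \<i>) *s e 2)"
    using equivalent_subalgebrasE[OF bilinear_listed(13)] by metis
  have entries: "A $ 1 $ 4 = 0" "A $ 2 $ 4 = 0" "A $ 3 $ 4 = 0" "A $ 3 $ 1 = 0" "A $ 3 $ 2 = 0"
    "A $ 3 $ 3 = A $ 1 $ 1 * A $ 2 $ 2 - A $ 1 $ 2 * A $ 2 $ 1" "A $ 4 $ 4 = 1"
    using bracket_matrix_d4_par[OF A] by simp_all
  obtain t c where "c \<noteq> 0"
    "complexified_map A (e 2 - (2 * \<i>) *s e 3) = c *s (e 1 + (of_real \<eta> * \<i>) *s e 2)"
    by (rule complexified_map_adapted_pair[OF A[unfolded d4_par_def] image, of 4 "1 / 2" "1 / 2"])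
      (use entries(1-5,7) in \<open>auto simp: matrix_simps coordinates algebra_simps\<close>)
  then have "A $ 2 $ 1 = 0" "A $ 2 $ 2 = 0"
    using entries(1-5,7) assms by (auto simp: matrix_simps complex_eq_iff)
  then show False
    using entries inj_complexified_map_row_nonzero[OF A(2), of 3] by (simp add: vec_eq_iff forall_4)
qed

text \<open>Here \<kappa> = d / 2 + \<epsilon> \<i>, and assumption \<open>d\<close> makes the real
  factor \<open>A $ 4 $ 4\<close> equal to 1, so \<epsilon> is preserved. Then the map on e_1, e_2
  modulo e_3 commutes with the rotation, its determinant is a sum of squares, and the image of
  \<open>v\<close> shows that \<sigma> keeps its sign.\<close>

lemma not_equivalent_d4':
  assumes "equivalent_subalgebras (d4' d)
      (span_pair (e 4 + (of_real \<sigma> * \<i>) *s e 3, e 1 + (of_real \<epsilon> * \<i>) *s e 2))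
      (span_pair (e 4 + (of_real \<sigma>' * \<i>) *s e 3, e 1 + (of_real \<epsilon>' * \<i>) *s e
          2))"
    and signs: "\<sigma> \<in> {1, -1}" "\<epsilon> \<in> {1, -1}" "\<sigma>' \<in> {1, -1}"
        "\<epsilon>' \<in> {1, -1}"
    and d: "d \<noteq> 0 \<or> \<epsilon> = \<epsilon>'"
  shows "\<sigma> = \<sigma>' \<and> \<epsilon> = \<epsilon>'"
proof -
  let ?v = "\<lambda>\<sigma>. e 4 + (of_real \<sigma> * \<i>) *s e 3 :: complex ^ 4"
  let ?w = "\<lambda>\<epsilon>. e 1 + (of_real \<epsilon> * \<i>) *s e 2 :: complex ^ 4"
  obtain A where A: "bracket_matrix (d4' d) A" "inj (complexified_map A)"
    and image: "complexified_map A ` span_pair (?v \<sigma>, ?w \<epsilon>) = span_pair (?v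
        \<sigma>', ?w \<epsilon>')"
    using equivalent_subalgebrasE[OF bilinear_listed(14) assms(1)] by metis
  note br = bracket_matrixD[OF A(1), unfolded d4'_def]
  have eqs: "2 * A $ 2 $ 4 = d * A $ 1 $ 4" "2 * A $ 1 $ 4 + d * A $ 2 $ 4 = 0" and 34: "A $ 3 $ 4
      = 0"
    using br[of 4 1] br[of 4 2] br[of 1 2] by (simp_all add: matrix_simps)
  then have "(4 + d * d) * A $ 1 $ 4 = 0"
    by algebra
  moreover have "4 + d * d \<noteq> 0"
    by (metis add_pos_nonneg less_numeral_extra(3) zero_le_square zero_less_numeral)
  ultimately have 4: "A $ 1 $ 4 = 0" "A $ 2 $ 4 = 0"
    using eqs(1) by simp_all
  have 3: "A $ 3 $ 1 = 0" "A $ 3 $ 2 = 0" "A $ 3 $ 3 = A $ 1 $ 1 * A $ 2 $ 2 - A $ 1 $ 2 * A $ 2 $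
      1"
    using br[of 1 2] 4 by (simp_all add: matrix_simps)
  obtain t c where w: "complexified_map A (?w \<epsilon>) = c *s ?w \<epsilon>'"
    and v: "complexified_map A (?v \<sigma>) = (complexified_map A (?v \<sigma>) $ 4) *s ?v
        \<sigma>' + t *s ?w \<epsilon>'"
    and "of_real (d / 2) + of_real \<epsilon> * \<i> = complexified_map A (?v \<sigma>) $ 4 *
        (of_real (d / 2) + of_real \<epsilon>' * \<i>)"
    by (rule complexified_map_adapted_pair[OF A[unfolded d4'_def] image, of 4
          "of_real (d / 2) + of_real \<epsilon> * \<i>" "of_real (d / 2) + of_real \<epsilon>' *
              \<i>"])
      (use 3(1,2) 4 34 signs in \<open>auto simp: matrix_simps coordinates algebra_simps\<close>)
  then have "of_real (d / 2) + of_real \<epsilon> * \<i> = of_real (A $ 4 $ 4) * (of_real (d / 2)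
      + of_real \<epsilon>' * \<i>)"
    using 34 by (simp add: matrix_simps)
  then have "d = A $ 4 $ 4 * d" "\<epsilon> = A $ 4 $ 4 * \<epsilon>'"
    by (auto simp: complex_eq_iff)
  then have m: "A $ 4 $ 4 = 1" and \<epsilon>: "\<epsilon> = \<epsilon>'"
    using d signs by auto
  have "A $ 1 $ 1 = Re c" "\<epsilon> * A $ 2 $ 1 = Im c" "A $ 1 $ 2 = - (\<epsilon> * Im c)"
      "\<epsilon> * A $ 2 $ 2 = \<epsilon> * Re c"
    using arg_cong[OF w, of "\<lambda>z. z $ 1"] arg_cong[OF w, of "\<lambda>z. z $ 2"] \<epsilon>
    by (simp_all add: matrix_simps complex_eq_iff)
  then have "A $ 2 $ 2 = A $ 1 $ 1" "A $ 1 $ 2 = - A $ 2 $ 1"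
    using signs(2) by auto
  then have "A $ 3 $ 3 \<ge> 0"
    using 3(3) by simp
  moreover have "Im t = 0" "Re t = 0"
    using arg_cong[OF v, of "\<lambda>z. z $ 1"] arg_cong[OF v, of "\<lambda>z. z $ 2"] 3(1,2) m
        signs(4)
    by (auto simp: matrix_simps complex_eq_iff)
  moreover have "\<sigma> * A $ 3 $ 3 = \<sigma>'"
    using arg_cong[OF v, of "\<lambda>z. z $ 3"] 34 m by (simp add: matrix_simps complex_eq_iff)
  ultimately show ?thesis
    using signs \<epsilon> by auto
qed

text \<open>An automorphism multiplies \<sigma> by \<open>A $ 3 $ 3\<close>, which is not zero, so
  the vanishing of \<sigma> is invariant. The contribution \<open>A $ 2 $ 3\<close> cancels against
  \<open>t\<close>, because [e_4, e_2] = - e_2 gives \<open>A $ 2 $ 3 = - A $ 4 $ 1\<close>.\<close>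

lemma not_equivalent_d4:
  assumes "equivalent_subalgebras d4 (span_pair (e 4 + \<i> *s (e 2 + of_real \<sigma> *s e 3), e
      1 - \<i> *s e 3))
      (span_pair (e 4 + \<i> *s (e 2 + of_real \<sigma>' *s e 3), e 1 - \<i> *s e 3))"
  shows "\<sigma> = 0 \<longleftrightarrow> \<sigma>' = 0"
proof -
  let ?v = "\<lambda>\<sigma>. e 4 + \<i> *s (e 2 + of_real \<sigma> *s e 3) :: complex ^ 4"
  let ?w = "e 1 - \<i> *s e 3 :: complex ^ 4"
  obtain A where A: "bracket_matrix d4 A" "inj (complexified_map A)"
    and image: "complexified_map A ` span_pair (?v \<sigma>, ?w) = span_pair (?v \<sigma>', ?w)"
    using equivalent_subalgebrasE[OF bilinear_listed(12) assms(1)] by metis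
  note br = bracket_matrixD[OF A(1), unfolded d4_def]
  have 4: "A $ 1 $ 4 = 0" "A $ 2 $ 4 = 0" "A $ 3 $ 4 = 0"
    using br[of 4 1] br[of 4 2] br[of 1 2] by (simp_all add: matrix_simps)
  have 3: "A $ 3 $ 1 = 0" "A $ 3 $ 2 = 0" "A $ 3 $ 3 = A $ 1 $ 1 * A $ 2 $ 2 - A $ 1 $ 2 * A $ 2 $
      1"
    using br[of 1 2] 4 by (simp_all add: matrix_simps)
  obtain t c where "c \<noteq> 0" and w: "complexified_map A ?w = c *s ?w"
    and v: "complexified_map A (?v \<sigma>) = (complexified_map A (?v \<sigma>) $ 4) *s ?v
        \<sigma>' + t *s ?w"
    and "1 = complexified_map A (?v \<sigma>) $ 4 * 1"
    by (rule complexified_map_adapted_pair[OF A[unfolded d4_def] image, of 4 1 1])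
      (use 3(1,2) 4 in \<open>auto simp: matrix_simps coordinates algebra_simps\<close>)
  then have m: "A $ 4 $ 4 = 1"
    using 4 by (simp add: matrix_simps)
  have "A $ 1 $ 1 = Re c" "Im c = 0" "A $ 1 $ 2 = 0" "A $ 3 $ 3 = Re c"
    using arg_cong[OF w, of "\<lambda>z. z $ 1"] arg_cong[OF w, of "\<lambda>z. z $ 2"]
        arg_cong[OF w, of "\<lambda>z. z $ 3"] 3(1,2)
    by (auto simp: matrix_simps complex_eq_iff)
  moreover from this have "Re c \<noteq> 0"
    using \<open>c \<noteq> 0\<close> by (simp add: complex_eq_iff)
  moreover have "A $ 2 $ 1 = 0" "A $ 4 $ 1 * A $ 2 $ 2 - A $ 4 $ 2 * A $ 2 $ 1 = - A $ 2 $ 3"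
    using br[of 4 2] 4 m by (auto simp: matrix_simps)
  ultimately have "A $ 2 $ 3 = - A $ 4 $ 1" "A $ 3 $ 3 = A $ 1 $ 1" "A $ 1 $ 1 \<noteq> 0" "A $ 2
      $ 1 = 0"
    using 3(3) by simp_all
  moreover from this have "A $ 4 $ 1 = Re t" "Im t = 0"
    using arg_cong[OF v, of "\<lambda>z. z $ 1"] 3(1) by (simp_all add: matrix_simps complex_eq_iff)
  moreover have "\<sigma> * A $ 3 $ 3 + A $ 2 $ 3 = \<sigma>' - Re t"
    using arg_cong[OF v, of "\<lambda>z. z $ 3"] 4 m by (simp add: matrix_simps complex_eq_iff
        algebra_simps)
  ultimately show ?thesis
    by auto
qed

lemma bracket_matrix_r2':
  assumes A: "bracket_matrix r2' A"
  shows "A $ 3 $ 1 = 0" "A $ 3 $ 2 = 0" "A $ 4 $ 1 = 0" "A $ 4 $ 2 = 0"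
  using bracket_matrixD[OF A, unfolded r2'_def, of 1 3] bracket_matrixD[OF A, unfolded r2'_def, of
      1 4]
  by (simp_all add: matrix_simps)

text \<open>\<kappa> = 1 - \<i> b does not separate these: for \<open>b = - \<i>\<close> both
  subalgebras are abelian. But e_3 + \<i> e_4 lies in the complexified derived algebra, which is
  preserved, and e_2 + \<i> e_4 does not.\<close>

lemma not_equivalent_r2'_abelian:
  "\<not> equivalent_subalgebras r2' (span_pair (e 1 + b *s e 2 + d *s e 4, e 3 + \<i> *s e 4))
      (span_pair (e 1 + \<i> *s e 3, e 2 + \<i> *s e 4))"
proof
  assume "equivalent_subalgebras r2' (span_pair (e 1 + b *s e 2 + d *s e 4, e 3 + \<i> *s e 4))
      (span_pair (e 1 + \<i> *s e 3, e 2 + \<i> *s e 4))"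
  then obtain A where A: "bracket_matrix r2' A" "inj (complexified_map A)"
    and image: "complexified_map A ` span_pair (e 1 + b *s e 2 + d *s e 4, e 3 + \<i> *s e 4) =
      span_pair (e 1 + \<i> *s e 3, e 2 + \<i> *s e 4)"
    using equivalent_subalgebrasE[OF bilinear_listed(6)] by metis
  note entries = bracket_matrix_r2'[OF A(1)]
  obtain t c where "c \<noteq> 0" "complexified_map A (e 3 + \<i> *s e 4) = c *s (e 2 + \<i> *s e
      4)"
    by (rule complexified_map_adapted_pair[OF A[unfolded r2'_def] image, of 1 "1 - \<i> * b" 0])
      (use entries in \<open>auto simp: matrix_simps coordinates algebra_simps\<close>)
  then show False
    using entries by (simp add: matrix_simps)
qed

text \<open>On the derived algebra the map is multiplication by a non-zero complex number, because
  it preserves the eigenline of \<open>w\<close>; the bracket relations then make it trivial on the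
  quotient, so \<open>b\<close> is preserved. Apart from rescaling \<open>d\<close> it only adds a
  multiple of \<open>b - \<i>\<close>, which is zero for \<open>b = \<i>\<close>.\<close>

lemma not_equivalent_r2':
  assumes "equivalent_subalgebras r2' (span_pair (e 1 + b *s e 2 + d *s e 4, e 3 + \<i> *s e 4))
      (span_pair (e 1 + b' *s e 2 + d' *s e 4, e 3 + \<i> *s e 4))"
  shows "b = b' \<and> (b = \<i> \<longrightarrow> (d = 0 \<longleftrightarrow> d' = 0))"
proof -
  let ?v = "\<lambda>b d. e 1 + b *s e 2 + d *s e 4 :: complex ^ 4"
  let ?w = "e 3 + \<i> *s e 4 :: complex ^ 4"
  obtain A where A: "bracket_matrix r2' A" "inj (complexified_map A)"
    and image: "complexified_map A ` span_pair (?v b d, ?w) = span_pair (?v b' d', ?w)"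
    using equivalent_subalgebrasE[OF bilinear_listed(6) assms] by metis
  note br = bracket_matrixD[OF A(1), unfolded r2'_def]
  note entries = bracket_matrix_r2'[OF A(1)]
  obtain t c where "c \<noteq> 0" and w: "complexified_map A ?w = c *s ?w"
    and v: "complexified_map A (?v b d) = (complexified_map A (?v b d) $ 1) *s ?v b' d' + t *s ?w"
    by (rule complexified_map_adapted_pair[OF A[unfolded r2'_def] image, of 1 "1 - \<i> * b" "1 -
        \<i> * b'"])
      (use entries in \<open>auto simp: matrix_simps coordinates algebra_simps\<close>)
  define P Q where "P = A $ 3 $ 3" and "Q = A $ 3 $ 4"
  have PQ: "A $ 4 $ 3 = - Q" "A $ 4 $ 4 = P" and c: "c = Complex P (- Q)"
    using arg_cong[OF w, of "\<lambda>z. z $ 3"] arg_cong[OF w, of "\<lambda>z. z $ 4"]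
    by (auto simp: P_def Q_def matrix_simps complex_eq_iff)
  have nz: "P * P + Q * Q \<noteq> 0"
    using c \<open>c \<noteq> 0\<close> by (auto simp: sum_squares_eq_zero_iff complex_eq_iff)
  have "(A $ 1 $ 1 - 1) * P - A $ 1 $ 2 * Q = 0" "(A $ 1 $ 1 - 1) * Q + A $ 1 $ 2 * P = 0"
    "A $ 2 $ 1 * P - (A $ 2 $ 2 - 1) * Q = 0" "A $ 2 $ 1 * Q + (A $ 2 $ 2 - 1) * P = 0"
    using br[of 1 3] br[of 2 3] entries PQ by (simp_all add: P_def Q_def matrix_simps algebra_simps)
  then have "(P * P + Q * Q) * (A $ 1 $ 1 - 1) = 0" "(P * P + Q * Q) * A $ 1 $ 2 = 0"
    "(P * P + Q * Q) * A $ 2 $ 1 = 0" "(P * P + Q * Q) * (A $ 2 $ 2 - 1) = 0"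
    by algebra+
  then have 12: "A $ 1 $ 1 = 1" "A $ 1 $ 2 = 0" "A $ 2 $ 1 = 0" "A $ 2 $ 2 = 1"
    using nz by auto
  then have "A $ 2 $ 3 = - A $ 1 $ 4" "A $ 2 $ 4 = A $ 1 $ 3"
    using br[of 1 2] by (simp_all add: matrix_simps)
  then have v34: "of_real (A $ 1 $ 3) - b * of_real (A $ 1 $ 4) - d * of_real Q = t"
    "of_real (A $ 1 $ 4) + b * of_real (A $ 1 $ 3) + d * of_real P = d' + \<i> * t"
    using arg_cong[OF v, of "\<lambda>z. z $ 3"] arg_cong[OF v, of "\<lambda>z. z $ 4"] 12 entries
        PQ
    by (simp_all add: matrix_simps algebra_simps)
  have "d = 0 \<longleftrightarrow> d' = 0" if "b = \<i>"
  proof -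
    have "d * (of_real P + \<i> * of_real Q) = d'"
      using v34(2) unfolding v34(1)[symmetric] that by (simp add: algebra_simps)
    moreover have "of_real P + \<i> * of_real Q \<noteq> 0"
      using nz by (auto simp: complex_eq_iff)
    ultimately show ?thesis
      by auto
  qed
  moreover have "b = b'"
    using arg_cong[OF v, of "\<lambda>z. z $ 2"] 12 entries by (simp add: matrix_simps)
  ultimately show ?thesis
    by blast
qed

section \<open>Classification\<close>

text \<open>
  The explicit matrices solve the bracket relations together with the requirement that the images of
  the representative's two vectors be \<open>s *s v + t *s w\<close> and \<open>c *s w\<close>;
      here \<open>t\<close> is determined by the
  condition that the row \<open>A $ j\<close> be real.
\<close>

lemmas sign_cases = conj_disj_distribL conj_disj_distribR ex_disj_distrib

section \<open>Algebras with real eigenvalues and a single class\<close>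

lemma classified_rh3:
  "classified_by rh3
      {(e 1 + \<i> *s e 2, e 3 + \<i> *s e 4)}
      {(e 1 + b1 *s e 2 + d1 *s e 4, e 3 + d2 *s e 4) | b1 d1 d2. Im b1 * Im d2 \<noteq> 0}"
  (is "classified_by _ ?R ?Q")
proof (rule classified_by_normal_pairsI[OF coordinate_order(1)])
  fix b c x y assume inv: "invariant_complex_subalgebra rh3 (span_pair (normal_pair 1 3 2 4 b c x
      y))"
  then have *: "Im b \<noteq> 0" "Im y \<noteq> 0" "x = 0"
    by (simp_all add: invariant_rh3_1324)
  then show "normal_pair 1 3 2 4 b c x y \<in> ?Q"
    by (simp add: normal_pair_def coordinates)
  \<comment> \<open>With \<open>t = 0\<close> the image of \<open>v\<close> fixes rows 1 and 2, and
    [e_1, e_2] = e_3 makes row 3 equal to \<open>Im b\<close> times e_3. So the scale of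
    \<open>w\<close> has real part \<open>Im b\<close>; as row 3 has no e_4 component, the imaginary
    part is chosen to make the scale times \<open>y\<close> purely imaginary.\<close>
  have "equivalent_subalgebras rh3 (span_pair (e 1 + \<i> *s e 2, e 3 + \<i> *s e 4))
      (span_pair (normal_pair 1 3 2 4 b c x y))"
    by (rule equivalent_subalgebrasI[OF bilinear_listed(1) _ _ _ _ _ inv, where s = 1 and t = 0
          and c = "Complex (Im b) (Im b * Re y / Im y)"
          and A = "vector [vector [1, Re b, 0, Re c], vector [0, Im b, 0, Im c],
            vector [0, 0, Im b, 0],
            vector [0, 0, Im b * Re y / Im y, Im b * ((Re y)\<^sup>2 + (Im y)\<^sup>2) / Im y]]"])
      (use * in \<open>simp_all add: rh3_def matrix_simps complex_eq_iff field_simps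
          power2_eq_square\<close>)
  then show "\<exists>p\<in>?R. equivalent_subalgebras rh3 (span_pair p) (span_pair (normal_pair 1
      3 2 4 b c x y))"
    by simp
next
  fix p assume "p \<in> ?Q"
  then have "\<exists>b c y. p = normal_pair 1 3 2 4 b c 0 y \<and> Im b * Im y \<noteq> 0"
    by (auto simp: normal_pair_def coordinates)
  then show "invariant_complex_subalgebra rh3 (span_pair p)"
    by (auto simp: invariant_rh3_1324)
qed (auto simp: invariant_rh3_1234 coordinates)

lemma classified_rr3_par_0:
  "classified_by (rr3_par 0)
      {(e 1 + \<i> *s e 2, e 3 + \<i> *s e 4)}
      {(e 1 + b1 *s e 2 + d1 *s e 4, e 3 + d2 *s e 4) | b1 d1 d2. Im b1 * Im d2 \<noteq> 0}"
  (is "classified_by _ ?R ?Q")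
proof (rule classified_by_normal_pairsI[OF coordinate_order(1)])
  fix b c x y assume inv: "invariant_complex_subalgebra (rr3_par 0) (span_pair (normal_pair 1 3 2
      4 b c x y))"
  then have *: "Im b \<noteq> 0" "Im y \<noteq> 0" "x = 0"
    by (auto simp: invariant_rr3_par_1324)
  then show "normal_pair 1 3 2 4 b c x y \<in> ?Q"
    by (simp add: normal_pair_def coordinates)
  have "equivalent_subalgebras (rr3_par 0) (span_pair (e 1 + \<i> *s e 2, e 3 + \<i> *s e 4))
      (span_pair (normal_pair 1 3 2 4 b c x y))"
    by (rule equivalent_subalgebrasI[OF bilinear_listed(3) _ _ _ _ _ inv, where s = 1 and t = "-
        of_real (Im c / Im y)"
          and c = "1"
          and A = "vector [vector [1, Re b, - (Im c / Im y), Re c - Im c / Im y * Re y], vector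
              [0, Im b, 0, 0],
            vector [0, 0, 1, Re y], vector [0, 0, 0, Im y]]"])
      (use * in \<open>simp_all add: rr3_par_def matrix_simps complex_eq_iff field_simps
          power2_eq_square\<close>)
  then show "\<exists>p\<in>?R. equivalent_subalgebras (rr3_par 0) (span_pair p) (span_pair
      (normal_pair 1 3 2 4 b c x y))"
    by simp
next
  fix p assume "p \<in> ?Q"
  then have "\<exists>b c y. p = normal_pair 1 3 2 4 b c 0 y \<and> Im b * Im y \<noteq> 0"
    by (auto simp: normal_pair_def coordinates)
  then show "invariant_complex_subalgebra (rr3_par 0) (span_pair p)"
    by (auto simp: invariant_rr3_par_1324)
qed (auto simp: invariant_rr3_par_1234 coordinates)

lemma classified_rr3_par_1:
  "classified_by (rr3_par 1)
      {(e 1 + \<i> *s e 4, e 3 + \<i> *s e 2)}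
      {(e 1 + b1 *s e 2 + d1 *s e 4, b2 *s e 2 + e 3) | b1 b2 d1. Im b2 * Im d1 \<noteq> 0}"
  (is "classified_by _ ?R ?Q")
proof (rule classified_by_normal_pairsI[OF coordinate_order(1)])
  fix b c x y assume inv: "invariant_complex_subalgebra (rr3_par 1) (span_pair (normal_pair 1 3 2
      4 b c x y))"
  then have *: "Im x \<noteq> 0" "Im c \<noteq> 0" "y = 0"
    by (auto simp: invariant_rr3_par_1324)
  then show "normal_pair 1 3 2 4 b c x y \<in> ?Q"
    by (simp add: normal_pair_def coordinates)
  have "equivalent_subalgebras (rr3_par 1) (span_pair (e 1 + \<i> *s e 4, e 3 + \<i> *s e 2))
      (span_pair (normal_pair 1 3 2 4 b c x y))"
    by (rule equivalent_subalgebrasI[OF bilinear_listed(3) _ _ _ _ _ inv, where s = 1 and t = "-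
        of_real (Im b / Im x)"
          and c = "1"
          and A = "vector [vector [1, Re b - Im b / Im x * Re x, - (Im b / Im x), Re c], vector
              [0, Im x, 0, 0],
            vector [0, Re x, 1, 0], vector [0, 0, 0, Im c]]"])
      (use * in \<open>simp_all add: rr3_par_def matrix_simps complex_eq_iff field_simps
          power2_eq_square\<close>)
  then show "\<exists>p\<in>?R. equivalent_subalgebras (rr3_par 1) (span_pair p) (span_pair
      (normal_pair 1 3 2 4 b c x y))"
    by simp
next
  fix p assume "p \<in> ?Q"
  then have "\<exists>b c x. p = normal_pair 1 3 2 4 b c x 0 \<and> Im x * Im c \<noteq> 0"
    by (auto simp: normal_pair_def coordinates)
  then show "invariant_complex_subalgebra (rr3_par 1) (span_pair p)"
    by (auto simp: invariant_rr3_par_1324)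
qed (auto simp: invariant_rr3_par_1234 coordinates)

lemma classified_r2r2:
  "classified_by r2r2
      {(e 1 + \<i> *s e 2, e 3 + \<i> *s e 4)}
      {(e 1 + b1 *s e 2 + d1 *s e 4, e 3 + d2 *s e 4) | b1 d1 d2.
         Im b1 * Im d2 \<noteq> 0 \<and>
         complex_subalgebra r2r2 (span_pair (e 1 + b1 *s e 2 + d1 *s e 4, e 3 + d2 *s e 4))}"
  (is "classified_by _ ?R ?Q")
proof (rule classified_by_normal_pairsI[OF coordinate_order(1)])
  fix b c x y assume inv: "invariant_complex_subalgebra r2r2 (span_pair (normal_pair 1 3 2 4 b c x
      y))"
  then have *: "Im b \<noteq> 0" "Im y \<noteq> 0" "x = 0" "c = 0"
    by (simp_all add: invariant_r2r2_1324)
  then have P: "normal_pair 1 3 2 4 b c x y = (e 1 + b *s e 2 + c *s e 4, e 3 + y *s e 4)"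
    and nz: "Im b * Im y \<noteq> 0"
    by (simp_all add: normal_pair_def)
  have "complex_subalgebra r2r2 (span_pair (e 1 + b *s e 2 + c *s e 4, e 3 + y *s e 4))"
    using inv unfolding P invariant_complex_subalgebra_def by blast
  then show "normal_pair 1 3 2 4 b c x y \<in> ?Q"
    unfolding P using nz by blast
  have "equivalent_subalgebras r2r2 (span_pair (e 1 + \<i> *s e 2, e 3 + \<i> *s e 4))
      (span_pair (normal_pair 1 3 2 4 b c x y))"
    by (rule equivalent_subalgebrasI[OF bilinear_listed(5) _ _ _ _ _ inv, where s = 1 and t = "0"
          and c = "1"
          and A = "vector [vector [1, Re b, 0, 0], vector [0, Im b, 0, 0],
            vector [0, 0, 1, Re y], vector [0, 0, 0, Im y]]"])
      (use * in \<open>simp_all add: r2r2_def matrix_simps complex_eq_iff field_simps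
          power2_eq_square\<close>)
  then show "\<exists>p\<in>?R. equivalent_subalgebras r2r2 (span_pair p) (span_pair (normal_pair
      1 3 2 4 b c x y))"
    by simp
next
  fix p assume "p \<in> ?Q"
  then obtain b1 d1 d2 where p: "p = (e 1 + b1 *s e 2 + d1 *s e 4, e 3 + d2 *s e 4)"
      "Im b1 * Im d2 \<noteq> 0" "complex_subalgebra r2r2 (span_pair p)"
    by auto
  have np: "p = normal_pair 1 3 2 4 b1 d1 0 d2"
    by (simp add: p(1) normal_pair_def add.commute)
  \<comment> \<open>Membership in \<open>?Q\<close> already contains closure under the bracket, so
    only the determinant of imaginary parts is left.\<close>
  show "invariant_complex_subalgebra r2r2 (span_pair p)"
    using p(2,3) unfolding np invariant_normal_pair_iff[OF coordinate_order(1)] by (simp add: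
        mult.commute)
next
  have rep: "invariant_complex_subalgebra r2r2 (span_pair (normal_pair 1 3 2 4 \<i> 0 0 \<i>))"
    by (simp add: invariant_r2r2_1324)
  show "p \<in> ?Q \<or> invariant_complex_subalgebra r2r2 (span_pair p)" if "p \<in> ?R" for p
    using that rep by (simp add: normal_pair_def)
qed (auto simp: invariant_r2r2_1234)

lemma classified_r4_par_1:
  "classified_by (r4_par 1)
      {(e 4 + \<i> *s e 3, e 1 + \<i> *s e 2)}
      {(e 4 + b1 *s e 2 + c1 *s e 3, e 1 + b2 *s e 2) | b1 b2 c1. Im c1 * Im b2 \<noteq> 0}"
  (is "classified_by _ ?R ?Q")
proof (rule classified_by_normal_pairsI[OF coordinate_order(3)])
  fix b c x y assume inv: "invariant_complex_subalgebra (r4_par 1) (span_pair (normal_pair 4 1 2 3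
      b c x y))"
  then have *: "Im x \<noteq> 0" "Im c \<noteq> 0" "y = 0"
    by (simp_all add: invariant_r4_par_4123)
  then show "normal_pair 4 1 2 3 b c x y \<in> ?Q"
    by (simp add: normal_pair_def coordinates)
  \<comment> \<open>The image of e_3 is the imaginary part of \<open>v\<close>; [e_4, e_3] = e_2 +
    e_3 then sends e_2 to \<open>Im c\<close> times e_2, which fixes the scale
    \<open>Im c / Im x\<close> of \<open>w\<close>.\<close>
  have "equivalent_subalgebras (r4_par 1) (span_pair (e 4 + \<i> *s e 3, e 1 + \<i> *s e 2))
      (span_pair (normal_pair 4 1 2 3 b c x y))"
    by (rule equivalent_subalgebrasI[OF bilinear_listed(9) _ _ _ _ _ inv, where s = 1 and t = "0"
          and c = "of_real (Im c / Im x)"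
          and A = "vector [vector [Im c / Im x, Im c / Im x * Re x, 0, 0], vector [0, Im c, 0, 0],
            vector [0, Im b, Im c, 0], vector [0, Re b, Re c, 1]]"])
      (use * in \<open>simp_all add: r4_par_def matrix_simps complex_eq_iff field_simps
          power2_eq_square\<close>)
  then show "\<exists>p\<in>?R. equivalent_subalgebras (r4_par 1) (span_pair p) (span_pair
      (normal_pair 4 1 2 3 b c x y))"
    by simp
next
  fix p assume "p \<in> ?Q"
  then have "\<exists>b c x. p = normal_pair 4 1 2 3 b c x 0 \<and> Im c * Im x \<noteq> 0"
    by (auto simp: normal_pair_def coordinates)
  then show "invariant_complex_subalgebra (r4_par 1) (span_pair p)"
    by (auto simp: invariant_r4_par_4123)
qed (auto simp: invariant_r4_par_4213 coordinates)

lemma classified_r4_par2_1: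
  assumes "\<alpha> \<noteq> 1"
  shows "classified_by (r4_par2 \<alpha> 1)
      {(e 4 + \<i> *s e 2, e 1 + \<i> *s e 3)}
      {(e 4 + b1 *s e 2 + c1 *s e 3, e 1 + c2 *s e 3) | b1 c1 c2. Im b1 * Im c2 \<noteq> 0}"
  (is "classified_by _ ?R ?Q")
proof (rule classified_by_normal_pairsI[OF coordinate_order(3)])
  fix b c x y assume inv: "invariant_complex_subalgebra (r4_par2 \<alpha> 1) (span_pair
      (normal_pair 4 1 2 3 b c x y))"
  then have *: "Im b \<noteq> 0" "Im y \<noteq> 0" "x = 0"
    using assms by (auto simp: invariant_r4_par2_4123)
  then show "normal_pair 4 1 2 3 b c x y \<in> ?Q"
    by (simp add: normal_pair_def coordinates)
  have "equivalent_subalgebras (r4_par2 \<alpha> 1) (span_pair (e 4 + \<i> *s e 2, e 1 + \<i> *s e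
      3))
      (span_pair (normal_pair 4 1 2 3 b c x y))"
    by (rule equivalent_subalgebrasI[OF bilinear_listed(10) _ _ _ _ _ inv, where s = 1 and t = "-
        of_real (Im c / Im y)"
          and c = "1"
          and A = "vector [vector [1, 0, Re y, 0], vector [0, Im b, 0, 0],
            vector [0, 0, Im y, 0], vector [- (Im c / Im y), Re b, Re c - Im c / Im y * Re y, 1]]"])
      (use * in \<open>simp_all add: r4_par2_def matrix_simps complex_eq_iff field_simps
          power2_eq_square\<close>)
  then show "\<exists>p\<in>?R. equivalent_subalgebras (r4_par2 \<alpha> 1) (span_pair p)
      (span_pair (normal_pair 4 1 2 3 b c x y))"
    by simp
next
  fix p assume "p \<in> ?Q"
  then have "\<exists>b c y. p = normal_pair 4 1 2 3 b c 0 y \<and> Im b * Im y \<noteq> 0"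
    by (auto simp: normal_pair_def coordinates)
  then show "invariant_complex_subalgebra (r4_par2 \<alpha> 1) (span_pair p)"
    by (auto simp: invariant_r4_par2_4123)
qed (use assms in \<open>auto simp: invariant_r4_par2_4213 coordinates\<close>)

lemma classified_r4_par2_same:
  assumes "\<alpha> \<noteq> 1"
  shows "classified_by (r4_par2 \<alpha> \<alpha>)
      {(e 4 + \<i> *s e 1, e 2 + \<i> *s e 3)}
      {(e 4 + a1 *s e 1 + c1 *s e 3, a2 *s e 1 + e 2 + c2 *s e 3) | a1 a2 c1 c2.
         Im c1 * Im a2 - Im a1 * Im c2 \<noteq> 0 \<and>
         complex_subalgebra (r4_par2 \<alpha> \<alpha>)
           (span_pair (e 4 + a1 *s e 1 + c1 *s e 3, a2 *s e 1 + e 2 + c2 *s e 3))}"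
  (is "classified_by _ ?R ?Q")
proof (rule classified_by_normal_pairsI[OF coordinate_order(4)])
  fix b c x y assume inv: "invariant_complex_subalgebra (r4_par2 \<alpha> \<alpha>) (span_pair
      (normal_pair 4 2 1 3 b c x y))"
  then have *: "Im b \<noteq> 0" "Im y \<noteq> 0" "x = 0"
    using assms by (auto simp: invariant_r4_par2_4213)
  then have P: "normal_pair 4 2 1 3 b c x y = (e 4 + b *s e 1 + c *s e 3, 0 *s e 1 + e 2 + y *s e
      3)"
    and nz: "Im c * Im 0 - Im b * Im y \<noteq> 0"
    by (simp_all add: normal_pair_def)
  have "complex_subalgebra (r4_par2 \<alpha> \<alpha>) (span_pair (e 4 + b *s e 1 + c *s e 3, 0 *s
      e 1 + e 2 + y *s e 3))"
    using inv unfolding P invariant_complex_subalgebra_def by blast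
  then show "normal_pair 4 2 1 3 b c x y \<in> ?Q"
    unfolding P using nz by blast
  have "equivalent_subalgebras (r4_par2 \<alpha> \<alpha>) (span_pair (e 4 + \<i> *s e 1, e 2 +
      \<i> *s e 3))
      (span_pair (normal_pair 4 2 1 3 b c x y))"
    by (rule equivalent_subalgebrasI[OF bilinear_listed(10) _ _ _ _ _ inv, where s = 1 and t = "-
        of_real (Im c / Im y)"
          and c = "1"
          and A = "vector [vector [Im b, 0, 0, 0], vector [0, 1, Re y, 0],
            vector [0, 0, Im y, 0], vector [Re b, - (Im c / Im y), Re c - Im c / Im y * Re y, 1]]"])
      (use * in \<open>simp_all add: r4_par2_def matrix_simps complex_eq_iff field_simps
          power2_eq_square\<close>)
  then show "\<exists>p\<in>?R. equivalent_subalgebras (r4_par2 \<alpha> \<alpha>) (span_pair p)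
      (span_pair (normal_pair 4 2 1 3 b c x y))"
    by simp
next
  fix p assume "p \<in> ?Q"
  then obtain a1 a2 c1 c2 where p: "p = (e 4 + a1 *s e 1 + c1 *s e 3, a2 *s e 1 + e 2 + c2 *s e 3)"
      "Im c1 * Im a2 - Im a1 * Im c2 \<noteq> 0" "complex_subalgebra (r4_par2 \<alpha> \<alpha>)
          (span_pair p)"
    by auto
  have np: "p = normal_pair 4 2 1 3 a1 c1 a2 c2"
    by (simp add: p(1) normal_pair_def add.commute)
  show "invariant_complex_subalgebra (r4_par2 \<alpha> \<alpha>) (span_pair p)"
    using p(2,3) unfolding np invariant_normal_pair_iff[OF coordinate_order(4)] by (simp add:
        mult.commute)
next
  have rep: "invariant_complex_subalgebra (r4_par2 \<alpha> \<alpha>) (span_pair (normal_pair 4 2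
      1 3 \<i> 0 0 \<i>))"
    by (simp add: invariant_r4_par2_4213)
  show "p \<in> ?Q \<or> invariant_complex_subalgebra (r4_par2 \<alpha> \<alpha>) (span_pair p)"
      if "p \<in> ?R" for p
    using that rep by (simp add: normal_pair_def)
qed (use assms in \<open>auto simp: invariant_r4_par2_4123\<close>)

lemma classified_d4_par_1:
  "classified_by (d4_par 1)
      {(e 4 - \<i> *s e 1, e 2 + \<i> *s e 3)}
      {(e 4 - c2 *s e 1 + c1 *s e 3, e 2 + c2 *s e 3) | c1 c2. Im c2 \<noteq> 0}"
  (is "classified_by _ ?R ?Q")
proof (rule classified_by_normal_pairsI[OF coordinate_order(4)])
  fix b c x y assume inv: "invariant_complex_subalgebra (d4_par 1) (span_pair (normal_pair 4 2 1 3
      b c x y))"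
  then have *: "Im y \<noteq> 0" "x = 0" "b = - y"
    by (auto simp: invariant_d4_par_4213)
  then show "normal_pair 4 2 1 3 b c x y \<in> ?Q"
    by (simp add: normal_pair_def coordinates)
  have "equivalent_subalgebras (d4_par 1) (span_pair (e 4 - \<i> *s e 1, e 2 + \<i> *s e 3))
      (span_pair (normal_pair 4 2 1 3 b c x y))"
    by (rule equivalent_subalgebrasI[OF bilinear_listed(13) _ _ _ _ _ inv, where s = 1 and t = "0"
          and c = "1"
          and A = "vector [vector [Im y, 0, - Im c, 0], vector [0, 1, Re y, 0],
            vector [0, 0, Im y, 0], vector [- Re y, 0, Re c, 1]]"])
      (use * in \<open>simp_all add: d4_par_def matrix_simps complex_eq_iff field_simps
          power2_eq_square\<close>)
  then show "\<exists>p\<in>?R. equivalent_subalgebras (d4_par 1) (span_pair p) (span_pair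
      (normal_pair 4 2 1 3 b c x y))"
    by simp
next
  fix p assume "p \<in> ?Q"
  then have "\<exists>c y. p = normal_pair 4 2 1 3 (- y) c 0 y \<and> Im y \<noteq> 0"
    by (auto simp: normal_pair_def coordinates)
  then show "invariant_complex_subalgebra (d4_par 1) (span_pair p)"
    by (auto simp: invariant_d4_par_4213)
qed (auto simp: invariant_d4_par_4123 coordinates)

lemma classified_h4:
  "classified_by h4
      {(e 4 + \<i> *s e 2, e 1 + (2 * \<i>) *s e 3)}
      {(e 4 + b1 *s e 2 + c1 *s e 3, e 1 + (2 * b1) *s e 3) | b1 c1. Im b1 \<noteq> 0}"
  (is "classified_by _ ?R ?Q")
proof (rule classified_by_normal_pairsI[OF coordinate_order(3)])
  fix b c x y assume inv: "invariant_complex_subalgebra h4 (span_pair (normal_pair 4 1 2 3 b c x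
      y))"
  then have *: "Im b \<noteq> 0" "x = 0" "y = 2 * b"
    by (simp_all add: invariant_h4_4123)
  then show "normal_pair 4 1 2 3 b c x y \<in> ?Q"
    by (simp add: normal_pair_def coordinates)
  \<comment> \<open>Every real \<open>t\<close> keeps the row of e_4 real; its value comes from the
    e_3 coordinate of [e_4, e_2] = e_1 + (1/2) e_2. The e_1 coordinate of the same relation gives
    the scale \<open>Im b\<close> of \<open>w\<close>.\<close>
  have "equivalent_subalgebras h4 (span_pair (e 4 + \<i> *s e 2, e 1 + (2 * \<i>) *s e 3))
      (span_pair (normal_pair 4 1 2 3 b c x y))"
    by (rule equivalent_subalgebrasI[OF bilinear_listed(15) _ _ _ _ _ inv, where s = 1 and t =
        "of_real (Re b - Im c / (4 * Im b))"
          and c = "of_real (Im b)"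
          and A = "vector [vector [Im b, 0, 2 * Im b * Re b, 0], vector [0, Im b, Im c / 2 + 2 *
              Im b * Re b, 0],
            vector [0, 0, (Im b)\<^sup>2, 0], vector [Re b - Im c / (4 * Im b), Re b, Re c + 2 *
                (Re b - Im c / (4 * Im b)) * Re b, 1]]"])
      (use * in \<open>simp_all add: h4_def matrix_simps complex_eq_iff field_simps
          power2_eq_square\<close>)
  then show "\<exists>p\<in>?R. equivalent_subalgebras h4 (span_pair p) (span_pair (normal_pair 4
      1 2 3 b c x y))"
    by simp
next
  fix p assume "p \<in> ?Q"
  then have "\<exists>b c. p = normal_pair 4 1 2 3 b c 0 (2 * b) \<and> Im b \<noteq> 0"
    by (auto simp: normal_pair_def coordinates)
  then show "invariant_complex_subalgebra h4 (span_pair p)"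
    by (auto simp: invariant_h4_4123)
qed (auto simp: invariant_h4_4213 coordinates)

section \<open>Rotation blocks on an abelian ideal\<close>

lemma equivalent_rr3':
  assumes inv: "invariant_complex_subalgebra (rr3' g) (span_pair (normal_pair 1 2 3 4 b c x y))"
  shows "equivalent_subalgebras (rr3' g) (span_pair (e 1 + \<i> *s e 4, e 2 + x *s e 3))
    (span_pair (normal_pair 1 2 3 4 b c x y))"
proof -
  have *: "Im c \<noteq> 0" "x = \<i> \<or> x = - \<i>" "y = 0"
    using inv by (simp_all add: invariant_rr3'_1234)
  show ?thesis
    by (rule equivalent_subalgebrasI[OF bilinear_listed(4) _ _ _ _ _ inv, where s = 1
          and t = "- of_real (Im b * Im x)" and c = 1
          and A = "vector [vector [1, - (Im b * Im x), Re b, Re c], vector [0, 1, 0, 0],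
            vector [0, 0, 1, 0], vector [0, 0, 0, Im c]]"])
      (use * in \<open>auto simp: rr3'_def matrix_simps complex_eq_iff field_simps\<close>)
qed

lemma classified_rr3'_0:
  "classified_by (rr3' 0)
      {(e 1 + \<i> *s e 4, e 2 + \<i> *s e 3)}
      {(e 1 + c1 *s e 3 + d1 *s e 4, e 2 - (complex_of_real \<epsilon> * \<i>) *s e 3) | c1 d1
          \<epsilon>.
         \<epsilon> \<in> {1, -1} \<and> Im d1 \<noteq> 0}"
  (is "classified_by _ ?R ?Q")
proof (rule classified_by_normal_pairsI[OF coordinate_order(2)])
  fix b c x y assume inv: "invariant_complex_subalgebra (rr3' 0) (span_pair (normal_pair 1 2 3 4 b
      c x y))"
  then have *: "Im c \<noteq> 0" "x = \<i> \<or> x = - \<i>" "y = 0"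
    by (simp_all add: invariant_rr3'_1234)
  then show "normal_pair 1 2 3 4 b c x y \<in> ?Q"
    by (auto simp: normal_pair_def coordinates sign_cases)
  have "equivalent_subalgebras (rr3' 0) (span_pair (e 1 + \<i> *s e 4, e 2 + \<i> *s e 3))
      (span_pair (normal_pair 1 2 3 4 b c x y))"
  proof (cases "x = \<i>")
    case True
    then show ?thesis
      using equivalent_rr3'[OF inv] by simp
  next
    case False
    then have "x = - \<i>"
      using * by simp
    \<comment> \<open>For \<gamma> = 0 reversing e_1 and e_3 is an automorphism; it exchanges the
      two eigenlines of ad e_1, hence \<open>s = -1\<close>.\<close>
    show ?thesis
      by (rule equivalent_subalgebrasI[OF bilinear_listed(4) _ _ _ _ _ inv, where s = "-1"
            and t = "- of_real (Im b)" and c = 1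
            and A = "vector [vector [-1, - Im b, - Re b, - Re c], vector [0, 1, 0, 0],
              vector [0, 0, -1, 0], vector [0, 0, 0, - Im c]]"])
        (use * \<open>x = - \<i>\<close> in \<open>auto simp: rr3'_def matrix_simps complex_eq_iff
            field_simps\<close>)
  qed
  then show "\<exists>p\<in>?R. equivalent_subalgebras (rr3' 0) (span_pair p) (span_pair
      (normal_pair 1 2 3 4 b c x y))"
    by simp
next
  fix p assume "p \<in> ?Q"
  then have "\<exists>b c x. p = normal_pair 1 2 3 4 b c x 0 \<and> Im c \<noteq> 0 \<and> (x =
      \<i> \<or> x = - \<i>)"
    by (auto simp: normal_pair_def coordinates)
  then show "invariant_complex_subalgebra (rr3' 0) (span_pair p)"
    by (auto simp: invariant_rr3'_1234)
qed (auto simp: invariant_rr3'_1324 coordinates sign_cases)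

lemma classified_rr3'_pos:
  assumes "\<gamma> > 0"
  shows "classified_by (rr3' \<gamma>)
      {(e 1 + \<i> *s e 4, e 2 - \<i> *s e 3), (e 1 + \<i> *s e 4, e 2 + \<i> *s e 3)}
      {(e 1 + c1 *s e 3 + d1 *s e 4, e 2 - (complex_of_real \<epsilon> * \<i>) *s e 3) | c1 d1
          \<epsilon>.
         \<epsilon> \<in> {1, -1} \<and> Im d1 \<noteq> 0}"
  (is "classified_by _ ?R ?Q")
proof (rule classified_by_normal_pairsI[OF coordinate_order(2)])
  fix b c x y assume inv: "invariant_complex_subalgebra (rr3' \<gamma>) (span_pair (normal_pair 1
      2 3 4 b c x y))"
  then have *: "Im c \<noteq> 0" "x = \<i> \<or> x = - \<i>" "y = 0"
    by (simp_all add: invariant_rr3'_1234)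
  then show "normal_pair 1 2 3 4 b c x y \<in> ?Q"
    by (auto simp: normal_pair_def coordinates sign_cases)
  show "\<exists>p\<in>?R. equivalent_subalgebras (rr3' \<gamma>) (span_pair p) (span_pair
      (normal_pair 1 2 3 4 b c x y))"
    using *(2) equivalent_rr3'[OF inv] by auto
next
  fix p assume "p \<in> ?Q"
  then have "\<exists>b c x. p = normal_pair 1 2 3 4 b c x 0 \<and> Im c \<noteq> 0 \<and> (x =
      \<i> \<or> x = - \<i>)"
    by (auto simp: normal_pair_def coordinates)
  then show "invariant_complex_subalgebra (rr3' \<gamma>) (span_pair p)"
    by (auto simp: invariant_rr3'_1234)
next
  fix p p' assume "p \<in> ?R" "p' \<in> ?R" "p \<noteq> p'"
  then show "\<not> equivalent_subalgebras (rr3' \<gamma>) (span_pair p) (span_pair p')"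
    using not_equivalent_rr3'[of \<gamma> \<i> "- \<i>"] not_equivalent_rr3'[of \<gamma> "- \<i>"
        \<i>] assms by auto
qed (auto simp: invariant_rr3'_1324 coordinates sign_cases)

lemma classified_r4':
  assumes "\<delta> > 0"
  shows "classified_by (r4' \<gamma> \<delta>)
      {(e 4 + \<i> *s e 1, e 2 + \<i> *s e 3), (e 4 + \<i> *s e 1, e 2 - \<i> *s e 3)}
      {(e 4 + a1 *s e 1 + c1 *s e 3, e 2 + (complex_of_real \<epsilon> * \<i>) *s e 3) | a1 c1
          \<epsilon>.
         \<epsilon> \<in> {1, -1} \<and> Im a1 \<noteq> 0}"
  (is "classified_by _ ?R ?Q")
proof (rule classified_by_normal_pairsI[OF coordinate_order(4)])
  fix b c x y assume inv: "invariant_complex_subalgebra (r4' \<gamma> \<delta>) (span_pair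
      (normal_pair 4 2 1 3 b c x y))"
  then have *: "Im b \<noteq> 0" "y = \<i> \<or> y = - \<i>" "x = 0"
    using assms by (simp_all add: invariant_r4'_4213)
  then show "normal_pair 4 2 1 3 b c x y \<in> ?Q"
    by (auto simp: normal_pair_def coordinates sign_cases)
  have "equivalent_subalgebras (r4' \<gamma> \<delta>) (span_pair (e 4 + \<i> *s e 1, e 2 + y *s e
      3))
      (span_pair (normal_pair 4 2 1 3 b c x y))"
    by (rule equivalent_subalgebrasI[OF bilinear_listed(11) _ _ _ _ _ inv, where s = 1
          and t = "- of_real (Im c * Im y)" and c = 1
          and A = "vector [vector [Im b, 0, 0, 0], vector [0, 1, 0, 0],
            vector [0, 0, 1, 0], vector [Re b, - (Im c * Im y), Re c, 1]]"])
      (use * in \<open>auto simp: r4'_def matrix_simps complex_eq_iff field_simps\<close>)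
  then show "\<exists>p\<in>?R. equivalent_subalgebras (r4' \<gamma> \<delta>) (span_pair p)
      (span_pair (normal_pair 4 2 1 3 b c x y))"
    using *(2) by auto
next
  fix p assume "p \<in> ?Q"
  then have "\<exists>b c y. p = normal_pair 4 2 1 3 b c 0 y \<and> Im b \<noteq> 0 \<and> (y =
      \<i> \<or> y = - \<i>)"
    by (auto simp: normal_pair_def coordinates)
  then show "invariant_complex_subalgebra (r4' \<gamma> \<delta>) (span_pair p)"
    using assms by (auto simp: invariant_r4'_4213)
next
  fix p p' assume "p \<in> ?R" "p' \<in> ?R" "p \<noteq> p'"
  then show "\<not> equivalent_subalgebras (r4' \<gamma> \<delta>) (span_pair p) (span_pair p')"
    using not_equivalent_r4'[of \<gamma> \<delta> \<i> "- \<i>"] not_equivalent_r4'[of \<gamma>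
        \<delta> "- \<i>" \<i>] assms by auto
qed (use assms in \<open>auto simp: invariant_r4'_4123 coordinates sign_cases\<close>)

section \<open>Heisenberg ideals with several classes\<close>

lemma classified_d4:
  "classified_by d4
      {(e 1 - \<i> *s e 3, e 4 + \<i> *s e 2), (e 4 + \<i> *s (e 2 + e 3), e 1 - \<i> *s e 3)}
      ({(e 4 + b1 *s e 2 + c1 *s e 3, e 1 - b1 *s e 3) | b1 c1. Im b1 \<noteq> 0} \<union>
       {(e 4 + a1 *s e 1 + c1 *s e 3, e 2 - a1 *s e 3) | a1 c1. Im a1 \<noteq> 0})"
  (is "classified_by _ ?R (?Q1 \<union> ?Q2)")
proof (rule classified_by_normal_pairsI[OF coordinate_order(3)])
  let ?rep = "\<lambda>\<sigma>. (e 4 + \<i> *s (e 2 + of_real \<sigma> *s e 3), e 1 - \<i> *s e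
      3) :: (complex ^ 4) \<times> (complex ^ 4)"
  \<comment> \<open>The first representative is listed with its vectors in the opposite order; up to
    this, both belong to one family with \<sigma> equal to 0 or 1.\<close>
  have rep: "span_pair (e 1 - \<i> *s e 3, e 4 + \<i> *s e 2) = span_pair (?rep 0)"
    "(e 4 + \<i> *s (e 2 + e 3), e 1 - \<i> *s e 3) = ?rep 1"
    by (simp_all add: span_pair_swap)
  fix b c x y :: complex
  \<comment> \<open>e_3 gets scaled by \<open>s * Im b\<close>, so
    \<open>\<sigma> * s * Im b = Im c\<close> has to be solved; for \<open>Im c = 0\<close> this
    forces \<sigma> = 0 and leaves \<open>s\<close> free.\<close>
  define \<sigma> s where "\<sigma> = (if Im c = 0 then 0 else 1 :: real)" and "s = (if Im c = 0
      then 1 else Im c / Im b)"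
  have rep_\<sigma>: "\<exists>p\<in>?R. span_pair p = span_pair (?rep \<sigma>)"
    using rep by (simp add: \<sigma>_def)
  {
    assume inv: "invariant_complex_subalgebra d4 (span_pair (normal_pair 4 1 2 3 b c x y))"
    then have *: "Im b \<noteq> 0" "x = 0" "y = - b"
      by (simp_all add: invariant_d4_4123)
    then show "normal_pair 4 1 2 3 b c x y \<in> ?Q1 \<union> ?Q2"
      by (auto simp: normal_pair_def coordinates)
    have "\<sigma> * s * Im b = Im c" "s \<noteq> 0"
      using * by (auto simp: \<sigma>_def s_def)
    then have "equivalent_subalgebras d4 (span_pair (?rep \<sigma>)) (span_pair (normal_pair 4 1 2
        3 b c x y))"
      by (intro equivalent_subalgebrasI[OF bilinear_listed(12) _ _ _ _ _ inv, where s = 1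
            and t = 0 and c = "of_real s"
            and A = "vector [vector [s, 0, - (Re b * s), 0], vector [0, Im b, 0, 0],
              vector [0, 0, s * Im b, 0], vector [0, Re b, Re c, 1]]"])
        (use * in \<open>auto simp: d4_def matrix_simps complex_eq_iff field_simps\<close>)
    then show "\<exists>p\<in>?R. equivalent_subalgebras d4 (span_pair p) (span_pair (normal_pair
        4 1 2 3 b c x y))"
      using rep_\<sigma> by metis
  next
    assume inv: "invariant_complex_subalgebra d4 (span_pair (normal_pair 4 2 1 3 b c 0 y))"
    then have *: "Im b \<noteq> 0" "y = - b"
      by (simp_all add: invariant_d4_4213)
    then show "normal_pair 4 2 1 3 b c 0 y \<in> ?Q1 \<union> ?Q2"
      by (auto simp: normal_pair_def coordinates)
    have "\<sigma> * s * Im b = Im c" "s \<noteq> 0"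
      using * by (auto simp: \<sigma>_def s_def)
    \<comment> \<open>\<open>d4\<close> has an automorphism exchanging the lines of e_1 and e_2 and
      reversing e_4, so this shape leads to the same classes.\<close>
    then have "equivalent_subalgebras d4 (span_pair (?rep \<sigma>)) (span_pair (normal_pair 4 2 1
        3 b c 0 y))"
      by (intro equivalent_subalgebrasI[OF bilinear_listed(12) _ _ _ _ _ inv, where s = "-1"
            and t = 0 and c = "- of_real s"
            and A = "vector [vector [0, - s, Re b * s, 0], vector [- Im b, 0, 0, 0],
              vector [0, 0, - s * Im b, 0], vector [- Re b, 0, - Re c, -1]]"])
        (use * in \<open>auto simp: d4_def matrix_simps complex_eq_iff field_simps\<close>)
    then show "\<exists>p\<in>?R. equivalent_subalgebras d4 (span_pair p) (span_pair (normal_pair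
        4 2 1 3 b c 0 y))"
      using rep_\<sigma> by metis
  }
  fix p p' assume "p \<in> ?R" "p' \<in> ?R" "p \<noteq> p'"
  then show "\<not> equivalent_subalgebras d4 (span_pair p) (span_pair p')"
    using not_equivalent_d4[of 0 1] not_equivalent_d4[of 1 0] rep by auto
next
  fix p assume "p \<in> ?Q1 \<union> ?Q2"
  then have "\<exists>b c. p = normal_pair 4 1 2 3 b c 0 (- b) \<and> Im b \<noteq> 0 \<or> p =
      normal_pair 4 2 1 3 b c 0 (- b) \<and> Im b \<noteq> 0"
    by (auto simp: normal_pair_def coordinates)
  then show "invariant_complex_subalgebra d4 (span_pair p)"
    by (auto simp: invariant_d4_4123 invariant_d4_4213)
next
  fix p assume "p \<in> ?R"
  moreover have "span_pair (e 1 - \<i> *s e 3, e 4 + \<i> *s e 2) = span_pair (normal_pair 4 1 2 3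
      \<i> 0 0 (- \<i>))"
    "(e 4 + \<i> *s (e 2 + e 3), e 1 - \<i> *s e 3) = normal_pair 4 1 2 3 \<i> \<i> 0 (- \<i>)"
    by (subst span_pair_swap) (simp_all add: normal_pair_def vector_add_ldistrib)
  ultimately have "invariant_complex_subalgebra d4 (span_pair p)"
    by (auto simp: invariant_d4_4123)
  then show "p \<in> ?Q1 \<union> ?Q2 \<or> invariant_complex_subalgebra d4 (span_pair p)" ..
qed

text \<open>In the matrices below e_3 is rescaled by a determinant quadratic in \<open>r\<close>, so
  a non-zero quantity can be normalized only up to its sign.\<close>

lemma signed_square:
  fixes D :: real
  assumes "D \<noteq> 0"
  obtains \<eta> r :: real where "\<eta> \<in> {1, -1}" "r \<noteq> 0" "\<eta> * (r * r) = D"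
proof -
  have "sgn D \<in> {1, -1}" "sgn D * (sqrt \<bar>D\<bar> * sqrt \<bar>D\<bar>) = D" "sqrt
      \<bar>D\<bar> \<noteq> 0"
    using assms by (auto simp: sgn_if)
  then show thesis
    using that by blast
qed

lemma classified_d4_par_half:
  "classified_by (d4_par (1 / 2))
      {(e 4 + \<i> *s e 3, e 1 + \<i> *s e 2), (e 4 + \<i> *s e 3, e 1 - \<i> *s e 2),
       (e 4 + \<i> *s e 1, e 2 - (2 * \<i>) *s e 3)}
      ({(e 4 + b1 *s e 2 + c1 *s e 3, e 1 + b2 *s e 2 + (2 * b1) *s e 3) | b1 b2 c1.
          2 * (Im b1)\<^sup>2 - Im c1 * Im b2 \<noteq> 0} \<union>
       {(e 4 + a1 *s e 1 + c1 *s e 3, a2 *s e 1 + e 2 - (2 * a1) *s e 3) | a1 a2 c1.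
          2 * (Im a1)\<^sup>2 + Im c1 * Im a2 \<noteq> 0})"
  (is "classified_by _ ?R (?Q1 \<union> ?Q2)")
proof (rule classified_by_normal_pairsI[OF coordinate_order(3)])
  fix b c x y assume inv: "invariant_complex_subalgebra (d4_par (1 / 2)) (span_pair (normal_pair 4
      1 2 3 b c x y))"
  then have *: "2 * (Im b * Im b) \<noteq> Im c * Im x" "y = 2 * b"
    by (auto simp: invariant_d4_par_4123)
  then have "normal_pair 4 1 2 3 b c x y \<in> ?Q1"
    by (simp add: normal_pair_def coordinates power2_eq_square)
  then show "normal_pair 4 1 2 3 b c x y \<in> ?Q1 \<union> ?Q2" ..
  show "\<exists>p\<in>?R. equivalent_subalgebras (d4_par (1 / 2)) (span_pair p)
      (span_pair (normal_pair 4 1 2 3 b c x y))"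
  proof (cases "Im x = 0")
    case True
    then have "Im b \<noteq> 0"
      using * by auto
    \<comment> \<open>Modulo e_3, ad e_4 is 1/2 on e_1, e_2, so any linear map is admissible there;
      this one exchanges the two directions. The value of \<open>t\<close> comes from the e_3
      coordinate of [e_4, e_1] = (1/2) e_1.\<close>
    have "equivalent_subalgebras (d4_par (1 / 2)) (span_pair (e 4 + \<i> *s e 1, e 2 - (2 * \<i>)
        *s e 3))
      (span_pair (normal_pair 4 1 2 3 b c x y))"
      by (rule equivalent_subalgebrasI[OF bilinear_listed(13) _ _ _ _ _ inv, where s = 1
            and t = "- of_real (Im c / (4 * Im b))" and c = 1
            and A = "vector [vector [0, Im b, Im c / 2, 0], vector [1, Re x, 2 * Re b, 0],
              vector [0, 0, - Im b, 0], vector [- (Im c / (4 * Im b)),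
                Re b - Im c / (4 * Im b) * Re x, Re c - Im c / (4 * Im b) * (2 * Re b), 1]]"])
        (use * True \<open>Im b \<noteq> 0\<close> in \<open>auto simp: d4_par_def matrix_simps
            complex_eq_iff field_simps\<close>)
    then show ?thesis
      by simp
  next
    case False
    \<comment> \<open>For t = - Im b / Im x the e_2 coordinate of v + t w is real, and its e_3
      coordinate has imaginary part Im c - 2 (Im b)^2 / Im x. This must equal the scale \<eta> r^2
      Im x of e_3, which leaves the quantity below.\<close>
    then have "Im c / Im x - 2 * (Im b / Im x * (Im b / Im x)) \<noteq> 0"
      using * by (simp add: field_simps)
    then obtain \<eta> r :: real where r: "\<eta> \<in> {1, -1}" "r \<noteq> 0"
      "\<eta> * (r * r) = Im c / Im x - 2 * (Im b / Im x * (Im b / Im x))"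
      by (rule signed_square)
    from r(3) have r': "\<eta> * (r * r * (Im x * Im x)) = Im c * Im x - 2 * (Im b * Im b)"
      using False by (simp add: field_simps)
    have "equivalent_subalgebras (d4_par (1 / 2)) (span_pair (e 4 + \<i> *s e 3, e 1 + (of_real
        \<eta> * \<i>) *s e 2))
      (span_pair (normal_pair 4 1 2 3 b c x y))"
      by (rule equivalent_subalgebrasI[OF bilinear_listed(13) _ _ _ _ _ inv, where s = 1
            and t = "- of_real (Im b / Im x)" and c = "of_real r"
            and A = "vector [vector [r, r * Re x, 2 * r * Re b, 0],
              vector [0, \<eta> * r * Im x, 2 * \<eta> * r * Im b, 0],
              vector [0, 0, \<eta> * (r * r) * Im x, 0], vector [- (Im b / Im x),
                Re b - Im b / Im x * Re x, Re c - Im b / Im x * (2 * Re b), 1]]"])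
        (use * False r(1,2) r' in \<open>auto simp: d4_par_def matrix_simps complex_eq_iff
            field_simps\<close>)
    then show ?thesis
      using r(1) by auto
  qed
next
  fix b c y assume inv: "invariant_complex_subalgebra (d4_par (1 / 2)) (span_pair (normal_pair 4 2
      1 3 b c 0 y))"
  then have *: "Im b \<noteq> 0" "y = - (2 * b)"
    by (auto simp: invariant_d4_par_4213)
  then have "normal_pair 4 2 1 3 b c 0 y \<in> ?Q2"
    by (simp add: normal_pair_def coordinates)
  then show "normal_pair 4 2 1 3 b c 0 y \<in> ?Q1 \<union> ?Q2" ..
  have "equivalent_subalgebras (d4_par (1 / 2)) (span_pair (e 4 + \<i> *s e 1, e 2 - (2 * \<i>) *s
      e 3))
      (span_pair (normal_pair 4 2 1 3 b c 0 y))"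
    by (rule equivalent_subalgebrasI[OF bilinear_listed(13) _ _ _ _ _ inv, where s = 1
          and t = "of_real (Im c / (4 * Im b))" and c = 1
          and A = "vector [vector [Im b, 0, Im c / 2, 0], vector [0, 1, - 2 * Re b, 0],
            vector [0, 0, Im b, 0], vector [Re b, Im c / (4 * Im b),
              Re c - Im c / (4 * Im b) * (2 * Re b), 1]]"])
      (use * in \<open>auto simp: d4_par_def matrix_simps complex_eq_iff field_simps\<close>)
  then show "\<exists>p\<in>?R. equivalent_subalgebras (d4_par (1 / 2)) (span_pair p)
      (span_pair (normal_pair 4 2 1 3 b c 0 y))"
    by simp
next
  fix p assume "p \<in> ?Q1 \<union> ?Q2"
  then have "(\<exists>b c x. p = normal_pair 4 1 2 3 b c x (2 * b) \<and> Im b * Im (2 * b)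
      \<noteq> Im c * Im x) \<or>
      (\<exists>b c x. p = normal_pair 4 2 1 3 b c x (- (2 * b)) \<and> Im b * Im (- (2 * b))
          \<noteq> Im c * Im x)"
    by (auto simp: normal_pair_def coordinates power2_eq_square neg_eq_iff_add_eq_0 algebra_simps)
  then show "invariant_complex_subalgebra (d4_par (1 / 2)) (span_pair p)"
    by (auto simp: invariant_d4_par_4123 invariant_d4_par_4213)
next
  let ?rep = "\<lambda>\<eta>. (e 4 + \<i> *s e 3, e 1 + (of_real \<eta> * \<i>) *s e 2) ::
      (complex ^ 4) \<times> (complex ^ 4)"
  have rep: "(e 4 + \<i> *s e 3, e 1 + \<i> *s e 2) = ?rep 1" "(e 4 + \<i> *s e 3, e 1 - \<i> *s e
      2) = ?rep (- 1)"
    by simp_all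
  have neq: "\<not> equivalent_subalgebras (d4_par (1 / 2)) (span_pair (?rep 1)) (span_pair (?rep
      (- 1)))"
    "\<not> equivalent_subalgebras (d4_par (1 / 2)) (span_pair (e 4 + \<i> *s e 1, e 2 - (2 *
        \<i>) *s e 3)) (span_pair (?rep 1))"
    "\<not> equivalent_subalgebras (d4_par (1 / 2)) (span_pair (e 4 + \<i> *s e 1, e 2 - (2 *
        \<i>) *s e 3)) (span_pair (?rep (- 1)))"
    using not_equivalent_d4_par_half[of 1 "-1"] not_equivalent_d4_par_half_real[of 1]
      not_equivalent_d4_par_half_real[of "-1"] by auto
  fix p p' assume "p \<in> ?R" "p' \<in> ?R" "p \<noteq> p'"
  then show "\<not> equivalent_subalgebras (d4_par (1 / 2)) (span_pair p) (span_pair p')"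
    using neq neq[THEN contrapos_nn, OF equivalent_subalgebras_sym] unfolding rep by blast
qed (auto simp: coordinates sign_cases)

lemma classified_d4_par:
  assumes "l \<noteq> 0" "l \<noteq> 1 / 2" "l \<noteq> 1"
  shows "classified_by (d4_par l)
      {(e 4 - (complex_of_real l * \<i>) *s e 1, e 2 + \<i> *s e 3),
       (e 4 + (complex_of_real (1 - l) * \<i>) *s e 2, e 1 + \<i> *s e 3)}
      ({(e 4 - (complex_of_real l * c2) *s e 1 + c1 *s e 3, e 2 + c2 *s e 3) | c1 c2.
          Im c2 \<noteq> 0} \<union>
       {(e 4 + (complex_of_real (1 - l) * c2) *s e 2 + c1 *s e 3, e 1 + c2 *s e 3) | c1 c2.
          Im c2 \<noteq> 0})"
  (is "classified_by _ ?R (?Q1 \<union> ?Q2)")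
proof (rule classified_by_normal_pairsI[OF coordinate_order(4)])
  have "complex_of_real (1 - 2 * l) \<noteq> 0"
    using assms unfolding of_real_eq_0_iff by simp
  fix b c x y assume inv: "invariant_complex_subalgebra (d4_par l) (span_pair (normal_pair 4 2 1 3
      b c x y))"
  then have "Im b * Im y \<noteq> Im c * Im x" "complex_of_real (1 - 2 * l) * x = 0" "b = -
      of_real l * y"
    unfolding invariant_d4_par_4213 by blast+
  then have *: "Im y \<noteq> 0" "x = 0" "b = - (of_real l * y)"
    using \<open>complex_of_real (1 - 2 * l) \<noteq> 0\<close> by (auto simp only: mult_eq_0_iff
        mult_minus_left) simp
  then have "normal_pair 4 2 1 3 b c x y \<in> ?Q1"
    by (simp add: normal_pair_def coordinates)
  then show "normal_pair 4 2 1 3 b c x y \<in> ?Q1 \<union> ?Q2" ..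
  \<comment> \<open>The image of \<open>v\<close> and the e_3 coordinate of [e_4, e_1] = l e_1
    determine \<open>t\<close>; in the other shape [e_4, e_2] = (1 - l) e_2 does the same.\<close>
  have "equivalent_subalgebras (d4_par l)
      (span_pair (e 4 - (complex_of_real l * \<i>) *s e 1, e 2 + \<i> *s e 3))
      (span_pair (normal_pair 4 2 1 3 b c x y))"
    by (rule equivalent_subalgebrasI[OF bilinear_listed(13) _ _ _ _ _ inv, where s = 1
          and t = "- of_real ((1 - l) * Im c / Im y)" and c = 1
          and A = "vector [vector [Im y, 0, - Im c, 0], vector [0, 1, Re y, 0],
            vector [0, 0, Im y, 0], vector [- (l * Re y), - ((1 - l) * Im c / Im y),
              Re c - (1 - l) * Im c / Im y * Re y, 1]]"])
      (use * in \<open>auto simp: d4_par_def matrix_simps complex_eq_iff field_simps\<close>)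
  then show "\<exists>p\<in>?R. equivalent_subalgebras (d4_par l) (span_pair p) (span_pair
      (normal_pair 4 2 1 3 b c x y))"
    by simp
next
  fix b c y assume inv: "invariant_complex_subalgebra (d4_par l) (span_pair (normal_pair 4 1 2 3 b
      c 0 y))"
  then have *: "Im y \<noteq> 0" "b = of_real (1 - l) * y"
    by (auto simp: invariant_d4_par_4123)
  then have "normal_pair 4 1 2 3 b c 0 y \<in> ?Q2"
    by (simp add: normal_pair_def coordinates)
  then show "normal_pair 4 1 2 3 b c 0 y \<in> ?Q1 \<union> ?Q2" ..
  have "equivalent_subalgebras (d4_par l)
      (span_pair (e 4 + (complex_of_real (1 - l) * \<i>) *s e 2, e 1 + \<i> *s e 3))
      (span_pair (normal_pair 4 1 2 3 b c 0 y))"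
    by (rule equivalent_subalgebrasI[OF bilinear_listed(13) _ _ _ _ _ inv, where s = 1
          and t = "- of_real (l * Im c / Im y)" and c = 1
          and A = "vector [vector [1, 0, Re y, 0], vector [0, Im y, Im c, 0],
            vector [0, 0, Im y, 0], vector [- (l * Im c / Im y), (1 - l) * Re y,
              Re c - l * Im c / Im y * Re y, 1]]"])
      (use *(1) in \<open>auto simp: *(2) d4_par_def matrix_simps complex_eq_iff
          field_simps\<close>)
  then show "\<exists>p\<in>?R. equivalent_subalgebras (d4_par l) (span_pair p) (span_pair
      (normal_pair 4 1 2 3 b c 0 y))"
    by simp
next
  fix p assume "p \<in> ?Q1 \<union> ?Q2"
  then have "\<exists>c y. p = normal_pair 4 2 1 3 (- of_real l * y) c 0 y \<and> Im y \<noteq> 0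
      \<or>
      p = normal_pair 4 1 2 3 (of_real (1 - l) * y) c 0 y \<and> Im y \<noteq> 0"
    by (auto simp: normal_pair_def coordinates)
  then show "invariant_complex_subalgebra (d4_par l) (span_pair p)"
    using assms by (auto simp: invariant_d4_par_4123 invariant_d4_par_4213)
next
  fix p p' assume "p \<in> ?R" "p' \<in> ?R" "p \<noteq> p'"
  then show "\<not> equivalent_subalgebras (d4_par l) (span_pair p) (span_pair p')"
    using not_equivalent_d4_par[OF assms(1,3,2)] equivalent_subalgebras_sym by blast
qed (auto simp: coordinates sign_cases)

lemma equivalent_d4':
  assumes inv: "invariant_complex_subalgebra (d4' d) (span_pair (normal_pair 4 1 2 3 b c x y))"
  obtains \<sigma> where "\<sigma> \<in> {1, -1}" "equivalent_subalgebras (d4' d)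
    (span_pair (e 4 + (of_real \<sigma> * \<i>) *s e 3, e 1 + x *s e 2)) (span_pair (normal_pair 4
        1 2 3 b c x y))"
proof -
  obtain h where d: "d = 2 * h"
    by (metis mult.commute nonzero_eq_divide_eq zero_neq_numeral)
  define \<epsilon> where "\<epsilon> = Im x"
  have *: "Im b * Im y \<noteq> Im c * \<epsilon>" "\<epsilon> = 1 \<or> \<epsilon> = - 1" "x =
      of_real \<epsilon> * \<i>"
    "b = (of_real h - of_real \<epsilon> * \<i>) * y"
    using inv by (auto simp: invariant_d4'_4123 \<epsilon>_def d)
  \<comment> \<open>\<open>Re y - h * \<epsilon> * Im y\<close> is the \<open>t\<close> that makes
    the e_2 coordinate of v + t w real. The whole expression is the imaginary part of the e_3
    coordinate, to be matched with \<sigma> times the scale \<open>r * r\<close> of e_3.\<close>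
  then have "Im c + (Re y - h * \<epsilon> * Im y) * Im y \<noteq> 0"
    by (auto simp: algebra_simps)
  then obtain \<sigma> r :: real where r: "\<sigma> \<in> {1, -1}" "r \<noteq> 0"
    "\<sigma> * (r * r) = Im c + (Re y - h * \<epsilon> * Im y) * Im y"
    by (rule signed_square)
  have "equivalent_subalgebras (d4' d)
    (span_pair (e 4 + (of_real \<sigma> * \<i>) *s e 3, e 1 + x *s e 2)) (span_pair (normal_pair 4
        1 2 3 b c x y))"
    by (rule equivalent_subalgebrasI[OF bilinear_listed(14) _ _ _ _ _ inv, where s = 1
          and t = "of_real (Re y - h * \<epsilon> * Im y)" and c = "of_real r"
          and A = "vector [vector [r, 0, r * Re y, 0], vector [0, r, r * \<epsilon> * Im y, 0],
            vector [0, 0, r * r, 0], vector [Re y - h * \<epsilon> * Im y, h * Re y + \<epsilon> *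
                Im y,
              Re c + (Re y - h * \<epsilon> * Im y) * Re y, 1]]"])
      (use *(2-4) r in \<open>auto simp: d4'_def d matrix_simps complex_eq_iff
          algebra_simps\<close>)
  then show thesis
    using that r(1) by blast
qed

lemma classified_d4'_0:
  "classified_by (d4' 0)
      {(e 4 - \<i> *s e 3, e 1 + \<i> *s e 2), (e 4 + \<i> *s e 3, e 1 + \<i> *s e 2)}
      {(e 4 + c1 *s e 3 - (complex_of_real \<epsilon> * \<i> * c2) *s e 2,
        c2 *s e 3 + e 1 + (complex_of_real \<epsilon> * \<i>) *s e 2) | c1 c2 \<epsilon>.
         \<epsilon> \<in> {1, -1} \<and> Re c2 * Im c2 + Im c1 \<noteq> 0}"
  (is "classified_by _ ?R ?Q")
proof (rule classified_by_normal_pairsI[OF coordinate_order(3)])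
  fix b c x y assume inv: "invariant_complex_subalgebra (d4' 0) (span_pair (normal_pair 4 1 2 3 b
      c x y))"
  then have *: "Re y * Im y + Im c \<noteq> 0" "x = \<i> \<or> x = - \<i>" "b = - (x * y)"
    by (auto simp: invariant_d4'_4123)
  then show "normal_pair 4 1 2 3 b c x y \<in> ?Q"
    by (auto simp: normal_pair_def coordinates sign_cases)
  have "\<exists>\<sigma>\<in>{1, -1}. equivalent_subalgebras (d4' 0)
    (span_pair (e 4 + (of_real \<sigma> * \<i>) *s e 3, e 1 + \<i> *s e 2)) (span_pair
        (normal_pair 4 1 2 3 b c x y))"
  proof (cases "x = \<i>")
    case True
    show ?thesis
      by (rule equivalent_d4'[OF inv]) (use True in blast)
  next
    case False
    then have x: "x = - \<i>"
      using *(2) by simp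
    obtain \<sigma> r :: real where r: "\<sigma> \<in> {1, -1}" "r \<noteq> 0" "\<sigma> * (r * r)
        = Re y * Im y + Im c"
      using *(1) by (rule signed_square)
    \<comment> \<open>For \<delta> = 0 reversing e_2, e_3 and e_4 is an automorphism; it exchanges
      the eigenlines for \<open>\<i>\<close> and \<open>- \<i>\<close>, so \<epsilon> is no
      invariant here.\<close>
    have "equivalent_subalgebras (d4' 0)
      (span_pair (e 4 + (of_real \<sigma> * \<i>) *s e 3, e 1 + \<i> *s e 2)) (span_pair
          (normal_pair 4 1 2 3 b c x y))"
      by (rule equivalent_subalgebrasI[OF bilinear_listed(14) _ _ _ _ _ inv, where s = "-1"
            and t = "- of_real (Re y)" and c = "of_real r"
            and A = "vector [vector [r, 0, r * Re y, 0], vector [0, - r, r * Im y, 0],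
              vector [0, 0, - (r * r), 0], vector [- Re y, Im y, - Re c - Re y * Re y, -1]]"])
        (use *(3) x r in \<open>auto simp: d4'_def matrix_simps complex_eq_iff
            algebra_simps\<close>)
    then show ?thesis
      using r(1) by blast
  qed
  then show "\<exists>p\<in>?R. equivalent_subalgebras (d4' 0) (span_pair p) (span_pair
      (normal_pair 4 1 2 3 b c x y))"
    by auto
next
  fix p assume "p \<in> ?Q"
  then have "\<exists>c x y. p = normal_pair 4 1 2 3 (- x * y) c x y \<and> Re y * Im y + Im c
      \<noteq> 0 \<and> (x = \<i> \<or> x = - \<i>)"
    by (auto simp: normal_pair_def coordinates)
  then show "invariant_complex_subalgebra (d4' 0) (span_pair p)"
    by (auto simp: invariant_d4'_4123)
next
  fix p p' assume "p \<in> ?R" "p' \<in> ?R" "p \<noteq> p'"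
  then show "\<not> equivalent_subalgebras (d4' 0) (span_pair p) (span_pair p')"
    using not_equivalent_d4'[of 0 1 1 "-1" 1] not_equivalent_d4'[of 0 "-1" 1 1 1] by auto
qed (auto simp: invariant_d4'_4213 coordinates sign_cases)

lemma classified_d4'_pos:
  assumes "\<delta> > 0"
  shows "classified_by (d4' \<delta>)
      {(e 4 + \<i> *s e 3, e 1 - \<i> *s e 2), (e 4 - \<i> *s e 3, e 1 + \<i> *s e 2),
       (e 4 + \<i> *s e 3, e 1 + \<i> *s e 2), (e 4 - \<i> *s e 3, e 1 - \<i> *s e 2)}
      {(e 4 + c1 *s e 3 + ((complex_of_real (\<delta> / 2) - complex_of_real \<epsilon> * \<i>) *
          c2) *s e 2,
        e 1 + (complex_of_real \<epsilon> * \<i>) *s e 2 + c2 *s e 3) | c1 c2 \<epsilon>.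
         \<epsilon> \<in> {1, -1} \<and>
         \<epsilon> * Im c1 + Im c2 * (- (\<delta> / 2) * Im c2 + \<epsilon> * Re c2) \<noteq> 0}"
  (is "classified_by _ ?R ?Q")
proof (rule classified_by_normal_pairsI[OF coordinate_order(3)])
  fix b c x y assume inv: "invariant_complex_subalgebra (d4' \<delta>) (span_pair (normal_pair 4 1
      2 3 b c x y))"
  then have *: "x = \<i> \<or> x = - \<i>" "b = (of_real (\<delta> / 2) - x) * y" "Im b * Im y
      \<noteq> Im c * Im x"
    unfolding invariant_d4'_4123 by blast+
  define \<epsilon> where "\<epsilon> = Im x"
  have \<epsilon>: "\<epsilon> \<in> {1, -1}" "x = of_real \<epsilon> * \<i>"
    using *(1) by (auto simp: \<epsilon>_def)
  have Im_b: "Im b = \<delta> / 2 * Im y - \<epsilon> * Re y"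
    using *(2) \<epsilon> by auto
  \<comment> \<open>The determinant is the negative of the expression in the list, with \<epsilon> =
    \<open>Im x\<close>.\<close>
  have "Im b * Im y - Im c * Im x = - (\<epsilon> * Im c + Im y * (- (\<delta> / 2) * Im y +
      \<epsilon> * Re y))"
    by (simp only: Im_b flip: \<epsilon>_def) (simp add: algebra_simps)
  then have "\<epsilon> * Im c + Im y * (- (\<delta> / 2) * Im y + \<epsilon> * Re y) \<noteq> 0"
    using *(3) by auto
  moreover have "normal_pair 4 1 2 3 b c x y =
      (e 4 + c *s e 3 + ((complex_of_real (\<delta> / 2) - complex_of_real \<epsilon> * \<i>) * y)
          *s e 2,
       e 1 + (complex_of_real \<epsilon> * \<i>) *s e 2 + y *s e 3)"
    by (simp add: normal_pair_def coordinates *(2) \<epsilon>(2))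
  ultimately show "normal_pair 4 1 2 3 b c x y \<in> ?Q"
    using \<epsilon>(1) by blast
  obtain \<sigma> where "\<sigma> \<in> {1, -1}" "equivalent_subalgebras (d4' \<delta>)
      (span_pair (e 4 + (of_real \<sigma> * \<i>) *s e 3, e 1 + x *s e 2)) (span_pair (normal_pair
          4 1 2 3 b c x y))"
    by (rule equivalent_d4'[OF inv])
  then show "\<exists>p\<in>?R. equivalent_subalgebras (d4' \<delta>) (span_pair p) (span_pair
      (normal_pair 4 1 2 3 b c x y))"
    using *(1) by auto
next
  fix p assume "p \<in> ?Q"
  then obtain c1 c2 \<epsilon> where p: "p = (e 4 + c1 *s e 3 + ((complex_of_real (\<delta> / 2) -
      complex_of_real \<epsilon> * \<i>) * c2) *s e 2,
        e 1 + (complex_of_real \<epsilon> * \<i>) *s e 2 + c2 *s e 3)" "\<epsilon> \<in> {1, -1}"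
      "\<epsilon> * Im c1 + Im c2 * (- (\<delta> / 2) * Im c2 + \<epsilon> * Re c2) \<noteq> 0"
    by blast
  let ?x = "complex_of_real \<epsilon> * \<i>" and ?b = "(complex_of_real (\<delta> / 2) -
      complex_of_real \<epsilon> * \<i>) * c2"
  have "p = normal_pair 4 1 2 3 ?b c1 ?x c2"
    by (simp add: p(1) normal_pair_def coordinates)
  moreover have "Im ?b * Im c2 - Im c1 * Im ?x =
      - (\<epsilon> * Im c1 + Im c2 * (- (\<delta> / 2) * Im c2 + \<epsilon> * Re c2))"
    by (simp add: algebra_simps)
  then have "Im ?b * Im c2 \<noteq> Im c1 * Im ?x"
    using p(3) by linarith
  moreover have "?x = \<i> \<or> ?x = - \<i>"
    using p(2) by auto
  ultimately show "invariant_complex_subalgebra (d4' \<delta>) (span_pair p)"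
    by (simp only: invariant_d4'_4123) simp
next
  let ?rep = "\<lambda>\<sigma> \<epsilon>. (e 4 + (of_real \<sigma> * \<i>) *s e 3, e 1 +
      (of_real \<epsilon> * \<i>) *s e 2)"
  have R: "?R = {?rep 1 (-1), ?rep (-1) 1, ?rep 1 1, ?rep (-1) (-1)}"
    by simp
  fix p p' assume p: "p \<in> ?R" "p' \<in> ?R" "p \<noteq> p'"
  obtain \<sigma> \<epsilon> where "p = ?rep \<sigma> \<epsilon>" "\<sigma> \<in> {1, -1}"
      "\<epsilon> \<in> {1, -1}"
    using p(1) unfolding R by blast
  moreover obtain \<sigma>' \<epsilon>' where "p' = ?rep \<sigma>' \<epsilon>'" "\<sigma>' \<in>
      {1, -1}" "\<epsilon>' \<in> {1, -1}"
    using p(2) unfolding R by blast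
  ultimately show "\<not> equivalent_subalgebras (d4' \<delta>) (span_pair p) (span_pair p')"
    using not_equivalent_d4'[of \<delta> \<sigma> \<epsilon> \<sigma>' \<epsilon>'] p(3) assms by
        blast
qed (auto simp: invariant_d4'_4213 coordinates sign_cases)

section \<open>The algebra \<open>r2'\<close>, with a continuous family of classes\<close>

lemma classified_r2':
  "classified_by r2'
      ({(e 1 + \<i> *s e 3, e 2 + \<i> *s e 4)} \<union>
       {(e 1 + b1 *s e 2, e 3 + \<i> *s e 4) | b1. Im b1 \<noteq> 0} \<union>
       {(e 1 + \<i> *s e 2 + e 4, e 3 + \<i> *s e 4)})
      ({(e 1 + c1 *s e 3 + d1 *s e 4, e 2 - d1 *s e 3 + c1 *s e 4) | c1 d1.
          (Im c1)\<^sup>2 + (Im d1)\<^sup>2 \<noteq> 0} \<union>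
       {(e 1 + (complex_of_real \<epsilon> * \<i>) *s e 2 + d1 *s e 4,
         e 3 - (complex_of_real \<epsilon> * \<i>) *s e 4) | d1 \<epsilon>. \<epsilon> \<in> {1,
             -1}} \<union>
       {(e 1 + b1 *s e 2 + d1 *s e 4, e 3 + (complex_of_real \<epsilon> * \<i>) *s e 4) | b1 d1
           \<epsilon>.
          \<epsilon> \<in> {1, -1} \<and> Im b1 \<noteq> 0})"
  (is "classified_by _ ({?N} \<union> ?R2 \<union> {?R3}) (?Q1 \<union> ?Q2 \<union> ?Q3)")
proof (rule classified_by_normal_pairsI[OF coordinate_order(2)])
  fix b c x y assume inv: "invariant_complex_subalgebra r2' (span_pair (normal_pair 1 2 3 4 b c x
      y))"
  then have *: "(Im b)\<^sup>2 + (Im c)\<^sup>2 \<noteq> 0" "x = - c" "y = b"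
    unfolding invariant_r2'_1234 by blast+
  have "normal_pair 1 2 3 4 b c x y = (e 1 + b *s e 3 + c *s e 4, e 2 - c *s e 3 + b *s e 4)"
    by (simp add: *(2,3) normal_pair_def)
  then show "normal_pair 1 2 3 4 b c x y \<in> ?Q1 \<union> ?Q2 \<union> ?Q3"
    using *(1) by blast
  have "equivalent_subalgebras r2' (span_pair ?N) (span_pair (normal_pair 1 2 3 4 b c x y))"
    by (rule equivalent_subalgebrasI[OF bilinear_listed(6) _ _ _ _ _ inv, where s = 1
          and t = 0 and c = 1
          and A = "vector [vector [1, 0, Re b, Re c], vector [0, 1, - Re c, Re b],
            vector [0, 0, Im b, Im c], vector [0, 0, - Im c, Im b]]"])
      (use *(2,3) in \<open>auto simp: r2'_def matrix_simps complex_eq_iff\<close>)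
  then show "\<exists>p\<in>{?N} \<union> ?R2 \<union> {?R3}. equivalent_subalgebras r2'
      (span_pair p)
      (span_pair (normal_pair 1 2 3 4 b c x y))"
    by blast
next
  fix b c y assume inv: "invariant_complex_subalgebra r2' (span_pair (normal_pair 1 3 2 4 b c 0 y))"
  then have *: "Im b \<noteq> 0" "y = \<i> \<or> y = - \<i>"
    unfolding invariant_r2'_1324 by blast+
  have "normal_pair 1 3 2 4 b c 0 y \<in> ?Q3"
    using * by (auto simp: normal_pair_def coordinates sign_cases)
  then show "normal_pair 1 3 2 4 b c 0 y \<in> ?Q1 \<union> ?Q2 \<union> ?Q3" ..
  let ?p = "normal_pair 1 3 2 4 b c 0 y"
  \<comment> \<open>Automorphisms trivial modulo the derived algebra can shift \<open>c\<close> by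
    multiples of \<open>b - y\<close>. So \<open>c\<close> can be removed unless
    \<open>b = y\<close>, where it can only be rescaled to 1; this is the origin of the isolated
    representative.\<close>
  consider "y = \<i>" "b \<noteq> \<i> \<or> c = 0" | "y = \<i>" "b = \<i>" "c \<noteq> 0"
    | "y = - \<i>" "b \<noteq> - \<i> \<or> c = 0" | "y = - \<i>" "b = - \<i>" "c \<noteq> 0"
    using *(2) by blast
  then show "\<exists>p\<in>{?N} \<union> ?R2 \<union> {?R3}. equivalent_subalgebras r2'
      (span_pair p) (span_pair ?p)"
  proof cases
    case 1
    \<comment> \<open>If \<open>b = \<i>\<close>, then \<open>c = 0\<close>, and \<open>z =
        0\<close> because \<open>x / 0 = 0\<close>.\<close>
    define z where "z = c / (b - \<i>)"
    have c: "c = (b - \<i>) * z"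
      using 1(2) by (auto simp: z_def)
    have "equivalent_subalgebras r2' (span_pair (e 1 + b *s e 2, e 3 + \<i> *s e 4)) (span_pair ?p)"
      by (rule equivalent_subalgebrasI[OF bilinear_listed(6) _ _ _ _ _ inv, where s = 1
            and t = "of_real (Re z) - b * of_real (Im z)" and c = 1
            and A = "vector [vector [1, 0, Re z, Im z], vector [0, 1, - Im z, Re z],
              vector [0, 0, 1, 0], vector [0, 0, 0, 1]]"])
        (auto simp: 1(1) c r2'_def matrix_simps complex_eq_iff algebra_simps)
    then show ?thesis
      using *(1) by blast
  next
    case 2
    \<comment> \<open>Multiplication by \<open>c\<close> on the derived algebra, seen as a complex
      line with e_3 = 1 and e_4 = \<i>, turns e_4 into \<open>c\<close> times e_4 modulo
      \<open>w\<close>; on the conjugate eigenline of \<open>w\<close> it acts by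
      \<open>cnj c\<close>.\<close>
    have "equivalent_subalgebras r2' (span_pair ?R3) (span_pair ?p)"
      by (rule equivalent_subalgebrasI[OF bilinear_listed(6) _ _ _ _ _ inv, where s = 1
            and t = "- of_real (Im c)" and c = "cnj c"
            and A = "vector [vector [1, 0, 0, 0], vector [0, 1, 0, 0],
              vector [0, 0, Re c, Im c], vector [0, 0, - Im c, Re c]]"])
        (use 2 in \<open>auto simp: r2'_def matrix_simps complex_eq_iff\<close>)
    then show ?thesis
      by blast
  next
    case 3
    define z where "z = c / (b + \<i>)"
    have c: "c = (b + \<i>) * z"
      using 3(2) by (auto simp: z_def add_eq_0_iff2)
    \<comment> \<open>Reversing e_2 and e_4 is an automorphism of \<open>r2'\<close>; it exchanges
      \<open>y = - \<i>\<close> with \<open>y = \<i>\<close> and changes the sign of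
      \<open>b\<close>.\<close>
    have "equivalent_subalgebras r2' (span_pair (e 1 + (- b) *s e 2, e 3 + \<i> *s e 4))
        (span_pair ?p)"
      by (rule equivalent_subalgebrasI[OF bilinear_listed(6) _ _ _ _ _ inv, where s = 1
            and t = "of_real (Re z) + b * of_real (Im z)" and c = 1
            and A = "vector [vector [1, 0, Re z, - Im z], vector [0, -1, - Im z, - Re z],
              vector [0, 0, 1, 0], vector [0, 0, 0, -1]]"])
        (auto simp: 3(1) c r2'_def matrix_simps complex_eq_iff algebra_simps)
    moreover have "Im (- b) \<noteq> 0"
      using *(1) by simp
    ultimately show ?thesis
      by blast
  next
    case 4
    have "equivalent_subalgebras r2' (span_pair ?R3) (span_pair ?p)"
      by (rule equivalent_subalgebrasI[OF bilinear_listed(6) _ _ _ _ _ inv, where s = 1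
            and t = "of_real (Im c)" and c = "- cnj c"
            and A = "vector [vector [1, 0, 0, 0], vector [0, -1, 0, 0],
              vector [0, 0, - Re c, Im c], vector [0, 0, Im c, Re c]]"])
        (use 4 in \<open>auto simp: r2'_def matrix_simps complex_eq_iff\<close>)
    then show ?thesis
      by blast
  qed
next
  fix p assume "p \<in> ?Q1 \<union> ?Q2 \<union> ?Q3"
  then have "(\<exists>b c. p = normal_pair 1 2 3 4 b c (- c) b \<and> (Im b)\<^sup>2 + (Im
      c)\<^sup>2 \<noteq> 0) \<or>
      (\<exists>b c y. p = normal_pair 1 3 2 4 b c 0 y \<and> Im b \<noteq> 0 \<and> (y = \<i>
          \<or> y = - \<i>))"
    by (auto simp: normal_pair_def coordinates)
  then show "invariant_complex_subalgebra r2' (span_pair p)"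
    using invariant_r2'_1234 invariant_r2'_1324 by blast
next
  let ?rep = "\<lambda>b d. (e 1 + b *s e 2 + d *s e 4, e 3 + \<i> *s e 4) :: (complex ^ 4)
      \<times> (complex ^ 4)"
  \<comment> \<open>Both lists are instances of one family. Since a non-zero \<open>d\<close> occurs
    only as \<open>d = 1\<close> with \<open>b = \<i>\<close>, the invariants \<open>b\<close> and
    the vanishing of \<open>d\<close> at \<open>b = \<i>\<close> separate all members.\<close>
  have rep: "\<exists>b d. p = ?rep b d \<and> (d = 0 \<or> b = \<i> \<and> d = 1)" if "p \<in>
      ?R2 \<union> {?R3}" for p
  proof -
    have "(e 1 + b *s e 2, e 3 + \<i> *s e 4) = ?rep b 0" "?R3 = ?rep \<i> 1" for b
      by simp_all
    then show ?thesis
      using that by blast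
  qed
  have N: "\<not> equivalent_subalgebras r2' (span_pair p) (span_pair ?N)"
    "\<not> equivalent_subalgebras r2' (span_pair ?N) (span_pair p)" if "p \<in> ?R2 \<union>
        {?R3}" for p
    using rep[OF that] not_equivalent_r2'_abelian equivalent_subalgebras_sym by metis+
  have "p = p'" if pp': "p \<in> ?R2 \<union> {?R3}" "p' \<in> ?R2 \<union> {?R3}"
    "equivalent_subalgebras r2' (span_pair p) (span_pair p')" for p p'
  proof -
    obtain b d b' d' where "p = ?rep b d" "d = 0 \<or> b = \<i> \<and> d = 1"
      "p' = ?rep b' d'" "d' = 0 \<or> b' = \<i> \<and> d' = 1"
      using rep[OF pp'(1)] rep[OF pp'(2)] by blast
    moreover from this have "b = b' \<and> (b = \<i> \<longrightarrow> (d = 0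
        \<longleftrightarrow> d' = 0))"
      using not_equivalent_r2' pp'(3) by blast
    ultimately show ?thesis
      by auto
  qed
  then show "\<not> equivalent_subalgebras r2' (span_pair p) (span_pair p')"
    if "p \<in> {?N} \<union> ?R2 \<union> {?R3}" "p' \<in> {?N} \<union> ?R2 \<union> {?R3}" "p
        \<noteq> p'" for p p'
    using that N by blast
next
  fix p assume "p \<in> {?N} \<union> ?R2 \<union> {?R3}"
  then have "(p = normal_pair 1 2 3 4 \<i> 0 0 \<i>) \<or>
      (\<exists>b c. p = normal_pair 1 3 2 4 b c 0 \<i> \<and> Im b \<noteq> 0)"
    by (auto simp: normal_pair_def coordinates)
  then have "invariant_complex_subalgebra r2' (span_pair p)"
    by (auto simp: invariant_r2'_1234 invariant_r2'_1324)
  then show "p \<in> ?Q1 \<union> ?Q2 \<union> ?Q3 \<or> invariant_complex_subalgebra r2'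
      (span_pair p)" ..
qed

section \<open>Algebras without invariant complex subalgebras\<close>

lemma no_invariant_complex_subalgebra:
  assumes "coordinate_order j k l m"
    and "\<And>b c x y. \<not> invariant_complex_subalgebra br (span_pair (normal_pair j k l m b c
        x y))"
    and "\<And>b c y. \<not> invariant_complex_subalgebra br (span_pair (normal_pair j l k m b c 0
        y))"
  shows "\<not> invariant_complex_subalgebra br q"
proof
  assume "invariant_complex_subalgebra br q"
  with assms(1) show False
    by (cases rule: invariant_complex_subalgebra_normal_form)
      (use \<open>invariant_complex_subalgebra br q\<close> assms(2,3) in blast)+
qed

lemma no_invariant_rr3: "\<not> invariant_complex_subalgebra rr3 q"
  by (rule no_invariant_complex_subalgebra[OF coordinate_order(1)])
    (simp_all add: invariant_rr3_1324 invariant_rr3_1234)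

lemma no_invariant_rr3_par:
  "l \<noteq> 0 \<Longrightarrow> l \<noteq> 1 \<Longrightarrow> \<not>
      invariant_complex_subalgebra (rr3_par l) q"
  by (rule no_invariant_complex_subalgebra[OF coordinate_order(1)])
    (auto simp: invariant_rr3_par_1324 invariant_rr3_par_1234)

lemma no_invariant_n4: "\<not> invariant_complex_subalgebra n4 q"
  by (rule no_invariant_complex_subalgebra[OF coordinate_order(3)])
    (simp_all add: invariant_n4_4123 invariant_n4_4213)

lemma no_invariant_r4: "\<not> invariant_complex_subalgebra r4 q"
  by (rule no_invariant_complex_subalgebra[OF coordinate_order(3)])
    (simp_all add: invariant_r4_4123 invariant_r4_4213)

lemma no_invariant_r4_par: "m \<noteq> 1 \<Longrightarrow> \<not> invariant_complex_subalgebra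
    (r4_par m) q"
  by (rule no_invariant_complex_subalgebra[OF coordinate_order(3)])
    (simp_all add: invariant_r4_par_4123 invariant_r4_par_4213)

lemma no_invariant_r4_par2:
  assumes "\<alpha> \<noteq> 1" "\<beta> \<noteq> 1" "\<alpha> \<noteq> \<beta>"
  shows "\<not> invariant_complex_subalgebra (r4_par2 \<alpha> \<beta>) q"
  by (rule no_invariant_complex_subalgebra[OF coordinate_order(3)])
    (use assms in \<open>auto simp: invariant_r4_par2_4123 invariant_r4_par2_4213\<close>)

theorem proposition3p3:
  "classified_by rh3
      {(e 1 + \<i> *s e 2, e 3 + \<i> *s e 4)}
      {(e 1 + b1 *s e 2 + d1 *s e 4, e 3 + d2 *s e 4) | b1 d1 d2. Im b1 * Im d2 \<noteq> 0} \<and>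
   classified_by (rr3_par 0)
      {(e 1 + \<i> *s e 2, e 3 + \<i> *s e 4)}
      {(e 1 + b1 *s e 2 + d1 *s e 4, e 3 + d2 *s e 4) | b1 d1 d2. Im b1 * Im d2 \<noteq> 0} \<and>
   classified_by (rr3_par 1)
      {(e 1 + \<i> *s e 4, e 3 + \<i> *s e 2)}
      {(e 1 + b1 *s e 2 + d1 *s e 4, b2 *s e 2 + e 3) | b1 b2 d1. Im b2 * Im d1 \<noteq> 0} \<and>
   classified_by (rr3' 0)
      {(e 1 + \<i> *s e 4, e 2 + \<i> *s e 3)}
      {(e 1 + c1 *s e 3 + d1 *s e 4, e 2 - (complex_of_real \<epsilon> * \<i>) *s e 3) | c1 d1 \<epsilon>.
         \<epsilon> \<in> {1, -1} \<and> Im d1 \<noteq> 0} \<and>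
   (\<forall>\<gamma>>0. classified_by (rr3' \<gamma>)
      {(e 1 + \<i> *s e 4, e 2 - \<i> *s e 3), (e 1 + \<i> *s e 4, e 2 + \<i> *s e 3)}
      {(e 1 + c1 *s e 3 + d1 *s e 4, e 2 - (complex_of_real \<epsilon> * \<i>) *s e 3) | c1 d1 \<epsilon>.
         \<epsilon> \<in> {1, -1} \<and> Im d1 \<noteq> 0}) \<and>
   classified_by r2r2
      {(e 1 + \<i> *s e 2, e 3 + \<i> *s e 4)}
      {(e 1 + b1 *s e 2 + d1 *s e 4, e 3 + d2 *s e 4) | b1 d1 d2.
         Im b1 * Im d2 \<noteq> 0 \<and>
         complex_subalgebra r2r2 (span_pair (e 1 + b1 *s e 2 + d1 *s e 4, e 3 + d2 *s e 4))} \<and>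
   classified_by r2'
      ({(e 1 + \<i> *s e 3, e 2 + \<i> *s e 4)} \<union>
       {(e 1 + b1 *s e 2, e 3 + \<i> *s e 4) | b1. Im b1 \<noteq> 0} \<union>
       {(e 1 + \<i> *s e 2 + e 4, e 3 + \<i> *s e 4)})
      ({(e 1 + c1 *s e 3 + d1 *s e 4, e 2 - d1 *s e 3 + c1 *s e 4) | c1 d1.
          (Im c1)\<^sup>2 + (Im d1)\<^sup>2 \<noteq> 0} \<union>
       {(e 1 + (complex_of_real \<epsilon> * \<i>) *s e 2 + d1 *s e 4,
         e 3 - (complex_of_real \<epsilon> * \<i>) *s e 4) | d1 \<epsilon>. \<epsilon> \<in> {1, -1}} \<union>
       {(e 1 + b1 *s e 2 + d1 *s e 4, e 3 + (complex_of_real \<epsilon> * \<i>) *s e 4) | b1 d1 \<epsilon>.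
          \<epsilon> \<in> {1, -1} \<and> Im b1 \<noteq> 0}) \<and>
   classified_by (r4_par 1)
      {(e 4 + \<i> *s e 3, e 1 + \<i> *s e 2)}
      {(e 4 + b1 *s e 2 + c1 *s e 3, e 1 + b2 *s e 2) | b1 b2 c1. Im c1 * Im b2 \<noteq> 0} \<and>
   (\<forall>\<alpha>. \<alpha> \<noteq> 0 \<and> -1 \<le> \<alpha> \<and> \<alpha> \<le> 1 \<and> \<alpha> \<noteq> 1 \<longrightarrow> classified_by (r4_par2 \<alpha> 1)
      {(e 4 + \<i> *s e 2, e 1 + \<i> *s e 3)}
      {(e 4 + b1 *s e 2 + c1 *s e 3, e 1 + c2 *s e 3) | b1 c1 c2. Im b1 * Im c2 \<noteq> 0}) \<and>
   (\<forall>\<alpha>. \<alpha> \<noteq> 0 \<and> -1 \<le> \<alpha> \<and> \<alpha> \<le> 1 \<and> \<alpha> \<noteq> 1 \<longrightarrow> classified_by (r4_par2 \<alpha> \<alpha>)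
      {(e 4 + \<i> *s e 1, e 2 + \<i> *s e 3)}
      {(e 4 + a1 *s e 1 + c1 *s e 3, a2 *s e 1 + e 2 + c2 *s e 3) | a1 a2 c1 c2.
         Im c1 * Im a2 - Im a1 * Im c2 \<noteq> 0 \<and>
         complex_subalgebra (r4_par2 \<alpha> \<alpha>)
           (span_pair (e 4 + a1 *s e 1 + c1 *s e 3, a2 *s e 1 + e 2 + c2 *s e 3))}) \<and>
   (\<forall>\<gamma> \<delta>. \<delta> > 0 \<longrightarrow> classified_by (r4' \<gamma> \<delta>)
      {(e 4 + \<i> *s e 1, e 2 + \<i> *s e 3), (e 4 + \<i> *s e 1, e 2 - \<i> *s e 3)}
      {(e 4 + a1 *s e 1 + c1 *s e 3, e 2 + (complex_of_real \<epsilon> * \<i>) *s e 3) | a1 c1 \<epsilon>.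
         \<epsilon> \<in> {1, -1} \<and> Im a1 \<noteq> 0}) \<and>
   classified_by d4
      {(e 1 - \<i> *s e 3, e 4 + \<i> *s e 2), (e 4 + \<i> *s (e 2 + e 3), e 1 - \<i> *s e 3)}
      ({(e 4 + b1 *s e 2 + c1 *s e 3, e 1 - b1 *s e 3) | b1 c1. Im b1 \<noteq> 0} \<union>
       {(e 4 + a1 *s e 1 + c1 *s e 3, e 2 - a1 *s e 3) | a1 c1. Im a1 \<noteq> 0}) \<and>
   classified_by (d4_par 1)
      {(e 4 - \<i> *s e 1, e 2 + \<i> *s e 3)}
      {(e 4 - c2 *s e 1 + c1 *s e 3, e 2 + c2 *s e 3) | c1 c2. Im c2 \<noteq> 0} \<and>
   classified_by (d4_par (1 / 2))
      {(e 4 + \<i> *s e 3, e 1 + \<i> *s e 2), (e 4 + \<i> *s e 3, e 1 - \<i> *s e 2),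
       (e 4 + \<i> *s e 1, e 2 - (2 * \<i>) *s e 3)}
      ({(e 4 + b1 *s e 2 + c1 *s e 3, e 1 + b2 *s e 2 + (2 * b1) *s e 3) | b1 b2 c1.
          2 * (Im b1)\<^sup>2 - Im c1 * Im b2 \<noteq> 0} \<union>
       {(e 4 + a1 *s e 1 + c1 *s e 3, a2 *s e 1 + e 2 - (2 * a1) *s e 3) | a1 a2 c1.
          2 * (Im a1)\<^sup>2 + Im c1 * Im a2 \<noteq> 0}) \<and>
   (\<forall>l::real. l \<ge> 1 / 2 \<and> l \<noteq> 1 / 2 \<and> l \<noteq> 1 \<longrightarrow> classified_by (d4_par l)
      {(e 4 - (complex_of_real l * \<i>) *s e 1, e 2 + \<i> *s e 3),
       (e 4 + (complex_of_real (1 - l) * \<i>) *s e 2, e 1 + \<i> *s e 3)}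
      ({(e 4 - (complex_of_real l * c2) *s e 1 + c1 *s e 3, e 2 + c2 *s e 3) | c1 c2.
          Im c2 \<noteq> 0} \<union>
       {(e 4 + (complex_of_real (1 - l) * c2) *s e 2 + c1 *s e 3, e 1 + c2 *s e 3) | c1 c2.
          Im c2 \<noteq> 0})) \<and>
   classified_by (d4' 0)
      {(e 4 - \<i> *s e 3, e 1 + \<i> *s e 2), (e 4 + \<i> *s e 3, e 1 + \<i> *s e 2)}
      {(e 4 + c1 *s e 3 - (complex_of_real \<epsilon> * \<i> * c2) *s e 2,
        c2 *s e 3 + e 1 + (complex_of_real \<epsilon> * \<i>) *s e 2) | c1 c2 \<epsilon>.
         \<epsilon> \<in> {1, -1} \<and> Re c2 * Im c2 + Im c1 \<noteq> 0} \<and>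
   (\<forall>\<delta>>0. classified_by (d4' \<delta>)
      {(e 4 + \<i> *s e 3, e 1 - \<i> *s e 2), (e 4 - \<i> *s e 3, e 1 + \<i> *s e 2),
       (e 4 + \<i> *s e 3, e 1 + \<i> *s e 2), (e 4 - \<i> *s e 3, e 1 - \<i> *s e 2)}
      {(e 4 + c1 *s e 3 + ((complex_of_real (\<delta> / 2) - complex_of_real \<epsilon> * \<i>) * c2) *s e 2,
        e 1 + (complex_of_real \<epsilon> * \<i>) *s e 2 + c2 *s e 3) | c1 c2 \<epsilon>.
         \<epsilon> \<in> {1, -1} \<and>
         \<epsilon> * Im c1 + Im c2 * (- (\<delta> / 2) * Im c2 + \<epsilon> * Re c2) \<noteq> 0}) \<and>
   classified_by h4
      {(e 4 + \<i> *s e 2, e 1 + (2 * \<i>) *s e 3)}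
      {(e 4 + b1 *s e 2 + c1 *s e 3, e 1 + (2 * b1) *s e 3) | b1 c1. Im b1 \<noteq> 0} \<and>
   (\<forall>q. \<not> invariant_complex_subalgebra rr3 q) \<and>
   (\<forall>l q. -1 \<le> l \<and> l \<le> 1 \<and> l \<noteq> 0 \<and> l \<noteq> 1 \<longrightarrow>
      \<not> invariant_complex_subalgebra (rr3_par l) q) \<and>
   (\<forall>q. \<not> invariant_complex_subalgebra n4 q) \<and>
   (\<forall>q. \<not> invariant_complex_subalgebra r4 q) \<and>
   (\<forall>\<mu> q. \<mu> \<noteq> 1 \<longrightarrow> \<not> invariant_complex_subalgebra (r4_par \<mu>) q) \<and>
   (\<forall>\<alpha> \<beta> q. \<alpha> * \<beta> \<noteq> 0 \<and> -1 \<le> \<alpha> \<and> \<alpha> \<le> \<beta> \<and> \<beta> \<le> 1 \<and> \<beta> \<noteq> 1 \<and> \<alpha> \<noteq> \<beta> \<longrightarrow>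
      \<not> invariant_complex_subalgebra (r4_par2 \<alpha> \<beta>) q)"
  by (intro conjI allI impI classified_rh3 classified_rr3_par_0 classified_rr3_par_1
      classified_rr3'_0
      classified_rr3'_pos classified_r2r2 classified_r2' classified_r4_par_1 classified_r4_par2_1
      classified_r4_par2_same classified_r4' classified_d4 classified_d4_par_1
          classified_d4_par_half
      classified_d4_par classified_d4'_0 classified_d4'_pos classified_h4 no_invariant_rr3
      no_invariant_rr3_par no_invariant_n4 no_invariant_r4 no_invariant_r4_par no_invariant_r4_par2)
    auto

end
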